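(* Consider a sharp theory with purification and a system $A$ of dimension $d$. A function $P:\mathsf{St}_1(A)\to\mathbb R$ on the normalised states of $A$ is a unital purity monotone if and only if there is a Schur-convex function $f:\mathbb R^d\to\mathbb R$ such that $P(\rho)=f(\mathbf p)$ for every $\rho\in\mathsf{St}_1(A)$, where $\mathbf p$ is the spectrum of $\rho$.
   Context: Framework. A causal operational probabilistic theory (OPT) has systems $A,B,\dots$ (including a trivial system $I$), with associative composites $AB$ ($AI=IA=A$; $AB$ and $BA$ related by a reversible swap), and tests. A test from $A$ to $B$ is a finite family $\{\mathcal C_i\}_{i\in X}$ of transformations from $A$ to $B$. Tests are closed under sequential composition, parallel composition $\otimes$ and coarse-graining (summing transformations over the blocks of a partition of $X$); identities $\mathcal I_A$ and swaps are one-outcome tests; systems and transformations form a strict symmetric monoidal category. Tests on $I$ are probability distributions, numbers compose by multiplication, and all probabilities in $[0,1]$ are available. A state of $A$ is a transformation $I\to A$, an effect is a transformation $A\to I$, $(a|\rho)\in[0,1]$ is their composition; tests $A\to I$ are observation-tests. States (effects) are equal iff they have the same pairing with all effects (states); transformations $\mathcal C,\mathcal C'$ from $A$ to $B$ are equal iff $(\mathcal C\otimes\mathcal I_S)\rho=(\mathcal C'\otimes\mathcal I_S)\rho$ for every system $S$ and state $\rho$ of $AS$. The spanned real vector spaces are finite-dimensional; the sets of states, effects and transformations are closed (hence compact). Every test $\{\mathcal A_i\}$ from $A$ to $B$ has the form $\mathcal A_i=(\mathcal I_B\otimes e_i)\mathcal A$ with $\mathcal A$ a deterministic transformation from $A$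 to some $BX$ and $\{e_i\}$ an observation-test on $X$. A channel is a deterministic (one-outcome-test) transformation; it is reversible if it has an inverse channel. A transformation $\mathcal T$ is pure if whenever $\mathcal T=\sum_{i\in X_0}\mathcal D_i$ with $X_0\subseteq X$ and $\{\mathcal D_i\}_{i\in X}$ a test, every $\mathcal D_i$, $i\in X_0$, is a multiple of $\mathcal T$. Causality: every system has a unique deterministic effect $u_A$; the marginal on $A$ of a state of $AB$ is obtained by applying $u_B$. A state is normalised if $(u|\rho)=1$ (set $\mathsf{St}_1(A)$). Tests may be chosen conditionally on earlier outcomes and randomised, so $\mathsf{St}_1(A)$ is convex; every nonzero state is a multiple of a normalised one. A sharp theory with purification is a causal OPT satisfying: Purity Preservation (sequential and parallel compositions of pure transformations are pure); Pure Sharpness (for every system there is a pure effect $a$ and a state $\rho$ with $(a|\rho)=1$); Purification (every normalised state $\rho$ of $A$ is the marginal of a normalised pure state of some composite $AB$, and if two normalised pure states $\Psi,\Psi'$ of $AB$ have the same marginal on $A$ then $\Psi'=(\mathcal I_A\otimes\mathcal U)\Psi$ for a reversible channel $\mathcal U$ on $B$). Normalised states $\{\rho_i\}$ are perfectly distinguishable if there is an observation-test $\{a_i\}$ with $(a_i|\rho_j)=\delta_{ij}$. A pure maximal set is a set of perfectly distinguishable normalised pure states to which no state can be added keeping perfect distinguishability. Facts fixing notation in sharp theories with purification: all pure maximal sets of a system have the same cardinality $d$ (its dimension); every normalised state can be written $\rho=\sum_{i=1}^dp_i\alpha_i$ with $\{\alpha_i\}_{i=1}^d$ a pure maximal set and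 $\{p_i\}$ a probability distribution, and the vector $\mathbf p\in\mathbb R^d$ (the spectrum) is unique up to reordering; there is a unique normalised state $\chi$ invariant under all reversible channels (the microcanonical state). A channel $\mathcal D$ on $A$ is unital if $\mathcal D\chi_A=\chi_A$. $P:\mathsf{St}_1(A)\to\mathbb R$ is a unital purity monotone if $P(\rho)\ge P(\sigma)$ whenever $\sigma=\mathcal D\rho$ for some unital channel $\mathcal D$. For $\mathbf x,\mathbf y\in\mathbb R^d$, $\mathbf x\preceq\mathbf y$ ($\mathbf y$ majorises $\mathbf x$) means that, with entries in decreasing order, $\sum_{i=1}^ky_i\ge\sum_{i=1}^kx_i$ for $k<d$ and $\sum_{i=1}^dy_i=\sum_{i=1}^dx_i$. $f:\mathbb R^d\to\mathbb R$ is Schur-convex if $\mathbf x\preceq\mathbf y$ implies $f(\mathbf x)\le f(\mathbf y)$. *)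

theory Defs
  imports "HOL-Analysis.Analysis"
begin

section \<open>Causal operational probabilistic theories\<close>

text \<open>
  Every element of \<open>'s\<close> is a system.  \<open>tests T A B\<close> contains the tests from \<open>A\<close> to \<open>B\<close>; a test is
  written as a list, so that its outcome set is \<open>{..<length cs}\<close> (reordering the outcomes is a
  coarse-graining).  \<open>prob\<close> reads a transformation of the trivial system as a number.
  Composition is written in the usual order: \<open>D \<cdot>\<^bsub>T\<^esub> C\<close> is \<open>C\<close> followed by \<open>D\<close>.
\<close>

record ('s, 't) opt =
  triv :: 's ("\<one>\<index>")
  sys_prod :: "'s \<Rightarrow> 's \<Rightarrow> 's" (infixl "\<odot>\<index>" 75)
  tests :: "'s \<Rightarrow> 's \<Rightarrow> 't list set"
  seq_comp :: "'t \<Rightarrow> 't \<Rightarrow> 't" (infixr "\<cdot>\<index>" 65)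
  par_comp :: "'t \<Rightarrow> 't \<Rightarrow> 't" (infixl "\<otimes>\<index>" 75)
  ident :: "'s \<Rightarrow> 't"
  swap :: "'s \<Rightarrow> 's \<Rightarrow> 't"
  prob :: "'t \<Rightarrow> real"

locale opt_data =
  fixes T :: "('s, 't) opt" (structure)
begin

definition transf :: "'s \<Rightarrow> 's \<Rightarrow> 't set" where
  "transf A B = (\<Union>cs \<in> tests T A B. set cs)"

definition states :: "'s \<Rightarrow> 't set" where
  "states A = transf \<one> A"

definition effects :: "'s \<Rightarrow> 't set" where
  "effects A = transf A \<one>"

definition channel :: "'s \<Rightarrow> 's \<Rightarrow> 't \<Rightarrow> bool" where
  "channel A B C \<longleftrightarrow> [C] \<in> tests T A B"

definition reversible :: "'s \<Rightarrow> 's \<Rightarrow> 't \<Rightarrow> bool" where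
  "reversible A B U \<longleftrightarrow> channel A B U \<and>
     (\<exists>V. channel B A V \<and> V \<cdot> U = ident T A \<and> U \<cdot> V = ident T B)"

text \<open>
  A transformation from \<open>A\<close> to \<open>B\<close> is represented as a vector by the numbers \<open>(E|(C \<otimes> I\<^sub>S)|\<rho>)\<close>, for all
  systems \<open>S\<close>, states \<open>\<rho>\<close> of \<open>AS\<close> and effects \<open>E\<close> of \<open>BS\<close>.  These vectors span the real vector space
  of transformations from \<open>A\<close> to \<open>B\<close>.  For states and effects the ancilla \<open>S\<close> adds no information:
  \<open>E\<close> and \<open>\<rho>\<close> combine to an effect (respectively a state) of the system itself.
\<close>

definition vect :: "'s \<Rightarrow> 's \<Rightarrow> 't \<Rightarrow> 's \<times> 't \<times> 't \<Rightarrow> real" where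
  "vect A B C = (\<lambda>(S, \<rho>, E).
     if \<rho> \<in> states (A \<odot> S) \<and> E \<in> effects (B \<odot> S)
     then prob T (E \<cdot> (C \<otimes> ident T S) \<cdot> \<rho>) else 0)"

definition is_lincomb ::
    "'s \<Rightarrow> 's \<Rightarrow> 't \<Rightarrow> 'i set \<Rightarrow> ('i \<Rightarrow> real) \<Rightarrow> ('i \<Rightarrow> 't) \<Rightarrow> bool" where
  "is_lincomb A B C X r D \<longleftrightarrow> (\<forall>z. vect A B C z = (\<Sum>i\<in>X. r i * vect A B (D i) z))"

definition is_sum :: "'s \<Rightarrow> 's \<Rightarrow> 't \<Rightarrow> 'i set \<Rightarrow> ('i \<Rightarrow> 't) \<Rightarrow> bool" where
  "is_sum A B C X D \<longleftrightarrow> is_lincomb A B C X (\<lambda>_. 1) D"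

definition is_multiple :: "'s \<Rightarrow> 's \<Rightarrow> 't \<Rightarrow> 't \<Rightarrow> bool" where
  "is_multiple A B D C \<longleftrightarrow> (\<exists>r. \<forall>z. vect A B D z = r * vect A B C z)"

definition pure :: "'s \<Rightarrow> 's \<Rightarrow> 't \<Rightarrow> bool" where
  "pure A B C \<longleftrightarrow> C \<in> transf A B \<and>
     (\<forall>ds \<in> tests T A B. \<forall>X \<subseteq> {..<length ds}.
        is_sum A B C X (\<lambda>i. ds ! i) \<longrightarrow> (\<forall>i\<in>X. is_multiple A B (ds ! i) C))"

definition discard :: "'s \<Rightarrow> 't" where
  "discard A = (THE u. channel A \<one> u)"

definition normalised_states :: "'s \<Rightarrow> 't set" where
  "normalised_states A = {\<rho> \<in> states A. prob T (discard A \<cdot> \<rho>) = 1}"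

definition marginal :: "'s \<Rightarrow> 's \<Rightarrow> 't \<Rightarrow> 't" where
  "marginal A B \<Psi> = (ident T A \<otimes> discard B) \<cdot> \<Psi>"

end

locale causal_opt = opt_data +
  assumes sys_assoc: "(A \<odot> B) \<odot> C = A \<odot> (B \<odot> C)"
    and sys_unit: "A \<odot> \<one> = A" "\<one> \<odot> A = A"
    and seq_assoc: "F \<in> transf A B \<Longrightarrow> G \<in> transf B C \<Longrightarrow> H \<in> transf C D \<Longrightarrow>
      (H \<cdot> G) \<cdot> F = H \<cdot> (G \<cdot> F)"
    and seq_ident: "F \<in> transf A B \<Longrightarrow> F \<cdot> ident T A = F"
      "F \<in> transf A B \<Longrightarrow> ident T B \<cdot> F = F"
    and par_assoc: "F \<in> transf A A' \<Longrightarrow> G \<in> transf B B' \<Longrightarrow> H \<in> transf C C' \<Longrightarrow>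
      (F \<otimes> G) \<otimes> H = F \<otimes> (G \<otimes> H)"
    and par_unit: "F \<in> transf A B \<Longrightarrow> F \<otimes> ident T \<one> = F"
      "F \<in> transf A B \<Longrightarrow> ident T \<one> \<otimes> F = F"
    and par_ident: "ident T A \<otimes> ident T B = ident T (A \<odot> B)"
    and interchange: "F \<in> transf A B \<Longrightarrow> F' \<in> transf B C \<Longrightarrow> G \<in> transf A' B' \<Longrightarrow> G' \<in> transf B' C' \<Longrightarrow>
      (F' \<cdot> F) \<otimes> (G' \<cdot> G) = (F' \<otimes> G') \<cdot> (F \<otimes> G)"
    and swap_natural: "F \<in> transf A A' \<Longrightarrow> G \<in> transf B B' \<Longrightarrow>
      swap T A' B' \<cdot> (F \<otimes> G) = (G \<otimes> F) \<cdot> swap T A B"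
    and swap_inverse: "swap T B A \<cdot> swap T A B = ident T (A \<odot> B)"
    and swap_hexagon: "swap T A (B \<odot> C) =
      (ident T B \<otimes> swap T A C) \<cdot> (swap T A B \<otimes> ident T C)"
    and ident_channel: "channel A A (ident T A)"
    and swap_channel: "channel (A \<odot> B) (B \<odot> A) (swap T A B)"
  \<comment> \<open>The choice of \<open>Ds\<close> may depend on the outcome \<open>i\<close>; constant \<open>Ds\<close> gives plain sequential composition,
    and composition with a test on \<open>\<one>\<close> gives randomisation.\<close>
    and test_conditional: "cs \<in> tests T A B \<Longrightarrow> (\<And>i. i < length cs \<Longrightarrow> Ds i \<in> tests T B C) \<Longrightarrow>
      concat (map (\<lambda>i. map (\<lambda>G. G \<cdot> (cs ! i)) (Ds i)) [0..<length cs]) \<in> tests T A C"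
    and test_parallel: "cs \<in> tests T A B \<Longrightarrow> ds \<in> tests T A' B' \<Longrightarrow>
      [F \<otimes> G. F \<leftarrow> cs, G \<leftarrow> ds] \<in> tests T (A \<odot> A') (B \<odot> B')"
    and test_coarse_graining: "cs \<in> tests T A B \<Longrightarrow> h ` {..<length cs} = {..<m} \<Longrightarrow>
      \<exists>es \<in> tests T A B. length es = m \<and>
        (\<forall>j<m. is_sum A B (es ! j) {i. i < length cs \<and> h i = j} (\<lambda>i. cs ! i))"
    and prob_bij: "bij_betw (prob T) (transf \<one> \<one>) {0..1}"
    and prob_seq: "p \<in> transf \<one> \<one> \<Longrightarrow> q \<in> transf \<one> \<one> \<Longrightarrow> prob T (q \<cdot> p) = prob T q * prob T p"
    and tests_triv: "cs \<in> tests T \<one> \<one> \<longleftrightarrow>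
      set cs \<subseteq> transf \<one> \<one> \<and> sum_list (map (prob T) cs) = 1"
    and states_eqI: "\<rho> \<in> states A \<Longrightarrow> \<sigma> \<in> states A \<Longrightarrow>
      (\<And>a. a \<in> effects A \<Longrightarrow> prob T (a \<cdot> \<rho>) = prob T (a \<cdot> \<sigma>)) \<Longrightarrow> \<rho> = \<sigma>"
    and effects_eqI: "a \<in> effects A \<Longrightarrow> b \<in> effects A \<Longrightarrow>
      (\<And>\<rho>. \<rho> \<in> states A \<Longrightarrow> prob T (a \<cdot> \<rho>) = prob T (b \<cdot> \<rho>)) \<Longrightarrow> a = b"
    and transf_eqI: "F \<in> transf A B \<Longrightarrow> G \<in> transf A B \<Longrightarrow>
      (\<And>S \<rho>. \<rho> \<in> states (A \<odot> S) \<Longrightarrow> (F \<otimes> ident T S) \<cdot> \<rho> = (G \<otimes> ident T S) \<cdot> \<rho>) \<Longrightarrow> F = G"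
  \<comment> \<open>finite dimension and closedness; on a finite-dimensional space of functions the topology of
    pointwise convergence, which \<open>closed\<close> refers to here, is the usual topology\<close>
    and finite_dimensional: "\<exists>X. finite X \<and> X \<subseteq> transf A B \<and>
      (\<forall>F \<in> transf A B. \<exists>r. is_lincomb A B F X r (\<lambda>G. G))"
    and closed_transf: "closed (vect A B ` transf A B)"
    and test_dilation: "cs \<in> tests T A B \<Longrightarrow>
      \<exists>X F es. channel A (B \<odot> X) F \<and> es \<in> tests T X \<one> \<and> length es = length cs \<and>
        (\<forall>i < length cs. cs ! i = (ident T B \<otimes> (es ! i)) \<cdot> F)"
    and causality: "\<exists>!u. channel A \<one> u"
    and normalisable: "\<rho> \<in> states A \<Longrightarrow> (\<exists>z. vect \<one> A \<rho> z \<noteq> 0) \<Longrightarrow>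
      \<exists>\<sigma> \<in> normalised_states A. is_multiple \<one> A \<rho> \<sigma>"

section \<open>Sharp theories with purification\<close>

locale sharp_theory_with_purification = causal_opt +
  assumes pure_seq: "pure A B F \<Longrightarrow> pure B C G \<Longrightarrow> pure A C (G \<cdot> F)"
    and pure_par: "pure A B F \<Longrightarrow> pure A' B' G \<Longrightarrow> pure (A \<odot> A') (B \<odot> B') (F \<otimes> G)"
    and pure_sharpness: "\<exists>a \<rho>. pure A \<one> a \<and> \<rho> \<in> states A \<and> prob T (a \<cdot> \<rho>) = 1"
    and purification_exists: "\<rho> \<in> normalised_states A \<Longrightarrow>
      \<exists>B. \<exists>\<Psi> \<in> normalised_states (A \<odot> B). pure \<one> (A \<odot> B) \<Psi> \<and> marginal A B \<Psi> = \<rho>"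
    and purification_unique:
      "\<Psi> \<in> normalised_states (A \<odot> B) \<Longrightarrow> pure \<one> (A \<odot> B) \<Psi> \<Longrightarrow>
       \<Psi>' \<in> normalised_states (A \<odot> B) \<Longrightarrow> pure \<one> (A \<odot> B) \<Psi>' \<Longrightarrow>
       marginal A B \<Psi> = marginal A B \<Psi>' \<Longrightarrow>
       \<exists>U. reversible B B U \<and> \<Psi>' = (ident T A \<otimes> U) \<cdot> \<Psi>"

section \<open>Dimension, spectra and unital purity monotones\<close>

context opt_data
begin

definition perfectly_distinguishable :: "'s \<Rightarrow> 't list \<Rightarrow> bool" where
  "perfectly_distinguishable A \<rho>s \<longleftrightarrow> set \<rho>s \<subseteq> normalised_states A \<and>
     (\<exists>as \<in> tests T A \<one>. length as = length \<rho>s \<and>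
        (\<forall>i < length \<rho>s. \<forall>j < length \<rho>s. prob T ((as ! i) \<cdot> (\<rho>s ! j)) = (if i = j then 1 else 0)))"

text \<open>A pure maximal set is given by an enumeration; perfect distinguishability forces the entries
  to be distinct.\<close>

definition pure_maximal_set :: "'s \<Rightarrow> 't list \<Rightarrow> bool" where
  "pure_maximal_set A \<alpha>s \<longleftrightarrow> (\<forall>\<alpha> \<in> set \<alpha>s. pure \<one> A \<alpha>) \<and> perfectly_distinguishable A \<alpha>s \<and>
     \<not> (\<exists>\<sigma>. perfectly_distinguishable A (\<alpha>s @ [\<sigma>]))"

definition dimension :: "'s \<Rightarrow> nat" where
  "dimension A = (THE d. \<exists>\<alpha>s. pure_maximal_set A \<alpha>s \<and> length \<alpha>s = d)"

text \<open>The spectrum is determined only up to reordering, hence a relation.\<close>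

definition is_spectrum :: "'s \<Rightarrow> 't \<Rightarrow> real list \<Rightarrow> bool" where
  "is_spectrum A \<rho> p \<longleftrightarrow> (\<forall>x \<in> set p. 0 \<le> x) \<and> sum_list p = 1 \<and>
     (\<exists>\<alpha>s. pure_maximal_set A \<alpha>s \<and> length \<alpha>s = length p \<and>
        is_lincomb \<one> A \<rho> {..<length p} (\<lambda>i. p ! i) (\<lambda>i. \<alpha>s ! i))"

definition microcanonical :: "'s \<Rightarrow> 't" where
  "microcanonical A =
     (THE \<rho>. \<rho> \<in> normalised_states A \<and> (\<forall>U. reversible A A U \<longrightarrow> U \<cdot> \<rho> = \<rho>))"

definition unital :: "'s \<Rightarrow> 't \<Rightarrow> bool" where
  "unital A D \<longleftrightarrow> channel A A D \<and> D \<cdot> microcanonical A = microcanonical A"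

definition unital_purity_monotone :: "'s \<Rightarrow> ('t \<Rightarrow> real) \<Rightarrow> bool" where
  "unital_purity_monotone A P \<longleftrightarrow>
     (\<forall>\<rho> \<in> normalised_states A. \<forall>\<sigma> \<in> normalised_states A.
        (\<exists>D. unital A D \<and> \<sigma> = D \<cdot> \<rho>) \<longrightarrow> P \<rho> \<ge> P \<sigma>)"

end

text \<open>Vectors in \<open>\<real>\<^sup>d\<close> are real lists of length \<open>d\<close>.\<close>

definition majorised_by :: "real list \<Rightarrow> real list \<Rightarrow> bool" (infix "\<preceq>" 50) where
  "x \<preceq> y \<longleftrightarrow> length x = length y \<and>
     (\<forall>k < length x. sum_list (take k (rev (sort x))) \<le> sum_list (take k (rev (sort y)))) \<and>
     sum_list x = sum_list y"

definition schur_convex :: "nat \<Rightarrow> (real list \<Rightarrow> real) \<Rightarrow> bool" where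
  "schur_convex d f \<longleftrightarrow>
     (\<forall>x y. length x = d \<longrightarrow> length y = d \<longrightarrow> x \<preceq> y \<longrightarrow> f x \<le> f y)"

end

theory Submission
  imports Defs
begin

text \<open>
  A composite of a system with its purifying system carries a steering principle: every transformation
  test is obtained from a pure state \<open>\<Psi>\<close> by prescribing an ensemble with the right marginal.  Steering
  from a purification of an internal state shows that identities are pure, so pure effects map pure
  bipartite states to pure states.  A pure effect occurring with certainty then occurs with certainty
  on exactly one state, which is pure.  Let \<open>\<Phi>\<close> purify a state \<open>\<mu>\<close> invariant under all
  reversible channels (\<open>\<mu>\<close> minimises a strictly convex invariant function).  All pure states have the
  same weight \<open>q\<close> in \<open>\<mu>\<close>, and steering with \<open>\<Phi>\<close> gives: an effect that is certain on a pure state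
  dominates the pure effect of that state.  Hence pure states that are orthogonal one after the other are
  perfectly distinguishable, every pure maximal set has \<open>1/q\<close> elements and averages to \<open>\<mu>\<close>, and removing a
  pure component of maximal weight again and again diagonalises every state.  Unital channels
  therefore act on spectra by doubly stochastic matrices, and conversely each doubly stochastic matrix is
  realised by a measure-and-prepare channel, which is unital.
\<close>

section \<open>Majorisation and doubly stochastic matrices\<close>

text \<open>The constants \<open>dimension\<close> and \<open>microcanonical\<close> are definite
  descriptions, so the facts behind them (equal sizes of pure maximal sets, uniqueness of the
  invariant state), and with them the existence of spectra, are derived from the axioms before the
  equivalence itself. Two obstacles shape the derivation. The reversible channels come without an
  invariant measure and the states without an ambient linear space; compactness together with
  finitely many spanning effects or states takes the place of both. Moreover, effects of different
  tests need not a priori fit into one test, and an effect need not a priori have a prescribed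
  refinement. Steering supplies both, because ensembles of states with a prescribed marginal can be
  assembled freely. The weight \<open>q\<close> is common to all pure states because reversible
  channels act transitively on them: their sharp effects can be chosen in one orbit, on which an
  invariant state is constant. Most identifications of states are then squeezes: a joint probability
  in \<open>\<Phi>\<close> that is at least \<open>q\<close> and at most \<open>q\<close> makes some
  pure effect certain, and certainty determines the state.\<close>

definition doubly_stochastic :: "nat \<Rightarrow> (nat \<Rightarrow> nat \<Rightarrow> real) \<Rightarrow> bool" where
  "doubly_stochastic n S \<longleftrightarrow> (\<forall>i<n. \<forall>j<n. 0 \<le> S i j) \<and>
     (\<forall>i<n. (\<Sum>j<n. S i j) = 1) \<and> (\<forall>j<n. (\<Sum>i<n. S i j) = 1)"

lemma doubly_stochasticI:
  assumes "\<And>i j. i < n \<Longrightarrow> j < n \<Longrightarrow> 0 \<le> S i j"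
    and "\<And>i. i < n \<Longrightarrow> (\<Sum>j<n. S i j) = 1" "\<And>j. j < n \<Longrightarrow> (\<Sum>i<n. S i j) = 1"
  shows "doubly_stochastic n S"
  using assms by (simp add: doubly_stochastic_def)

lemma doubly_stochasticD:
  assumes "doubly_stochastic n S"
  shows "i < n \<Longrightarrow> j < n \<Longrightarrow> 0 \<le> S i j" "i < n \<Longrightarrow> (\<Sum>j<n. S i j) = 1" "j < n \<Longrightarrow> (\<Sum>i<n. S i j) = 1"
  using assms by (simp_all add: doubly_stochastic_def)

lemma doubly_stochastic_mult:
  assumes "doubly_stochastic n R" "doubly_stochastic n S"
  shows "doubly_stochastic n (\<lambda>i j. \<Sum>l<n. R i l * S l j)"
proof (rule doubly_stochasticI)
  show "0 \<le> (\<Sum>l<n. R i l * S l j)" if "i < n" "j < n" for i j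
    using that doubly_stochasticD(1)[OF assms(1)] doubly_stochasticD(1)[OF assms(2)] by (intro sum_nonneg) simp
  show "(\<Sum>j<n. \<Sum>l<n. R i l * S l j) = 1" if "i < n" for i
  proof -
    have "(\<Sum>j<n. \<Sum>l<n. R i l * S l j) = (\<Sum>l<n. R i l * (\<Sum>j<n. S l j))"
      unfolding sum_distrib_left by (rule sum.swap)
    then show ?thesis using that doubly_stochasticD(2)[OF assms(1)] doubly_stochasticD(2)[OF assms(2)] by simp
  qed
  show "(\<Sum>i<n. \<Sum>l<n. R i l * S l j) = 1" if "j < n" for j
  proof -
    have "(\<Sum>i<n. \<Sum>l<n. R i l * S l j) = (\<Sum>l<n. (\<Sum>i<n. R i l) * S l j)"
      unfolding sum_distrib_right by (rule sum.swap)
    then show ?thesis using that doubly_stochasticD(3)[OF assms(1)] doubly_stochasticD(3)[OF assms(2)] by simp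
  qed
qed

lemma doubly_stochastic_permute:
  assumes "doubly_stochastic n S" "p permutes {..<n}" "r permutes {..<n}"
  shows "doubly_stochastic n (\<lambda>i j. S (p i) (r j))"
proof -
  have mem: "p i < n" "r i < n" if "i < n" for i
    using permutes_in_image[OF assms(2), of i] permutes_in_image[OF assms(3), of i] that by simp_all
  have "(\<Sum>j<n. S (p i) (r j)) = (\<Sum>j<n. S (p i) j)" "(\<Sum>i<n. S (p i) (r j)) = (\<Sum>i<n. S i (r j))" for i j
    using sum.reindex_bij_betw[OF permutes_imp_bij[OF assms(3)], of "\<lambda>j. S (p i) j"]
      sum.reindex_bij_betw[OF permutes_imp_bij[OF assms(2)], of "\<lambda>i. S i (r j)"] by simp_all
  then show ?thesis using doubly_stochasticD[OF assms(1)] mem by (intro doubly_stochasticI) simp_all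
qed

text \<open>A T-transform, that is, \<open>1 - \<theta>\<close> times the identity matrix plus
  \<open>\<theta>\<close> times a transposition matrix. One matrix serves all vectors
  \<open>y\<close>; a constant \<open>y\<close> gives its row sums.\<close>

lemma doubly_stochastic_transfer:
  assumes "j < n" "k < n" "0 \<le> \<theta>" "\<theta> \<le> 1"
  shows "\<exists>S. doubly_stochastic n S \<and> (\<forall>y. \<forall>i<n. (\<Sum>l<n. S i l * y l) =
    (1 - \<theta>) * y i + \<theta> * y (Transposition.transpose j k i))"
proof -
  let ?\<tau> = "Transposition.transpose j k"
  have perm: "?\<tau> permutes {..<n}" using assms by (intro permutes_swap_id) auto
  have mem: "?\<tau> i < n" if "i < n" for i using permutes_in_image[OF perm, of i] that by simp
  have inv: "?\<tau> i = l \<longleftrightarrow> i = ?\<tau> l" for i l by (metis transpose_involutory)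
  define S where "S i l = (1 - \<theta>) * (if i = l then 1 else 0) + \<theta> * (if ?\<tau> i = l then 1 else 0)" for i l
  have row: "(\<Sum>l<n. S i l * y l) = (1 - \<theta>) * y i + \<theta> * y (?\<tau> i)" if "i < n" for i and y :: "nat \<Rightarrow> real"
  proof -
    have "(\<Sum>l<n. S i l * y l) = (\<Sum>l<n. (if i = l then (1 - \<theta>) * y l else 0) + (if ?\<tau> i = l then \<theta> * y l else 0))"
      by (rule sum.cong) (auto simp: S_def distrib_right)
    also have "\<dots> = (1 - \<theta>) * y i + \<theta> * y (?\<tau> i)"
      using that mem[OF that] by (simp add: sum.distrib)
    finally show ?thesis .
  qed
  have "doubly_stochastic n S"
  proof (rule doubly_stochasticI)
    show "0 \<le> S i l" for i l using assms by (simp add: S_def)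
    show "(\<Sum>l<n. S i l) = 1" if "i < n" for i using row[OF that, of "\<lambda>_. 1"] by simp
    show "(\<Sum>i<n. S i l) = 1" if "l < n" for l
    proof -
      have "(\<Sum>i<n. S i l) = (\<Sum>i<n. (if i = l then 1 - \<theta> else 0) + (if i = ?\<tau> l then \<theta> else 0))"
        by (rule sum.cong) (auto simp: S_def inv)
      also have "\<dots> = 1" using that mem[OF that] by (simp add: sum.distrib)
      finally show ?thesis .
    qed
  qed
  then show ?thesis using row by blast
qed

text \<open>Each step moves mass from the last index \<open>j\<close> below \<open>k\<close> with \<open>x j < y j\<close> to the first index \<open>k\<close>
  with \<open>x k > y k\<close>; in between \<open>x\<close> and \<open>y\<close> agree, so the partial sums stay dominated.\<close>

lemma doubly_stochastic_of_partial_sums: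
  fixes x y :: "nat \<Rightarrow> real"
  assumes anti: "\<And>i j. i \<le> j \<Longrightarrow> j < n \<Longrightarrow> x j \<le> x i"
    and "\<And>m. m \<le> n \<Longrightarrow> (\<Sum>i<m. x i) \<le> (\<Sum>i<m. y i)" "(\<Sum>i<n. x i) = (\<Sum>i<n. y i)"
  shows "\<exists>S. doubly_stochastic n S \<and> (\<forall>i<n. x i = (\<Sum>j<n. S i j * y j))"
  using assms(2,3)
\<comment> \<open>The measure counts the entries of \<open>y\<close> still to be corrected. Order is
  required of the fixed vector \<open>x\<close> alone, so the modified \<open>y\<close> has nothing
  to satisfy beyond the two conditions on sums.\<close>
proof (induction "card {i. i < n \<and> x i \<noteq> y i}" arbitrary: y rule: less_induct)
  case less
  note dom = less.prems(1) and total = less.prems(2)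
  show ?case
  proof (cases "\<exists>i<n. x i \<noteq> y i")
    case False
    have "doubly_stochastic n (\<lambda>i j. if i = j then 1 else 0)"
      by (rule doubly_stochasticI) auto
    moreover have "x i = (\<Sum>j<n. (if i = j then 1 else 0) * y j)" if "i < n" for i
    proof -
      have "(\<Sum>j<n. (if i = j then 1 else 0) * y j) = (\<Sum>j<n. if i = j then y j else 0)"
        by (rule sum.cong) auto
      then show ?thesis using that False by simp
    qed
    ultimately show ?thesis by (intro exI[of _ "\<lambda>i j. if i = j then 1 else 0"]) blast
  next
    case True
    have "\<exists>k<n. x k > y k"
    proof (rule ccontr)
      assume none: "\<not> (\<exists>k<n. x k > y k)"
      then have le: "x k \<le> y k" if "k < n" for k using that by (meson not_le)
      obtain i where i: "i < n" "x i \<noteq> y i" using True by blast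
      then have "\<exists>i\<in>{..<n}. x i < y i" using le[of i] by (intro bexI[of _ i]) auto
      then have "(\<Sum>i<n. x i) < (\<Sum>i<n. y i)"
        using le by (intro sum_strict_mono_ex1) auto
      then show False using total by simp
    qed
    define k where "k = (LEAST k. k < n \<and> x k > y k)"
    have k: "k < n" "x k > y k" and k_least: "\<And>i. i < k \<Longrightarrow> x i \<le> y i"
    proof -
      show *: "k < n" "x k > y k" using LeastI_ex[OF \<open>\<exists>k<n. x k > y k\<close>] unfolding k_def by auto
      show "x i \<le> y i" if "i < k" for i
        using not_less_Least[of i "\<lambda>k. k < n \<and> x k > y k"] that * unfolding k_def[symmetric] by force
    qed
    define J where "J = {i. i < k \<and> x i < y i}"
    have "J \<noteq> {}"
    proof
      assume "J = {}"
      then have "(\<Sum>i<k. x i) = (\<Sum>i<k. y i)"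
        using k_least by (intro sum.cong) (fastforce simp: J_def)+
      then show False using dom[of "Suc k"] k by simp
    qed
    define j where "j = Max J"
    have "finite J" by (simp add: J_def)
    then have j: "j < k" "x j < y j" and between: "\<And>i. j < i \<Longrightarrow> i < k \<Longrightarrow> x i = y i"
    proof -
      show "j < k" "x j < y j" using Max_in[OF \<open>finite J\<close> \<open>J \<noteq> {}\<close>] by (auto simp: J_def j_def)
      show "x i = y i" if "j < i" "i < k" for i
      proof (rule ccontr)
        assume "x i \<noteq> y i"
        then have "i \<in> J" using k_least[OF that(2)] that(2) by (simp add: J_def)
        then show False using Max_ge[OF \<open>finite J\<close>, of i] that(1) by (simp add: j_def)
      qed
    qed
    \<comment> \<open>The largest amount that overshoots neither target: at least one of the two
      entries reaches its value in \<open>x\<close>, which lowers the measure.\<close>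
    define \<delta> where "\<delta> = min (y j - x j) (x k - y k)"
    have \<delta>: "0 < \<delta>" "\<delta> \<le> y j - x j" "\<delta> \<le> x k - y k" using j(2) k(2) by (simp_all add: \<delta>_def)
    have xjk: "x k \<le> x j" using anti[of j k] j(1) k(1) by simp
    \<comment> \<open>Exchanging \<open>y j\<close> and \<open>y k\<close> with weight
      \<open>\<delta> / \<Delta>\<close> moves exactly \<open>\<delta>\<close>. The weight is at
      most 1 since \<open>y k + \<delta> \<le> x k \<le> x j \<le> y j - \<delta>\<close>.\<close>
    define \<Delta> where "\<Delta> = y j - y k"
    have \<Delta>: "\<delta> \<le> \<Delta>" "0 < \<Delta>" using \<delta> xjk by (simp_all add: \<Delta>_def)
    define y' where "y' = y(j := y j - \<delta>, k := y k + \<delta>)"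
    have jn: "j < n" using j(1) k(1) by simp
    obtain R where R: "doubly_stochastic n R" and Ry: "\<And>i. i < n \<Longrightarrow> (\<Sum>l<n. R i l * y l) =
        (1 - \<delta> / \<Delta>) * y i + \<delta> / \<Delta> * y (Transposition.transpose j k i)"
      using doubly_stochastic_transfer[OF jn k(1), of "\<delta> / \<Delta>"] \<delta>(1) \<Delta> by auto
    have Ry': "(\<Sum>l<n. R i l * y l) = y' i" if "i < n" for i
    proof -
      have "\<delta> / \<Delta> * \<Delta> = \<delta>" using \<Delta>(2) by simp
      then have a: "\<delta> / \<Delta> * y j - \<delta> / \<Delta> * y k = \<delta>" by (simp add: \<Delta>_def right_diff_distrib)
      consider "i = j" | "i = k" | "i \<noteq> j" "i \<noteq> k" by blast
      then show ?thesis
        unfolding Ry[OF that] using a j(1)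
        by cases (auto simp: y'_def transpose_apply_other left_diff_distrib)
    qed
    have part: "(\<Sum>i<m. y' i) = (\<Sum>i<m. y i) - (if j < m then \<delta> else 0) + (if k < m then \<delta> else 0)" for m
    proof -
      have "(\<Sum>i<m. y' i) = (\<Sum>i<m. y i - (if i = j then \<delta> else 0) + (if i = k then \<delta> else 0))"
        using j(1) by (intro sum.cong) (auto simp: y'_def)
      then show ?thesis by (simp add: sum.distrib sum_subtractf)
    qed
    have "\<exists>S. doubly_stochastic n S \<and> (\<forall>i<n. x i = (\<Sum>l<n. S i l * y' l))"
    proof (rule less.hyps)
      have "{i. i < n \<and> x i \<noteq> y' i} \<subset> {i. i < n \<and> x i \<noteq> y i}"
      proof
        show "{i. i < n \<and> x i \<noteq> y' i} \<subseteq> {i. i < n \<and> x i \<noteq> y i}"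
          using j k by (auto simp: y'_def)
        have "x j = y' j \<or> x k = y' k" using j(1) by (auto simp: y'_def \<delta>_def min_def)
        then have "\<not> {j, k} \<subseteq> {i. i < n \<and> x i \<noteq> y' i}" by auto
        moreover have "{j, k} \<subseteq> {i. i < n \<and> x i \<noteq> y i}" using j k jn by auto
        ultimately show "{i. i < n \<and> x i \<noteq> y' i} \<noteq> {i. i < n \<and> x i \<noteq> y i}" by metis
      qed
      then show "card {i. i < n \<and> x i \<noteq> y' i} < card {i. i < n \<and> x i \<noteq> y i}"
        by (rule psubset_card_mono[rotated]) simp
      show "(\<Sum>i<m. x i) \<le> (\<Sum>i<m. y' i)" if m: "m \<le> n" for m
      \<comment> \<open>Only prefixes ending between \<open>j\<close> and \<open>k\<close> lose
        mass. There the part below \<open>j\<close> is dominated by hypothesis, entry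
        \<open>j\<close> by the choice of \<open>\<delta>\<close>, and the entries after
        \<open>j\<close> coincide.\<close>
      proof (cases "j < m \<and> m \<le> k")
        case False
        then show ?thesis using part[of m] dom[OF m] j(1) by auto
      next
        case True
        have split: "(\<Sum>i<m. f i) = (\<Sum>i<j. f i) + f j + (\<Sum>i\<in>{Suc j..<m}. f i)" for f :: "nat \<Rightarrow> real"
        proof -
          have "(\<Sum>i<m. f i) = (\<Sum>i<Suc j. f i) + (\<Sum>i\<in>{Suc j..<m}. f i)"
            using True sum.atLeastLessThan_concat[of 0 "Suc j" m f] by (simp add: atLeast0LessThan)
          then show ?thesis by simp
        qed
        have "(\<Sum>i\<in>{Suc j..<m}. x i) = (\<Sum>i\<in>{Suc j..<m}. y i)"
          using True between by (intro sum.cong) auto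
        then show ?thesis using part[of m] True dom[of j] jn split[of x] split[of y] \<delta>(2) by simp
      qed
      show "(\<Sum>i<n. x i) = (\<Sum>i<n. y' i)" using part[of n] total jn k(1) by simp
    qed
    then obtain S where S: "doubly_stochastic n S" "\<And>i. i < n \<Longrightarrow> x i = (\<Sum>l<n. S i l * y' l)" by blast
    have "x i = (\<Sum>m<n. (\<Sum>l<n. S i l * R l m) * y m)" if "i < n" for i
    proof -
      have "x i = (\<Sum>l<n. S i l * (\<Sum>m<n. R l m * y m))" using S(2)[OF that] Ry' by simp
      also have "\<dots> = (\<Sum>m<n. \<Sum>l<n. S i l * (R l m * y m))"
        unfolding sum_distrib_left by (rule sum.swap)
      finally show ?thesis by (simp add: sum_distrib_right mult.assoc)
    qed
    then show ?thesis using doubly_stochastic_mult[OF S(1) R] by blast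
  qed
qed

text \<open>The first \<open>k\<close> entries of the image of \<open>y\<close> add up to a weighted
  sum of the entries of \<open>y\<close>, with weights between 0 and 1 and total \<open>k\<close>.
  For antitone \<open>y\<close> such a sum is largest when the weights sit on the first
  \<open>k\<close> entries.\<close>

lemma partial_sums_of_doubly_stochastic:
  fixes x y :: "nat \<Rightarrow> real"
  assumes S: "doubly_stochastic n S" "\<And>i. i < n \<Longrightarrow> x i = (\<Sum>j<n. S i j * y j)"
    and anti: "\<And>i j. i \<le> j \<Longrightarrow> j < n \<Longrightarrow> y j \<le> y i" and "k < n"
  shows "(\<Sum>i<k. x i) \<le> (\<Sum>i<k. y i)"
proof -
  define t where "t j = (\<Sum>i<k. S i j)" for j
  have t: "0 \<le> t j" "t j \<le> 1" if "j < n" for j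
  proof -
    show "0 \<le> t j" unfolding t_def using doubly_stochasticD(1)[OF S(1) _ that] \<open>k < n\<close> by (intro sum_nonneg) auto
    have "t j \<le> (\<Sum>i<n. S i j)"
      unfolding t_def using doubly_stochasticD(1)[OF S(1) _ that] \<open>k < n\<close> by (intro sum_mono2) auto
    then show "t j \<le> 1" using doubly_stochasticD(3)[OF S(1) that] by simp
  qed
  have tsum: "(\<Sum>j<n. t j) = real k"
  proof -
    have "(\<Sum>j<n. t j) = (\<Sum>i<k. \<Sum>j<n. S i j)" unfolding t_def by (rule sum.swap)
    also have "\<dots> = (\<Sum>i<k. 1)" using doubly_stochasticD(2)[OF S(1)] \<open>k < n\<close> by (intro sum.cong) auto
    finally show ?thesis by simp
  qed
  have "(\<Sum>i<k. x i) = (\<Sum>i<k. \<Sum>j<n. S i j * y j)" using S(2) \<open>k < n\<close> by (intro sum.cong) auto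
  also have "\<dots> = (\<Sum>j<n. t j * y j)" unfolding t_def sum_distrib_right by (rule sum.swap)
  \<comment> \<open>The entry \<open>y k\<close> serves as threshold: \<open>y j - y k\<close> is
    nonnegative before \<open>k\<close>, where the weight may be raised to 1, and nonpositive from
    \<open>k\<close> on, where it may be lowered to 0.\<close>
  also have "\<dots> = (\<Sum>j<n. t j * (y j - y k)) + real k * y k"
    using tsum by (simp add: right_diff_distrib sum_subtractf flip: sum_distrib_right)
  also have "(\<Sum>j<n. t j * (y j - y k)) \<le> (\<Sum>j<n. if j < k then y j - y k else 0)"
  proof (rule sum_mono)
    fix j assume "j \<in> {..<n}"
    then have j: "j < n" by simp
    show "t j * (y j - y k) \<le> (if j < k then y j - y k else 0)"
    proof (cases "j < k")
      case True
      then show ?thesis using anti[of j k] \<open>k < n\<close> t[OF j] by (simp add: mult_left_le_one_le)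
    next
      case False
      then show ?thesis using anti[of k j] j t[OF j] by (simp add: mult_nonneg_nonpos)
    qed
  qed
  also have "(\<Sum>j<n. if j < k then y j - y k else 0) = (\<Sum>j<k. y j - y k)"
    using \<open>k < n\<close> by (intro sum.mono_neutral_cong_right) auto
  finally show ?thesis by (simp add: sum_subtractf)
qed

lemma descending_permutation:
  fixes x :: "real list"
  obtains p where "p permutes {..<length x}" "\<And>i. i < length x \<Longrightarrow> rev (sort x) ! i = x ! p i"
    "\<And>i j. i \<le> j \<Longrightarrow> j < length x \<Longrightarrow> rev (sort x) ! j \<le> rev (sort x) ! i"
proof -
  have "mset (rev (sort x)) = mset x" by simp
  then obtain p where p: "p permutes {..<length x}" "permute_list p x = rev (sort x)"
    by (rule mset_eq_permutation)
  show thesis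
  proof (rule that[OF p(1)])
    show "rev (sort x) ! i = x ! p i" if "i < length x" for i
      using permute_list_nth[OF p(1) that] p(2) by simp
    show "rev (sort x) ! j \<le> rev (sort x) ! i" if "i \<le> j" "j < length x" for i j
      using that by (simp add: rev_nth sorted_nth_mono)
  qed
qed

lemma sum_list_take: "k \<le> length xs \<Longrightarrow> sum_list (take k xs) = (\<Sum>i<k. xs ! i)" for xs :: "real list"
  by (simp add: sum_list_sum_nth atLeast0LessThan)

text \<open>The Hardy-Littlewood-Polya theorem. The results above treat decreasing sequences; the
  sorting permutations turn a matrix for the sorted vectors into one for the original vectors and
  back, since permuting rows and columns preserves double stochasticity.\<close>

theorem majorised_by_iff_doubly_stochastic:
  assumes "length x = n" "length y = n"
  shows "x \<preceq> y \<longleftrightarrow> (\<exists>S. doubly_stochastic n S \<and> (\<forall>i<n. x ! i = (\<Sum>j<n. S i j * y ! j)))"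
proof -
  define X Y where "X = rev (sort x)" and "Y = rev (sort y)"
  obtain p where p: "p permutes {..<n}" "\<And>i. i < n \<Longrightarrow> X ! i = x ! p i"
    and X: "\<And>i j. i \<le> j \<Longrightarrow> j < n \<Longrightarrow> X ! j \<le> X ! i"
    using descending_permutation[of x] assms unfolding X_def by metis
  obtain r where r: "r permutes {..<n}" "\<And>i. i < n \<Longrightarrow> Y ! i = y ! r i"
    and Y: "\<And>i j. i \<le> j \<Longrightarrow> j < n \<Longrightarrow> Y ! j \<le> Y ! i"
    using descending_permutation[of y] assms unfolding Y_def by metis
  have mem: "p i < n" "r i < n" if "i < n" for i
    using permutes_in_image[OF p(1), of i] permutes_in_image[OF r(1), of i] that by simp_all
  have len: "length X = n" "length Y = n" using assms by (simp_all add: X_def Y_def)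
  have sums: "sum_list x = (\<Sum>i<n. X ! i)" "sum_list y = (\<Sum>i<n. Y ! i)"
    using sum.reindex_bij_betw[OF permutes_imp_bij[OF p(1)], of "(!) x"] p(2)
      sum.reindex_bij_betw[OF permutes_imp_bij[OF r(1)], of "(!) y"] r(2) assms
    by (simp_all add: sum_list_sum_nth atLeast0LessThan)
  have maj: "x \<preceq> y \<longleftrightarrow> (\<forall>k<n. (\<Sum>i<k. X ! i) \<le> (\<Sum>i<k. Y ! i)) \<and> (\<Sum>i<n. X ! i) = (\<Sum>i<n. Y ! i)"
    using assms len sums by (simp add: majorised_by_def X_def[symmetric] Y_def[symmetric] sum_list_take)
  show ?thesis
  proof
    assume "x \<preceq> y"
    then have d: "\<forall>k<n. (\<Sum>i<k. X ! i) \<le> (\<Sum>i<k. Y ! i)" "(\<Sum>i<n. X ! i) = (\<Sum>i<n. Y ! i)" using maj by auto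
    then have "(\<Sum>i<m. X ! i) \<le> (\<Sum>i<m. Y ! i)" if "m \<le> n" for m using that by (cases "m = n") auto
    then obtain S where S: "doubly_stochastic n S" "\<And>i. i < n \<Longrightarrow> X ! i = (\<Sum>j<n. S i j * Y ! j)"
      using doubly_stochastic_of_partial_sums[of n "(!) X" "(!) Y"] X d(2) by blast
    let ?S = "\<lambda>i j. S (inv p i) (inv r j)"
    have "x ! i = (\<Sum>j<n. ?S i j * y ! j)" if i: "i < n" for i
    proof -
      have ip: "inv p i < n" using permutes_in_image[OF permutes_inv[OF p(1)], of i] i by simp
      have "x ! i = X ! (inv p i)" using p(2)[OF ip] permutes_inverses(1)[OF p(1)] by simp
      also have "\<dots> = (\<Sum>j<n. S (inv p i) j * Y ! j)" by (rule S(2)[OF ip])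
      also have "\<dots> = (\<Sum>j<n. S (inv p i) (inv r (r j)) * y ! (r j))"
        using r(2) permutes_inverses(2)[OF r(1)] by simp
      also have "\<dots> = (\<Sum>j<n. ?S i j * y ! j)"
        using sum.reindex_bij_betw[OF permutes_imp_bij[OF r(1)], of "\<lambda>j. S (inv p i) (inv r j) * y ! j"] by simp
      finally show ?thesis .
    qed
    then show "\<exists>S. doubly_stochastic n S \<and> (\<forall>i<n. x ! i = (\<Sum>j<n. S i j * y ! j))"
      using doubly_stochastic_permute[OF S(1) permutes_inv[OF p(1)] permutes_inv[OF r(1)]] by blast
  next
    assume "\<exists>S. doubly_stochastic n S \<and> (\<forall>i<n. x ! i = (\<Sum>j<n. S i j * y ! j))"
    then obtain S where S: "doubly_stochastic n S" "\<And>i. i < n \<Longrightarrow> x ! i = (\<Sum>j<n. S i j * y ! j)" by blast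
    let ?S = "\<lambda>i j. S (p i) (r j)"
    have ds: "doubly_stochastic n ?S" by (rule doubly_stochastic_permute[OF S(1) p(1) r(1)])
    have eq: "X ! i = (\<Sum>j<n. ?S i j * Y ! j)" if i: "i < n" for i
    proof -
      have "X ! i = (\<Sum>j<n. S (p i) j * y ! j)" using p(2)[OF i] S(2)[OF mem(1)[OF i]] by simp
      also have "\<dots> = (\<Sum>j<n. ?S i j * y ! (r j))"
        using sum.reindex_bij_betw[OF permutes_imp_bij[OF r(1)], of "\<lambda>j. S (p i) j * y ! j"] by simp
      finally show ?thesis using r(2) by simp
    qed
    have "(\<Sum>i<n. X ! i) = (\<Sum>i<n. \<Sum>j<n. ?S i j * Y ! j)" using eq by simp
    also have "\<dots> = (\<Sum>j<n. (\<Sum>i<n. ?S i j) * Y ! j)" unfolding sum_distrib_right by (rule sum.swap)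
    also have "\<dots> = (\<Sum>j<n. Y ! j)" using doubly_stochasticD(3)[OF ds] by simp
    finally have "(\<Sum>i<n. X ! i) = (\<Sum>i<n. Y ! i)" .
    moreover have "(\<Sum>i<k. X ! i) \<le> (\<Sum>i<k. Y ! i)" if "k < n" for k
      using partial_sums_of_doubly_stochastic[of n ?S "(!) X" "(!) Y" k] ds eq Y that by blast
    ultimately show "x \<preceq> y" using maj by blast
  qed
qed

text \<open>Prefix sums of a probability vector are at most 1, and a nonempty prefix of the vertex
  already sums to 1. The vertex is the spectrum of a pure state and supplies the top value of the
  Schur-convex function built at the end.\<close>

lemma probability_majorised_by_unit:
  assumes "\<forall>z\<in>set x. 0 \<le> z" "sum_list x = 1" "length x = Suc m"
  shows "x \<preceq> 1 # replicate m 0"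
proof -
  define X where "X = rev (sort x)"
  have X: "\<forall>z\<in>set X. 0 \<le> z" "sum_list X = 1"
    using assms by (simp_all add: X_def sum_mset_sum_list[symmetric])
  have "sort (1 # replicate m 0 :: real list) = replicate m 0 @ [1]"
    by (rule properties_for_sort) (auto simp: sorted_append sorted_replicate)
  then have e: "rev (sort (1 # replicate m 0 :: real list)) = 1 # replicate m 0" by simp
  have "sum_list (take k X) \<le> sum_list (take k (1 # replicate m 0))" for k
  proof (cases k)
    case (Suc l)
    have "sum_list (take k X) + sum_list (drop k X) = 1"
      using X(2) by (metis append_take_drop_id sum_list_append)
    moreover have "0 \<le> sum_list (drop k X)" using X(1) by (intro sum_list_nonneg) (auto dest: in_set_dropD)
    moreover have "0 \<le> sum_list (take l (replicate m (0::real)))" by (intro sum_list_nonneg) (auto dest: in_set_takeD)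
    ultimately show ?thesis using Suc by simp
  qed simp
  then show ?thesis
    unfolding majorised_by_def e X_def[symmetric] using assms by (simp add: sum_list_replicate)
qed

section \<open>Composition and linear combinations\<close>

context causal_opt
begin

declare sys_unit [simp] sys_assoc [simp]

abbreviation St :: "'a \<Rightarrow> 'b set" where
  "St A \<equiv> transf \<one> A"

abbreviation Eff :: "'a \<Rightarrow> 'b set" where
  "Eff A \<equiv> transf A \<one>"

abbreviation pr :: "'b \<Rightarrow> 'b \<Rightarrow> real" where
  "pr a \<rho> \<equiv> prob T (a \<cdot> \<rho>)"

section \<open>Closure of tests and transformations under composition\<close>

lemma transfI: "cs \<in> tests T A B \<Longrightarrow> F \<in> set cs \<Longrightarrow> F \<in> transf A B"
  by (auto simp: transf_def)

lemma transfE: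
  assumes "F \<in> transf A B"
  obtains cs i where "cs \<in> tests T A B" "i < length cs" "cs ! i = F"
  using assms by (auto simp: transf_def in_set_conv_nth)

lemma channel_transf: "channel A B F \<Longrightarrow> F \<in> transf A B"
  by (auto simp: channel_def transf_def intro!: bexI)

lemma test_seq:
  assumes "cs \<in> tests T A B" "ds \<in> tests T B C"
  shows "[G \<cdot> F. F \<leftarrow> cs, G \<leftarrow> ds] \<in> tests T A C"
proof -
  have "map (\<lambda>F. map (\<lambda>G. G \<cdot> F) ds) (map ((!) cs) [0..<length cs])
      = map (\<lambda>i. map (\<lambda>G. G \<cdot> (cs ! i)) ds) [0..<length cs]"
    by simp
  then have "map (\<lambda>i. map (\<lambda>G. G \<cdot> (cs ! i)) ds) [0..<length cs] = map (\<lambda>F. map (\<lambda>G. G \<cdot> F) ds) cs"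
    by (simp only: map_nth)
  then show ?thesis
    using test_conditional[OF assms(1), of "\<lambda>_. ds" C] assms(2) by simp
qed

lemma seq_transf: "F \<in> transf A B \<Longrightarrow> G \<in> transf B C \<Longrightarrow> G \<cdot> F \<in> transf A C"
  unfolding transf_def by clarsimp (rule bexI[OF _ test_seq]; auto)

lemma par_transf: "F \<in> transf A B \<Longrightarrow> G \<in> transf A' B' \<Longrightarrow> F \<otimes> G \<in> transf (A \<odot> A') (B \<odot> B')"
  unfolding transf_def by clarsimp (rule bexI[OF _ test_parallel]; auto)

lemma test_pre_channel:
  assumes "channel A B F" "ds \<in> tests T B C"
  shows "map (\<lambda>G. G \<cdot> F) ds \<in> tests T A C"
  using test_seq[of "[F]" A B ds C] assms by (simp add: channel_def)

lemma test_post_channel: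
  assumes "cs \<in> tests T A B" "channel B C G"
  shows "map (\<lambda>F. G \<cdot> F) cs \<in> tests T A C"
  using test_seq[of cs A B "[G]" C] assms by (simp add: channel_def)

lemma channel_seq: "channel A B F \<Longrightarrow> channel B C G \<Longrightarrow> channel A C (G \<cdot> F)"
  using test_pre_channel[of A B F "[G]" C] by (simp add: channel_def)

lemma channel_par: "channel A B F \<Longrightarrow> channel A' B' G \<Longrightarrow> channel (A \<odot> A') (B \<odot> B') (F \<otimes> G)"
  using test_parallel[of "[F]" A B "[G]" A' B'] by (simp add: channel_def)

lemma test_par_channel:
  assumes "channel A B F" "ds \<in> tests T A' B'"
  shows "map (\<lambda>G. F \<otimes> G) ds \<in> tests T (A \<odot> A') (B \<odot> B')"
  using test_parallel[of "[F]" A B ds A' B'] assms by (simp add: channel_def)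

lemma test_channel_par:
  assumes "cs \<in> tests T A B" "channel A' B' G"
  shows "map (\<lambda>F. F \<otimes> G) cs \<in> tests T (A \<odot> A') (B \<odot> B')"
  using test_parallel[of cs A B "[G]" A' B'] assms by (simp add: channel_def)

lemma ident_transf [simp]: "ident T A \<in> transf A A"
  using ident_channel channel_transf by blast

lemma swap_transf [simp]: "swap T A B \<in> transf (A \<odot> B) (B \<odot> A)"
  using swap_channel channel_transf by blast

section \<open>Discarding, numbers and pairings\<close>

lemma channel_discard: "channel A \<one> (discard A)"
  unfolding discard_def by (rule theI') (rule causality)

lemma discard_transf [simp]: "discard A \<in> Eff A"
  using channel_discard channel_transf by blast

text \<open>Causality in the form used throughout: a one-outcome observation-test, however it is
  composed, is the discard. The rules for products and for channels below are instances.\<close>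

lemma discard_unique: "channel A \<one> u \<Longrightarrow> u = discard A"
  using causality channel_discard by blast

lemma discard_triv: "discard \<one> = ident T \<one>"
  using discard_unique[OF ident_channel] by simp

lemma discard_par: "discard A \<otimes> discard B = discard (A \<odot> B)"
  using discard_unique[of "A \<odot> B"] channel_par[OF channel_discard channel_discard, of A B] by simp

lemma discard_channel: "channel A B F \<Longrightarrow> discard B \<cdot> F = discard A"
  using discard_unique channel_seq channel_discard by blast

lemma prob_ident [simp]: "prob T (ident T \<one>) = 1"
  using tests_triv[of "[ident T \<one>]"] ident_channel[of \<one>] by (simp add: channel_def)

lemma prob_range: "s \<in> transf \<one> \<one> \<Longrightarrow> 0 \<le> prob T s \<and> prob T s \<le> 1"
  using prob_bij by (auto simp: bij_betw_def)

lemma scalar_exists: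
  assumes "0 \<le> x" "x \<le> 1"
  obtains s where "s \<in> transf \<one> \<one>" "prob T s = x"
  using prob_bij assms unfolding bij_betw_def by (metis atLeastAtMost_iff imageE)

lemma pr_range: "\<rho> \<in> St A \<Longrightarrow> a \<in> Eff A \<Longrightarrow> 0 \<le> pr a \<rho> \<and> pr a \<rho> \<le> 1"
  using prob_range seq_transf by blast

lemma pr_nonneg: "\<rho> \<in> St A \<Longrightarrow> a \<in> Eff A \<Longrightarrow> 0 \<le> pr a \<rho>"
  using pr_range by blast

lemma state_eqI:
  "\<rho> \<in> St A \<Longrightarrow> \<sigma> \<in> St A \<Longrightarrow> (\<And>a. a \<in> Eff A \<Longrightarrow> pr a \<rho> = pr a \<sigma>) \<Longrightarrow> \<rho> = \<sigma>"
  using states_eqI by (simp add: states_def effects_def)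

lemma effect_eqI:
  "a \<in> Eff A \<Longrightarrow> b \<in> Eff A \<Longrightarrow> (\<And>\<rho>. \<rho> \<in> St A \<Longrightarrow> pr a \<rho> = pr b \<rho>) \<Longrightarrow> a = b"
  using effects_eqI by (simp add: states_def effects_def)

lemma pr_seq:
  assumes "\<rho> \<in> St A" "F \<in> transf A B" "b \<in> Eff B"
  shows "pr (b \<cdot> F) \<rho> = pr b (F \<cdot> \<rho>)"
  using seq_assoc[OF assms] by simp

lemma pr_scaled_state:
  assumes "s \<in> transf \<one> \<one>" "\<rho> \<in> St A" "a \<in> Eff A"
  shows "pr a (\<rho> \<cdot> s) = prob T s * pr a \<rho>"
  using seq_assoc[OF assms] prob_seq[OF assms(1) seq_transf[OF assms(2,3)]] by simp

lemma pr_scaled_effect: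
  assumes "s \<in> transf \<one> \<one>" "\<rho> \<in> St A" "a \<in> Eff A"
  shows "pr (s \<cdot> a) \<rho> = prob T s * pr a \<rho>"
  using seq_assoc[OF assms(2,3,1)] prob_seq[OF seq_transf[OF assms(2,3)] assms(1)] by simp

section \<open>One-sided maps and conditioning on bipartite systems\<close>

lemma par_split_left:
  assumes "F \<in> transf A A'" "G \<in> transf B B'"
  shows "F \<otimes> G = (F \<otimes> ident T B') \<cdot> (ident T A \<otimes> G)"
  using interchange[OF ident_transf assms(1) assms(2) ident_transf] assms by (simp add: seq_ident)

lemma par_split_right:
  assumes "F \<in> transf A A'" "G \<in> transf B B'"
  shows "F \<otimes> G = (ident T A' \<otimes> G) \<cdot> (F \<otimes> ident T B)"
  using interchange[OF assms(1) ident_transf ident_transf assms(2)] assms by (simp add: seq_ident)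

lemma left_transf: "a \<in> Eff A \<Longrightarrow> a \<otimes> ident T B \<in> transf (A \<odot> B) B"
  using par_transf[of a A \<one> "ident T B" B B] by simp

lemma right_transf: "b \<in> Eff B \<Longrightarrow> ident T A \<otimes> b \<in> transf (A \<odot> B) A"
  using par_transf[of "ident T A" A A b B \<one>] by simp

lemma pair_transf: "a \<in> Eff A \<Longrightarrow> b \<in> Eff B \<Longrightarrow> a \<otimes> b \<in> Eff (A \<odot> B)"
  using par_transf[of a A \<one> b B \<one>] by simp

lemma prod_state: "\<rho> \<in> St A \<Longrightarrow> \<sigma> \<in> St B \<Longrightarrow> \<rho> \<otimes> \<sigma> \<in> St (A \<odot> B)"
  using par_transf[of \<rho> \<one> A \<sigma> \<one> B] by simp

lemma left_state: "\<Phi> \<in> St (A \<odot> B) \<Longrightarrow> a \<in> Eff A \<Longrightarrow> (a \<otimes> ident T B) \<cdot> \<Phi> \<in> St B"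
  using seq_transf left_transf by blast

lemma right_state: "\<Phi> \<in> St (A \<odot> B) \<Longrightarrow> b \<in> Eff B \<Longrightarrow> (ident T A \<otimes> b) \<cdot> \<Phi> \<in> St A"
  using seq_transf right_transf by blast

text \<open>With \<open>pr_right\<close> this gives three readings of one joint probability: on the
  bipartite state, or on either factor after conditioning on the other. Most later estimates pass
  from one reading to another and bound the effect by the discard there.\<close>

lemma pr_left:
  assumes "\<Phi> \<in> St (A \<odot> B)" "a \<in> Eff A" "b \<in> Eff B"
  shows "pr b ((a \<otimes> ident T B) \<cdot> \<Phi>) = pr (a \<otimes> b) \<Phi>"
  using pr_seq[OF assms(1) left_transf[OF assms(2)] assms(3)] par_split_right[OF assms(2,3)]
    par_unit(2)[OF assms(3)] by simp

lemma pr_right: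
  assumes "\<Phi> \<in> St (A \<odot> B)" "a \<in> Eff A" "b \<in> Eff B"
  shows "pr a ((ident T A \<otimes> b) \<cdot> \<Phi>) = pr (a \<otimes> b) \<Phi>"
  using pr_seq[OF assms(1) right_transf[OF assms(3)] assms(2)] par_split_left[OF assms(2,3)]
    par_unit(1)[OF assms(2)] by simp

lemma left_right_commute:
  assumes "\<Phi> \<in> St (A \<odot> B)" "a \<in> transf A A'" "R \<in> transf B C"
  shows "(a \<otimes> ident T C) \<cdot> (ident T A \<otimes> R) \<cdot> \<Phi> = (ident T A' \<otimes> R) \<cdot> (a \<otimes> ident T B) \<cdot> \<Phi>"
proof -
  have "((a \<otimes> ident T C) \<cdot> (ident T A \<otimes> R)) \<cdot> \<Phi> = ((ident T A' \<otimes> R) \<cdot> (a \<otimes> ident T B)) \<cdot> \<Phi>"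
    using par_split_left[OF assms(2,3)] par_split_right[OF assms(2,3)] by simp
  then show ?thesis
    using seq_assoc[OF assms(1) par_transf[OF ident_transf assms(3)] par_transf[OF assms(2) ident_transf]]
      seq_assoc[OF assms(1) par_transf[OF assms(2) ident_transf] par_transf[OF ident_transf assms(3)]]
    by simp
qed

lemma right_of_right:
  assumes "\<Phi> \<in> St (A \<odot> B)" "R \<in> transf B C" "S \<in> transf C D"
  shows "(ident T A \<otimes> S) \<cdot> (ident T A \<otimes> R) \<cdot> \<Phi> = (ident T A \<otimes> (S \<cdot> R)) \<cdot> \<Phi>"
proof -
  have "ident T A \<otimes> (S \<cdot> R) = (ident T A \<otimes> S) \<cdot> (ident T A \<otimes> R)"
    using interchange[OF ident_transf ident_transf assms(2,3), of A] by (simp add: seq_ident[OF ident_transf])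
  then show ?thesis
    using seq_assoc[OF assms(1) par_transf[OF ident_transf assms(2)] par_transf[OF ident_transf assms(3)]]
    by simp
qed

lemma prod_state_apply:
  assumes "\<rho> \<in> St A" "\<sigma> \<in> St B" "F \<in> transf A A'" "G \<in> transf B B'"
  shows "(F \<otimes> G) \<cdot> (\<rho> \<otimes> \<sigma>) = (F \<cdot> \<rho>) \<otimes> (G \<cdot> \<sigma>)"
  using interchange[OF assms(1,3,2,4)] by simp

lemma scalar_par: "s \<in> transf \<one> \<one> \<Longrightarrow> t \<in> transf \<one> \<one> \<Longrightarrow> s \<otimes> t = s \<cdot> t"
  using par_split_left[of s \<one> \<one> t \<one> \<one>] by (simp add: par_unit)

lemma pr_prod:
  assumes "\<rho> \<in> St A" "\<sigma> \<in> St B" "a \<in> Eff A" "b \<in> Eff B"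
  shows "pr (a \<otimes> b) (\<rho> \<otimes> \<sigma>) = pr a \<rho> * pr b \<sigma>"
  using assms by (simp add: prod_state_apply seq_transf scalar_par prob_seq)

lemma state_prod_ident:
  assumes "\<rho> \<in> St A" "\<sigma> \<in> St B"
  shows "(ident T A \<otimes> \<sigma>) \<cdot> \<rho> = \<rho> \<otimes> \<sigma>" "(\<rho> \<otimes> ident T B) \<cdot> \<sigma> = \<rho> \<otimes> \<sigma>"
  using par_split_right[OF assms] par_split_left[OF assms] assms by (simp_all add: par_unit)

text \<open>The hexagon with two trivial factors makes this swap idempotent, and an invertible
  idempotent is the identity.\<close>

lemma swap_unit: "swap T A \<one> = ident T A"
proof -
  let ?s = "swap T A \<one>"
  have s: "?s \<in> transf A A" "swap T \<one> A \<in> transf A A"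
    using swap_transf[of A \<one>] swap_transf[of \<one> A] by auto
  have "?s = (ident T \<one> \<otimes> ?s) \<cdot> (?s \<otimes> ident T \<one>)"
    using swap_hexagon[of A \<one> \<one>] by simp
  then have idem: "?s = ?s \<cdot> ?s"
    using s by (simp add: par_unit)
  have inv: "swap T \<one> A \<cdot> ?s = ident T A"
    using swap_inverse[of \<one> A] by simp
  have "?s = (swap T \<one> A \<cdot> ?s) \<cdot> ?s" using s inv by (simp add: seq_ident)
  also have "\<dots> = swap T \<one> A \<cdot> (?s \<cdot> ?s)" using s seq_assoc by blast
  also have "\<dots> = ident T A" using idem inv by simp
  finally show ?thesis .
qed

lemma swap_right:
  assumes "b \<in> Eff B"
  shows "(b \<otimes> ident T A) \<cdot> swap T A B = ident T A \<otimes> b"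
proof -
  have "swap T A \<one> \<cdot> (ident T A \<otimes> b) = (b \<otimes> ident T A) \<cdot> swap T A B"
    by (rule swap_natural[OF ident_transf assms])
  then show ?thesis
    using seq_ident(2)[OF right_transf[OF assms]] by (simp add: swap_unit)
qed

section \<open>Linear relations between transformations\<close>

lemma vect_state_eq:
  assumes "\<rho> \<in> St A" "\<sigma> \<in> St S" "E \<in> Eff (A \<odot> S)"
  shows "vect \<one> A \<rho> (S, \<sigma>, E) = pr (E \<cdot> (ident T A \<otimes> \<sigma>)) \<rho>"
proof -
  have "ident T A \<otimes> \<sigma> \<in> transf A (A \<odot> S)"
    using par_transf[of "ident T A" A A \<sigma> \<one> S] assms by simp
  then have "(E \<cdot> (ident T A \<otimes> \<sigma>)) \<cdot> \<rho> = E \<cdot> (ident T A \<otimes> \<sigma>) \<cdot> \<rho>"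
    using seq_assoc[OF assms(1) _ assms(3)] by blast
  then show ?thesis
    using assms state_prod_ident[OF assms(1,2)] by (simp add: vect_def states_def effects_def)
qed

lemma vect_state_unit:
  assumes "\<rho> \<in> St A" "a \<in> Eff A"
  shows "vect \<one> A \<rho> (\<one>, ident T \<one>, a) = pr a \<rho>"
  using vect_state_eq[OF assms(1) ident_transf, of a] assms par_ident[of A \<one>] by (simp add: seq_ident)

lemma vect_effect_eq:
  assumes "a \<in> Eff A" "\<sigma> \<in> St (A \<odot> S)" "E \<in> Eff S"
  shows "vect A \<one> a (S, \<sigma>, E) = pr a ((ident T A \<otimes> E) \<cdot> \<sigma>)"
  using assms by (simp add: vect_def states_def effects_def pr_left pr_right)

lemma vect_effect_unit:
  assumes "a \<in> Eff A" "\<rho> \<in> St A"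
  shows "vect A \<one> a (\<one>, \<rho>, ident T \<one>) = pr a \<rho>"
  using vect_effect_eq[OF assms(1), of \<rho> \<one> "ident T \<one>"] assms par_ident[of A \<one>] by (simp add: seq_ident)

lemma vect_outside:
  "\<not> (\<rho> \<in> St (A \<odot> S) \<and> E \<in> Eff (B \<odot> S)) \<Longrightarrow> vect A B F (S, \<rho>, E) = 0"
  by (auto simp: vect_def states_def effects_def)

lemma lincombI:
  assumes "\<And>S \<rho> E. \<rho> \<in> St (A \<odot> S) \<Longrightarrow> E \<in> Eff (B \<odot> S) \<Longrightarrow>
      vect A B F (S, \<rho>, E) = (\<Sum>i\<in>X. r i * vect A B (D i) (S, \<rho>, E))"
  shows "is_lincomb A B F X r D"
  unfolding is_lincomb_def
proof
  fix z :: "'a \<times> 'b \<times> 'b"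
  obtain S \<rho> E where z: "z = (S, \<rho>, E)" by (cases z)
  show "vect A B F z = (\<Sum>i\<in>X. r i * vect A B (D i) z)"
    using assms[of \<rho> S E] vect_outside[of \<rho> A S E B] unfolding z
    by (cases "\<rho> \<in> St (A \<odot> S) \<and> E \<in> Eff (B \<odot> S)") simp_all
qed

text \<open>For a map out of the trivial system the ancilla carries a state of its own, which can be
  absorbed into the effect. The coordinates of \<open>vect\<close> with an ancilla are therefore
  pairings with other effects of \<open>A\<close>, and pairings alone decide linear
  relations.\<close>

lemma lincomb_state:
  assumes "\<rho> \<in> St A" "\<And>i. i \<in> X \<Longrightarrow> D i \<in> St A"
  shows "is_lincomb \<one> A \<rho> X r D \<longleftrightarrow> (\<forall>a \<in> Eff A. pr a \<rho> = (\<Sum>i\<in>X. r i * pr a (D i)))"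
    (is "?L \<longleftrightarrow> ?R")
proof
  assume L: ?L
  show ?R
  proof
    fix a assume a: "a \<in> Eff A"
    have "vect \<one> A \<rho> (\<one>, ident T \<one>, a) = (\<Sum>i\<in>X. r i * vect \<one> A (D i) (\<one>, ident T \<one>, a))"
      using L by (auto simp: is_lincomb_def)
    then show "pr a \<rho> = (\<Sum>i\<in>X. r i * pr a (D i))"
      using assms a by (simp add: vect_state_unit)
  qed
next
  assume R: ?R
  show ?L
  proof (rule lincombI)
    fix S \<sigma> E assume asm: "\<sigma> \<in> St (\<one> \<odot> S)" "E \<in> Eff (A \<odot> S)"
    then have "E \<cdot> (ident T A \<otimes> \<sigma>) \<in> Eff A"
      using seq_transf[of "ident T A \<otimes> \<sigma>" A "A \<odot> S" E \<one>] par_transf[of "ident T A" A A \<sigma> \<one> S] by simp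
    then show "vect \<one> A \<rho> (S, \<sigma>, E) = (\<Sum>i\<in>X. r i * vect \<one> A (D i) (S, \<sigma>, E))"
      using R asm assms by (simp add: vect_state_eq)
  qed
qed

text \<open>Dually, the effect on the ancilla is absorbed into the state.\<close>

lemma lincomb_effect:
  assumes "a \<in> Eff A" "\<And>i. i \<in> X \<Longrightarrow> D i \<in> Eff A"
  shows "is_lincomb A \<one> a X r D \<longleftrightarrow> (\<forall>\<rho> \<in> St A. pr a \<rho> = (\<Sum>i\<in>X. r i * pr (D i) \<rho>))"
    (is "?L \<longleftrightarrow> ?R")
proof
  assume L: ?L
  show ?R
  proof
    fix \<rho> assume \<rho>: "\<rho> \<in> St A"
    have "vect A \<one> a (\<one>, \<rho>, ident T \<one>) = (\<Sum>i\<in>X. r i * vect A \<one> (D i) (\<one>, \<rho>, ident T \<one>))"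
      using L by (auto simp: is_lincomb_def)
    then show "pr a \<rho> = (\<Sum>i\<in>X. r i * pr (D i) \<rho>)"
      using assms \<rho> by (simp add: vect_effect_unit)
  qed
next
  assume R: ?R
  show ?L
  proof (rule lincombI)
    fix S \<sigma> E assume asm: "\<sigma> \<in> St (A \<odot> S)" "E \<in> Eff (\<one> \<odot> S)"
    show "vect A \<one> a (S, \<sigma>, E) = (\<Sum>i\<in>X. r i * vect A \<one> (D i) (S, \<sigma>, E))"
      using R asm assms right_state[of \<sigma> A S E] by (simp add: vect_effect_eq)
  qed
qed

text \<open>A coordinate of the composite is a coordinate of the inner map at an index with a
  changed effect, so linear relations pass through. Composition on the other side changes the state
  in the index, and tensoring with an identity enlarges the ancilla in it.\<close>

lemma lincomb_post:
  assumes "F \<in> transf A B" "\<And>i. i \<in> X \<Longrightarrow> D i \<in> transf A B" "G \<in> transf B C"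
    and "is_lincomb A B F X r D"
  shows "is_lincomb A C (G \<cdot> F) X r (\<lambda>i. G \<cdot> D i)"
proof -
  have *: "vect A C (G \<cdot> H) (S, \<rho>, E) = vect A B H (S, \<rho>, E \<cdot> (G \<otimes> ident T S))"
    if "\<rho> \<in> St (A \<odot> S)" "E \<in> Eff (C \<odot> S)" "H \<in> transf A B" for H S \<rho> E
  proof -
    have g: "G \<otimes> ident T S \<in> transf (B \<odot> S) (C \<odot> S)" and h: "H \<otimes> ident T S \<in> transf (A \<odot> S) (B \<odot> S)"
      using par_transf assms(3) that by simp_all
    have "(G \<cdot> H) \<otimes> ident T S = (G \<otimes> ident T S) \<cdot> (H \<otimes> ident T S)"
      using interchange[OF that(3) assms(3) ident_transf ident_transf, of S] by (simp add: seq_ident[OF ident_transf])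
    then have "E \<cdot> ((G \<cdot> H) \<otimes> ident T S) \<cdot> \<rho> = (E \<cdot> (G \<otimes> ident T S)) \<cdot> (H \<otimes> ident T S) \<cdot> \<rho>"
      using seq_assoc[OF that(1) h g] seq_assoc[OF seq_transf[OF that(1) h] g that(2)] by simp
    then show ?thesis
      using that seq_transf[OF g that(2)] by (simp add: vect_def states_def effects_def)
  qed
  show ?thesis
  proof (rule lincombI)
    fix S \<rho> E assume asm: "\<rho> \<in> St (A \<odot> S)" "E \<in> Eff (C \<odot> S)"
    show "vect A C (G \<cdot> F) (S, \<rho>, E) = (\<Sum>i\<in>X. r i * vect A C (G \<cdot> D i) (S, \<rho>, E))"
      using asm *[of \<rho> S E] assms by (simp add: is_lincomb_def)
  qed
qed

lemma lincomb_pre: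
  assumes "F \<in> transf B C" "\<And>i. i \<in> X \<Longrightarrow> D i \<in> transf B C" "G \<in> transf A B"
    and "is_lincomb B C F X r D"
  shows "is_lincomb A C (F \<cdot> G) X r (\<lambda>i. D i \<cdot> G)"
proof -
  have *: "vect A C (H \<cdot> G) (S, \<rho>, E) = vect B C H (S, (G \<otimes> ident T S) \<cdot> \<rho>, E)"
    if "\<rho> \<in> St (A \<odot> S)" "E \<in> Eff (C \<odot> S)" "H \<in> transf B C" for H S \<rho> E
  proof -
    have g: "G \<otimes> ident T S \<in> transf (A \<odot> S) (B \<odot> S)" and h: "H \<otimes> ident T S \<in> transf (B \<odot> S) (C \<odot> S)"
      using par_transf assms(3) that by simp_all
    have "(H \<cdot> G) \<otimes> ident T S = (H \<otimes> ident T S) \<cdot> (G \<otimes> ident T S)"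
      using interchange[OF assms(3) that(3) ident_transf ident_transf, of S] by (simp add: seq_ident[OF ident_transf])
    then have "((H \<cdot> G) \<otimes> ident T S) \<cdot> \<rho> = (H \<otimes> ident T S) \<cdot> (G \<otimes> ident T S) \<cdot> \<rho>"
      using seq_assoc[OF that(1) g h] by simp
    then show ?thesis
      using that seq_transf[OF that(1) g] by (simp add: vect_def states_def effects_def)
  qed
  show ?thesis
  proof (rule lincombI)
    fix S \<rho> E assume asm: "\<rho> \<in> St (A \<odot> S)" "E \<in> Eff (C \<odot> S)"
    show "vect A C (F \<cdot> G) (S, \<rho>, E) = (\<Sum>i\<in>X. r i * vect A C (D i \<cdot> G) (S, \<rho>, E))"
      using asm *[of \<rho> S E] assms by (simp add: is_lincomb_def)
  qed
qed

lemma lincomb_par_ident: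
  assumes "F \<in> transf A B" "\<And>i. i \<in> X \<Longrightarrow> D i \<in> transf A B"
    and "is_lincomb A B F X r D"
  shows "is_lincomb (A \<odot> C) (B \<odot> C) (F \<otimes> ident T C) X r (\<lambda>i. D i \<otimes> ident T C)"
proof -
  have *: "vect (A \<odot> C) (B \<odot> C) (H \<otimes> ident T C) (S, \<rho>, E) = vect A B H (C \<odot> S, \<rho>, E)"
    if "H \<in> transf A B" for H S \<rho> E
    using par_assoc[OF that ident_transf ident_transf, of C S] par_ident[of C S]
    by (simp add: vect_def states_def effects_def)
  show ?thesis
    unfolding is_lincomb_def
  proof
    fix z :: "'a \<times> 'b \<times> 'b"
    obtain S \<rho> E where z: "z = (S, \<rho>, E)" by (cases z)
    show "vect (A \<odot> C) (B \<odot> C) (F \<otimes> ident T C) z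
        = (\<Sum>i\<in>X. r i * vect (A \<odot> C) (B \<odot> C) (D i \<otimes> ident T C) z)"
      using * assms by (simp add: z is_lincomb_def)
  qed
qed

section \<open>Convex combinations of states, pure states\<close>

lemma test_nth: "cs \<in> tests T A B \<Longrightarrow> i < length cs \<Longrightarrow> cs ! i \<in> transf A B"
  by (auto intro: transfI)

lemma normalised_iff: "\<rho> \<in> normalised_states A \<longleftrightarrow> \<rho> \<in> St A \<and> pr (discard A) \<rho> = 1"
  by (simp add: normalised_states_def states_def)

lemma normalised_state: "\<rho> \<in> normalised_states A \<Longrightarrow> \<rho> \<in> St A"
  by (simp add: normalised_iff)

lemma normalised_discard: "\<rho> \<in> normalised_states A \<Longrightarrow> pr (discard A) \<rho> = 1"
  by (simp add: normalised_iff)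

lemma channel_normalised: "channel \<one> A \<rho> \<Longrightarrow> \<rho> \<in> normalised_states A"
  using discard_channel[of \<one> A \<rho>] by (simp add: normalised_iff channel_transf discard_triv)

section \<open>Probabilities of tests and normalised states\<close>

lemma state_test_sum:
  assumes "cs \<in> tests T \<one> A"
  shows "(\<Sum>i<length cs. pr (discard A) (cs ! i)) = 1"
  using test_post_channel[OF assms channel_discard]
  by (simp add: tests_triv sum_list_sum_nth atLeast0LessThan)

lemma total_coarse_graining:
  assumes "cs \<in> tests T A B" "cs \<noteq> []"
  shows "\<exists>F. channel A B F \<and> is_sum A B F {..<length cs} (\<lambda>i. cs ! i)"
proof -
  have im: "(\<lambda>_. 0) ` {..<length cs} = {..<1::nat}" using assms(2) by auto
  obtain es where es: "es \<in> tests T A B" "length es = 1"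
    "is_sum A B (es ! 0) {i. i < length cs \<and> (0::nat) = 0} (\<lambda>i. cs ! i)"
    using test_coarse_graining[OF assms(1) im] by auto
  have "es = [es ! 0]" using es(2) by (cases es) auto
  then have "channel A B (es ! 0)" using es(1) by (simp add: channel_def)
  moreover have "{i. i < length cs \<and> (0::nat) = 0} = {..<length cs}" by auto
  ultimately show ?thesis using es(3) by auto
qed

lemma effect_test_sum:
  assumes "es \<in> tests T A \<one>" "\<rho> \<in> St A"
  shows "(\<Sum>i<length es. pr (es ! i) \<rho>) = pr (discard A) \<rho>"
proof -
  obtain cs where "cs \<in> tests T \<one> A" using assms(2) by (auto simp: transf_def)
  then have comp: "[G \<cdot> F. F \<leftarrow> cs, G \<leftarrow> es] \<in> tests T \<one> \<one>"
    using test_seq assms(1) by blast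
  \<comment> \<open>An empty observation-test, preceded by a preparation, would be an empty test on
    the trivial system, whose probabilities add up to 0 instead of 1.\<close>
  have "es \<noteq> []"
  proof
    assume "es = []"
    then have "[G \<cdot> F. F \<leftarrow> cs, G \<leftarrow> es] = []" by simp
    with comp have "[] \<in> tests T \<one> \<one>" by metis
    then show False by (simp add: tests_triv)
  qed
  then obtain F where F: "channel A \<one> F" "is_sum A \<one> F {..<length es} (\<lambda>i. es ! i)"
    using total_coarse_graining assms(1) by blast
  have "is_lincomb A \<one> (discard A) {..<length es} (\<lambda>_. 1) (\<lambda>i. es ! i)"
    using F discard_unique[OF F(1)] by (simp add: is_sum_def)
  moreover have "\<And>i. i \<in> {..<length es} \<Longrightarrow> es ! i \<in> Eff A"
    using assms(1) by (auto intro: transfI)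
  ultimately show ?thesis
    using assms(2) lincomb_effect[of "discard A" A "{..<length es}" "\<lambda>i. es ! i" "\<lambda>_. 1"] by simp
qed

lemma pr_le_discard:
  assumes "a \<in> Eff A" "\<rho> \<in> St A"
  shows "pr a \<rho> \<le> pr (discard A) \<rho>"
proof -
  obtain es i where es: "es \<in> tests T A \<one>" "i < length es" "es ! i = a"
    using transfE[OF assms(1)] by blast
  have "pr (es ! i) \<rho> \<le> (\<Sum>i<length es. pr (es ! i) \<rho>)"
    using es assms(2) by (intro member_le_sum) (auto intro!: pr_nonneg transfI[OF es(1)])
  then show ?thesis using effect_test_sum[OF es(1) assms(2)] es by simp
qed

lemma null_state:
  assumes "a \<in> Eff A" "\<rho> \<in> St A" "pr (discard A) \<rho> = 0"
  shows "pr a \<rho> = 0"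
  using pr_le_discard[OF assms(1,2)] pr_nonneg[OF assms(2,1)] assms(3) by simp

text \<open>Normalisation speaks of a probability only, and a state is merely one outcome of some
  preparation. If this outcome has probability 1, the others are null, so forgetting the outcome
  prepares the same state deterministically.\<close>

lemma normalised_channel:
  assumes "\<rho> \<in> normalised_states A"
  shows "channel \<one> A \<rho>"
proof -
  have \<rho>: "\<rho> \<in> St A" "pr (discard A) \<rho> = 1" using assms by (auto simp: normalised_iff)
  obtain cs i where cs: "cs \<in> tests T \<one> A" "i < length cs" "cs ! i = \<rho>"
    using transfE[OF \<rho>(1)] by blast
  then have "cs \<noteq> []" by auto
  then obtain F where F: "channel \<one> A F" "is_sum \<one> A F {..<length cs} (\<lambda>i. cs ! i)"
    using total_coarse_graining cs by blast
  have mem: "\<And>j. j \<in> {..<length cs} \<Longrightarrow> cs ! j \<in> St A" using cs(1) by (auto intro: transfI)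
  have split: "(\<Sum>j<length cs. g j) = g i + (\<Sum>j\<in>{..<length cs} - {i}. g j)" for g :: "nat \<Rightarrow> real"
    using cs(2) by (simp add: sum.remove)
  have "(\<Sum>j\<in>{..<length cs} - {i}. pr (discard A) (cs ! j)) = 0"
    using state_test_sum[OF cs(1)] split[of "\<lambda>j. pr (discard A) (cs ! j)"] cs(3) \<rho>(2) by simp
  then have z: "pr (discard A) (cs ! j) = 0" if "j \<in> {..<length cs} - {i}" for j
    using that mem pr_nonneg[OF _ discard_transf] by (subst (asm) sum_nonneg_eq_0_iff) auto
  have "F = \<rho>"
  proof (rule state_eqI)
    show "F \<in> St A" "\<rho> \<in> St A" using F \<rho> channel_transf by auto
    fix a assume a: "a \<in> Eff A"
    have "pr a F = (\<Sum>j<length cs. pr a (cs ! j))"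
      using F(2) lincomb_state[OF channel_transf[OF F(1)], of "{..<length cs}" "\<lambda>i. cs ! i" "\<lambda>_. 1"] mem a by (simp add: is_sum_def)
    also have "\<dots> = pr a \<rho>"
      using split[of "\<lambda>j. pr a (cs ! j)"] null_state[OF a] z mem cs(3) by simp
    finally show "pr a F = pr a \<rho>" .
  qed
  then show ?thesis using F by simp
qed

lemma channel_state_iff: "channel \<one> A \<rho> \<longleftrightarrow> \<rho> \<in> normalised_states A"
  using normalised_channel channel_normalised by blast

lemma channel_normalised_state: "channel A B F \<Longrightarrow> \<rho> \<in> normalised_states A \<Longrightarrow> F \<cdot> \<rho> \<in> normalised_states B"
  using channel_seq channel_state_iff by blast

lemma normalised_prod: "\<rho> \<in> normalised_states A \<Longrightarrow> \<sigma> \<in> normalised_states B \<Longrightarrow> \<rho> \<otimes> \<sigma> \<in> normalised_states (A \<odot> B)"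
  using channel_par[of \<one> A \<rho> \<one> B \<sigma>] channel_state_iff by simp

lemma discard_normalised: "\<rho> \<in> normalised_states A \<Longrightarrow> discard A \<cdot> \<rho> = ident T \<one>"
  using discard_channel[OF normalised_channel] discard_triv by simp

lemma normalise:
  assumes "\<rho> \<in> St A" "pr (discard A) \<rho> \<noteq> 0"
  shows "\<exists>\<sigma> \<in> normalised_states A. \<forall>a \<in> Eff A. pr a \<rho> = pr (discard A) \<rho> * pr a \<sigma>"
proof -
  have "\<exists>z. vect \<one> A \<rho> z \<noteq> 0"
    using vect_state_unit[OF assms(1) discard_transf] assms(2) by metis
  then obtain \<sigma> where \<sigma>: "\<sigma> \<in> normalised_states A" "is_multiple \<one> A \<rho> \<sigma>"
    using normalisable[of \<rho> A] assms(1) unfolding states_def by blast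
  then obtain r where r: "\<And>z. vect \<one> A \<rho> z = r * vect \<one> A \<sigma> z" by (auto simp: is_multiple_def)
  have *: "pr a \<rho> = r * pr a \<sigma>" if "a \<in> Eff A" for a
    using r[of "(\<one>, ident T \<one>, a)"] that assms(1) \<sigma>(1) by (simp add: vect_state_unit normalised_iff)
  then show ?thesis using \<sigma>(1) by (intro bexI[of _ \<sigma>]) (auto simp: normalised_iff)
qed

lemma scaled_state:
  assumes "\<rho> \<in> St A" "0 \<le> x" "x \<le> 1"
  shows "\<exists>\<sigma> \<in> St A. \<forall>a \<in> Eff A. pr a \<sigma> = x * pr a \<rho>"
proof -
  obtain s where "s \<in> transf \<one> \<one>" "prob T s = x" using scalar_exists assms by blast
  then show ?thesis
    using pr_scaled_state seq_transf assms(1) by (intro bexI[of _ "\<rho> \<cdot> s"]) auto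
qed

lemma scaled_effect:
  assumes "a \<in> Eff A" "0 \<le> x" "x \<le> 1"
  shows "\<exists>b \<in> Eff A. \<forall>\<rho> \<in> St A. pr b \<rho> = x * pr a \<rho>"
proof -
  obtain s where "s \<in> transf \<one> \<one>" "prob T s = x" using scalar_exists assms by blast
  then show ?thesis
    using pr_scaled_effect seq_transf assms(1) by (intro bexI[of _ "s \<cdot> a"]) auto
qed

lemma complement_effect:
  assumes "e \<in> Eff A"
  shows "\<exists>e' \<in> Eff A. \<forall>\<rho> \<in> St A. pr e' \<rho> = pr (discard A) \<rho> - pr e \<rho>"
proof -
  obtain es i where es: "es \<in> tests T A \<one>" "i < length es" "es ! i = e"
    using transfE[OF assms] by blast
  have split: "(\<Sum>j<length es. g j) = g i + (\<Sum>j\<in>{..<length es} - {i}. g j)" for g :: "nat \<Rightarrow> real"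
    using es(2) by (simp add: sum.remove)
  show ?thesis
  \<comment> \<open>A coarse-graining has no empty blocks, so grouping all outcomes except
    \<open>i\<close> requires a second outcome. With a single outcome \<open>e\<close> is the
    discard and its complement the zero effect.\<close>
  proof (cases "length es = 1")
    case True
    then have "pr e \<rho> = pr (discard A) \<rho>" if "\<rho> \<in> St A" for \<rho>
      using effect_test_sum[OF es(1) that] es by simp
    then show ?thesis using scaled_effect[OF discard_transf, of 0 A] by auto
  next
    case False
    have im: "(\<lambda>j. if j = i then 0 else 1) ` {..<length es} = {..<2::nat}"
    proof
      show "{..<2::nat} \<subseteq> (\<lambda>j. if j = i then 0 else 1) ` {..<length es}"
      proof
        fix k :: nat assume "k \<in> {..<2}"
        then have "k = 0 \<or> k = 1" by auto
        moreover have "(if i = 0 then 1 else 0) < length es" "(if i = 0 then 1 else 0) \<noteq> i"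
          using False es(2) by auto
        ultimately show "k \<in> (\<lambda>j. if j = i then 0 else 1) ` {..<length es}"
          using es(2) by (auto simp: image_iff intro: bexI[of _ i] bexI[of _ "if i = 0 then 1 else 0"])
      qed
    qed auto
    obtain fs where fs: "fs \<in> tests T A \<one>" "length fs = 2"
      "\<forall>k<2. is_sum A \<one> (fs ! k) {j. j < length es \<and> (if j = i then 0 else 1) = k} (\<lambda>j. es ! j)"
      using test_coarse_graining[OF es(1) im] by auto
    have set: "{j. j < length es \<and> (if j = i then 0 else 1) = (1::nat)} = {..<length es} - {i}" by auto
    have sum: "is_lincomb A \<one> (fs ! 1) ({..<length es} - {i}) (\<lambda>_. 1) (\<lambda>j. es ! j)"
      using fs(3)[rule_format, of 1] by (simp only: set is_sum_def)
    have f: "fs ! 1 \<in> Eff A" using fs by (intro transfI[OF fs(1)]) auto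
    have mem: "\<And>j. j \<in> {..<length es} - {i} \<Longrightarrow> es ! j \<in> Eff A"
      using es(1) by (auto intro: transfI)
    have "pr (fs ! 1) \<rho> = pr (discard A) \<rho> - pr e \<rho>" if "\<rho> \<in> St A" for \<rho>
      using sum lincomb_effect[OF f, of "{..<length es} - {i}" "\<lambda>i. es ! i" "\<lambda>_. 1"] mem that effect_test_sum[OF es(1) that]
        split[of "\<lambda>j. pr (es ! j) \<rho>"] es(3) by simp
    then show ?thesis using f by blast
  qed
qed

section \<open>Pure and reversible transformations\<close>

lemma multiple_lincomb: "is_multiple A B D C \<longleftrightarrow> (\<exists>r. is_lincomb A B D {()} (\<lambda>_. r) (\<lambda>_. C))"
  by (simp add: is_multiple_def is_lincomb_def)

lemma multiple_state:
  assumes "\<rho> \<in> St A" "\<sigma> \<in> St A"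
  shows "is_multiple \<one> A \<rho> \<sigma> \<longleftrightarrow> (\<exists>r. \<forall>a \<in> Eff A. pr a \<rho> = r * pr a \<sigma>)"
  using lincomb_state[OF assms(1), of "{()}" "\<lambda>_. \<sigma>"] assms by (simp add: multiple_lincomb)

lemma pure_transf: "pure A B F \<Longrightarrow> F \<in> transf A B"
  by (simp add: pure_def)

lemma reversible_channel: "reversible A B U \<Longrightarrow> channel A B U"
  by (simp add: reversible_def)

lemma reversible_ident: "reversible A A (ident T A)"
  unfolding reversible_def using ident_channel seq_ident[OF ident_transf] by blast

lemma reversible_swap: "reversible (A \<odot> B) (B \<odot> A) (swap T A B)"
  unfolding reversible_def using swap_channel swap_inverse by blast

lemma reversible_seq:
  assumes "reversible A B U" "reversible B C V"
  shows "reversible A C (V \<cdot> U)"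
proof -
  obtain U' where U: "channel A B U" "channel B A U'" "U' \<cdot> U = ident T A" "U \<cdot> U' = ident T B"
    using assms(1) by (auto simp: reversible_def)
  obtain V' where V: "channel B C V" "channel C B V'" "V' \<cdot> V = ident T B" "V \<cdot> V' = ident T C"
    using assms(2) by (auto simp: reversible_def)
  note t = U(1,2)[THEN channel_transf] V(1,2)[THEN channel_transf]
  have "(U' \<cdot> V') \<cdot> (V \<cdot> U) = U' \<cdot> (V' \<cdot> (V \<cdot> U))"
    using seq_assoc[OF seq_transf[OF t(1) t(3)] t(4) t(2)] .
  also have "\<dots> = U' \<cdot> ((V' \<cdot> V) \<cdot> U)" using seq_assoc[OF t(1) t(3) t(4)] by simp
  also have "\<dots> = ident T A" using U V t by (simp add: seq_ident)
  finally have 1: "(U' \<cdot> V') \<cdot> (V \<cdot> U) = ident T A" .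
  have "(V \<cdot> U) \<cdot> (U' \<cdot> V') = V \<cdot> (U \<cdot> (U' \<cdot> V'))"
    using seq_assoc[OF seq_transf[OF t(4) t(2)] t(1) t(3)] .
  also have "\<dots> = V \<cdot> ((U \<cdot> U') \<cdot> V')" using seq_assoc[OF t(4) t(2) t(1)] by simp
  also have "\<dots> = ident T C" using U V t by (simp add: seq_ident)
  finally have 2: "(V \<cdot> U) \<cdot> (U' \<cdot> V') = ident T C" .
  show ?thesis
    unfolding reversible_def using 1 2 U V channel_seq by blast
qed

lemma reversible_par_ident:
  assumes "reversible B C U"
  shows "reversible (A \<odot> B) (A \<odot> C) (ident T A \<otimes> U)"
proof -
  obtain V where V: "channel B C U" "channel C B V" "V \<cdot> U = ident T B" "U \<cdot> V = ident T C"
    using assms by (auto simp: reversible_def)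
  note t = V(1,2)[THEN channel_transf]
  have "(ident T A \<otimes> V) \<cdot> (ident T A \<otimes> U) = ident T (A \<odot> B)"
    using interchange[OF ident_transf ident_transf t(1) t(2), of A] V by (simp add: seq_ident[OF ident_transf] par_ident)
  moreover have "(ident T A \<otimes> U) \<cdot> (ident T A \<otimes> V) = ident T (A \<odot> C)"
    using interchange[OF ident_transf ident_transf t(2) t(1), of A] V by (simp add: seq_ident[OF ident_transf] par_ident)
  ultimately show ?thesis
    unfolding reversible_def using V channel_par[OF ident_channel] by blast
qed

text \<open>The inverse of \<open>U\<close> carries a decomposition of \<open>U \<cdot> F\<close>
  back to one of \<open>F\<close>, where purity applies; composing with \<open>U\<close> again
  returns the conclusion.\<close>

lemma pure_post_reversible:
  assumes "pure A B F" "reversible B C U"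
  shows "pure A C (U \<cdot> F)"
proof -
  obtain V where V: "channel B C U" "channel C B V" "V \<cdot> U = ident T B" "U \<cdot> V = ident T C"
    using assms(2) by (auto simp: reversible_def)
  note t = V(1,2)[THEN channel_transf]
  have F: "F \<in> transf A B" using pure_transf assms(1) .
  have VU: "V \<cdot> (U \<cdot> F) = F" using seq_assoc[OF F t] V F by (simp add: seq_ident)
  show ?thesis
    unfolding pure_def
  proof (intro conjI ballI allI impI)
    show UF: "U \<cdot> F \<in> transf A C" using seq_transf F t by blast
    fix ds X i assume ds: "ds \<in> tests T A C" and X: "X \<subseteq> {..<length ds}"
      and sum: "is_sum A C (U \<cdot> F) X ((!) ds)" and i: "i \<in> X"
    have mem: "\<And>i. i \<in> X \<Longrightarrow> ds ! i \<in> transf A C" using X by (auto intro!: test_nth[OF ds])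
    have "is_lincomb A B F X (\<lambda>_. 1) (\<lambda>i. V \<cdot> ds ! i)"
      using lincomb_post[OF UF mem t(2) sum[unfolded is_sum_def]] VU by simp
    then have "is_sum A B F X ((!) (map (\<lambda>G. V \<cdot> G) ds))"
      using X by (auto simp: is_sum_def is_lincomb_def subset_iff intro!: sum.cong)
    then have "is_multiple A B (map (\<lambda>G. V \<cdot> G) ds ! i) F"
      using assms(1) i X test_post_channel[OF ds V(2)] unfolding pure_def by (metis length_map)
    then obtain r where r: "is_lincomb A B (V \<cdot> ds ! i) {()} (\<lambda>_. r) (\<lambda>_. F)"
      using i X by (auto simp: multiple_lincomb)
    have "is_lincomb A C (U \<cdot> (V \<cdot> ds ! i)) {()} (\<lambda>_. r) (\<lambda>_. U \<cdot> F)"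
      by (rule lincomb_post[OF seq_transf[OF mem[OF i] t(2)] F t(1) r])
    moreover have "U \<cdot> (V \<cdot> ds ! i) = ds ! i"
      using seq_assoc[OF mem[OF i] t(2) t(1)] V mem[OF i] by (simp add: seq_ident)
    ultimately show "is_multiple A C (ds ! i) (U \<cdot> F)"
      by (auto simp: multiple_lincomb)
  qed
qed

end

context sharp_theory_with_purification
begin

section \<open>Preparations, convex combinations and extremality\<close>

lemma normalised_exists: "\<exists>\<sigma>. \<sigma> \<in> normalised_states A"
proof -
  obtain a \<rho> where "pure A \<one> a" "\<rho> \<in> states A" "pr a \<rho> = 1" using pure_sharpness by blast
  then have "\<rho> \<in> St A" "pr (discard A) \<rho> \<noteq> 0"
    using pr_le_discard[OF pure_transf] by (fastforce simp: states_def)+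
  then show ?thesis using normalise by blast
qed

lemma normalise_any:
  assumes "\<rho> \<in> St A"
  shows "\<exists>\<sigma> \<in> normalised_states A. \<forall>a \<in> Eff A. pr a \<rho> = pr (discard A) \<rho> * pr a \<sigma>"
proof (cases "pr (discard A) \<rho> = 0")
  case True
  then show ?thesis using null_state[OF _ assms] normalised_exists by auto
next
  case False
  then show ?thesis using normalise assms by blast
qed

text \<open>A random index with the prescribed probabilities is a test of the trivial system;
  preparing the corresponding normalised state conditionally on it realises the list. Null states
  get an arbitrary normalised representative.\<close>

lemma prep_testI:
  assumes "set \<rho>s \<subseteq> St A" "(\<Sum>i<length \<rho>s. pr (discard A) (\<rho>s ! i)) = 1"
  shows "\<rho>s \<in> tests T \<one> A"
proof -
  let ?n = "length \<rho>s"
  have mem: "\<rho>s ! i \<in> St A" if "i < ?n" for i using that assms(1) by auto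
  have "\<forall>i. \<exists>\<sigma>. i < ?n \<longrightarrow> \<sigma> \<in> normalised_states A \<and>
      (\<forall>a \<in> Eff A. pr a (\<rho>s ! i) = pr (discard A) (\<rho>s ! i) * pr a \<sigma>)"
    using normalise_any[OF mem] by blast
  then obtain \<sigma> where \<sigma>: "\<And>i. i < ?n \<Longrightarrow> \<sigma> i \<in> normalised_states A"
    "\<And>i a. i < ?n \<Longrightarrow> a \<in> Eff A \<Longrightarrow> pr a (\<rho>s ! i) = pr (discard A) (\<rho>s ! i) * pr a (\<sigma> i)"
    by metis
  have "\<forall>i. \<exists>s. i < ?n \<longrightarrow> s \<in> transf \<one> \<one> \<and> prob T s = pr (discard A) (\<rho>s ! i)"
    using seq_transf[OF mem discard_transf] by blast
  then obtain s where s: "\<And>i. i < ?n \<Longrightarrow> s i \<in> transf \<one> \<one>"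
    "\<And>i. i < ?n \<Longrightarrow> prob T (s i) = pr (discard A) (\<rho>s ! i)" by metis
  have "(\<Sum>i<?n. prob T (s i)) = 1" using assms(2) s(2) by simp
  then have cs: "map s [0..<?n] \<in> tests T \<one> \<one>"
    using s by (auto simp: tests_triv sum_list_sum_nth atLeast0LessThan)
  have "concat (map (\<lambda>i. map (\<lambda>G. G \<cdot> (map s [0..<?n] ! i)) [\<sigma> i]) [0..<length (map s [0..<?n])]) \<in> tests T \<one> A"
    by (rule test_conditional[OF cs]) (use \<sigma>(1) normalised_channel in \<open>auto simp: channel_def\<close>)
  moreover have "concat (map (\<lambda>i. map (\<lambda>G. G \<cdot> (map s [0..<?n] ! i)) [\<sigma> i]) [0..<length (map s [0..<?n])])
      = map (\<lambda>i. \<sigma> i \<cdot> s i) [0..<?n]"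
  proof -
    have "map (\<lambda>i. map (\<lambda>G. G \<cdot> (map s [0..<?n] ! i)) [\<sigma> i]) [0..<length (map s [0..<?n])]
        = map (\<lambda>i. [\<sigma> i \<cdot> s i]) [0..<?n]" by simp
    then show ?thesis by (simp only: concat_map_singleton)
  qed
  moreover have "map (\<lambda>i. \<sigma> i \<cdot> s i) [0..<?n] = \<rho>s"
  proof (rule nth_equalityI)
    fix i assume "i < length (map (\<lambda>i. \<sigma> i \<cdot> s i) [0..<?n])"
    then have i: "i < ?n" by simp
    have "\<sigma> i \<cdot> s i = \<rho>s ! i"
    proof (rule state_eqI)
      show "\<sigma> i \<cdot> s i \<in> St A"
        using seq_transf[OF s(1)[OF i] normalised_state[OF \<sigma>(1)[OF i]]] .
      fix a assume "a \<in> Eff A"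
      then show "pr a (\<sigma> i \<cdot> s i) = pr a (\<rho>s ! i)"
        using pr_scaled_state[OF s(1)[OF i] normalised_state[OF \<sigma>(1)[OF i]]] \<sigma>(2)[OF i] s(2)[OF i] by metis
    qed (rule mem[OF i])
    then show "map (\<lambda>i. \<sigma> i \<cdot> s i) [0..<?n] ! i = \<rho>s ! i" using i by simp
  qed simp
  ultimately show ?thesis by simp
qed

text \<open>Preparing the components at random and forgetting which one was prepared realises the
  mixture. Single coefficients may exceed 1 and only the total weight \<open>W\<close> is bounded,
  so the mixture is formed with coefficients divided by \<open>W\<close> and then scaled by
  \<open>W\<close>.\<close>

lemma conic_combination:
  assumes "finite I" "\<And>i. i \<in> I \<Longrightarrow> D i \<in> St A" "\<And>i. i \<in> I \<Longrightarrow> 0 \<le> c i"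
    and "(\<Sum>i\<in>I. c i * pr (discard A) (D i)) \<le> 1"
  shows "\<exists>\<tau> \<in> St A. \<forall>a \<in> Eff A. pr a \<tau> = (\<Sum>i\<in>I. c i * pr a (D i))"
proof -
  define W where "W = (\<Sum>i\<in>I. c i * pr (discard A) (D i))"
  have pos: "0 \<le> c i * pr (discard A) (D i)" if "i \<in> I" for i
    using assms that pr_nonneg[OF _ discard_transf] by simp
  have W: "0 \<le> W" "W \<le> 1" using assms(4) pos by (auto simp: W_def intro: sum_nonneg)
  show ?thesis
  proof (cases "W = 0")
    case True
    have "c i * pr a (D i) = 0" if "i \<in> I" "a \<in> Eff A" for i a
    proof -
      have "c i * pr (discard A) (D i) = 0"
        using True pos assms(1) that unfolding W_def by (subst (asm) sum_nonneg_eq_0_iff) auto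
      then show ?thesis using null_state[OF that(2) assms(2)[OF that(1)]] by auto
    qed
    then have "(\<Sum>i\<in>I. c i * pr a (D i)) = 0" if "a \<in> Eff A" for a
      using that by (intro sum.neutral) blast
    moreover obtain \<kappa> where "\<kappa> \<in> normalised_states A" using normalised_exists by blast
    ultimately show ?thesis
      using scaled_state[of \<kappa> A 0] by (simp add: normalised_iff)
  next
    case False
    obtain xs where xs: "set xs = I" "distinct xs" using finite_distinct_list assms(1) by blast
    have "\<forall>i. \<exists>\<sigma>. i \<in> I \<longrightarrow> \<sigma> \<in> St A \<and> (\<forall>a \<in> Eff A. pr a \<sigma> = c i / W * pr a (D i))"
    proof (intro allI)
      fix i
      show "\<exists>\<sigma>. i \<in> I \<longrightarrow> \<sigma> \<in> St A \<and> (\<forall>a \<in> Eff A. pr a \<sigma> = c i / W * pr a (D i))"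
      proof (cases "i \<in> I")
        case True
        obtain \<sigma> where \<sigma>: "\<sigma> \<in> normalised_states A"
          "\<forall>a \<in> Eff A. pr a (D i) = pr (discard A) (D i) * pr a \<sigma>"
          using normalise_any[OF assms(2)[OF True]] by blast
        have "c i * pr (discard A) (D i) \<le> W"
          using True pos assms(1) unfolding W_def by (intro member_le_sum) auto
        then have "c i / W * pr (discard A) (D i) \<le> 1" using W False by (simp add: divide_simps)
        moreover have "0 \<le> c i / W * pr (discard A) (D i)" using pos[OF True] W(1) by simp
        ultimately obtain \<tau> where "\<tau> \<in> St A"
          "\<forall>a \<in> Eff A. pr a \<tau> = c i / W * pr (discard A) (D i) * pr a \<sigma>"
          using scaled_state[of \<sigma> A "c i / W * pr (discard A) (D i)"] \<sigma>(1) by (auto simp: normalised_iff)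
        moreover have "c i / W * pr (discard A) (D i) * pr a \<sigma> = c i / W * pr a (D i)" if "a \<in> Eff A" for a
          using \<sigma>(2) that by (metis mult.assoc)
        ultimately show ?thesis by auto
      qed auto
    qed
    then obtain \<sigma> where \<sigma>: "\<And>i. i \<in> I \<Longrightarrow> \<sigma> i \<in> St A"
      "\<And>i a. i \<in> I \<Longrightarrow> a \<in> Eff A \<Longrightarrow> pr a (\<sigma> i) = c i / W * pr a (D i)" by metis
    let ?cs = "map \<sigma> xs"
    have reindex: "(\<Sum>k<length ?cs. g (?cs ! k)) = (\<Sum>i\<in>I. g (\<sigma> i))" for g :: "'b \<Rightarrow> real"
    proof -
      have "(\<Sum>k<length ?cs. g (?cs ! k)) = sum_list (map (\<lambda>i. g (\<sigma> i)) xs)"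
        by (simp add: sum_list_sum_nth atLeast0LessThan)
      then show ?thesis using xs by (simp add: sum_list_distinct_conv_sum_set)
    qed
    have "(\<Sum>i\<in>I. pr (discard A) (\<sigma> i)) = 1"
      using \<sigma>(2) False by (simp add: W_def flip: sum_divide_distrib)
    then have test: "?cs \<in> tests T \<one> A"
      using reindex[of "pr (discard A)"] \<sigma>(1) xs by (intro prep_testI) auto
    moreover have "?cs \<noteq> []" using False xs by (auto simp: W_def)
    ultimately obtain F where F: "channel \<one> A F" "is_sum \<one> A F {..<length ?cs} (\<lambda>i. ?cs ! i)"
      using total_coarse_graining by blast
    have mem: "\<And>k. k \<in> {..<length ?cs} \<Longrightarrow> ?cs ! k \<in> St A" using test by (auto intro: transfI)
    have Fpr: "pr a F = (\<Sum>i\<in>I. c i * pr a (D i)) / W" if "a \<in> Eff A" for a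
    proof -
      have "pr a F = (\<Sum>k<length ?cs. pr a (?cs ! k))"
        using F lincomb_state[OF channel_transf[OF F(1)], of "{..<length ?cs}" "\<lambda>i. ?cs ! i" "\<lambda>_. 1"] mem that
        by (simp add: is_sum_def)
      also have "\<dots> = (\<Sum>i\<in>I. pr a (\<sigma> i))" by (rule reindex)
      also have "\<dots> = (\<Sum>i\<in>I. c i * pr a (D i)) / W" using \<sigma>(2) that by (simp add: sum_divide_distrib)
      finally show ?thesis .
    qed
    show ?thesis using scaled_state[OF channel_transf[OF F(1)] W] Fpr False by auto
  qed
qed

lemma sum_of_two_states:
  assumes "\<sigma> \<in> St A" "\<tau> \<in> St A" "0 \<le> s" "0 \<le> t"
    and "s * pr (discard A) \<sigma> + t * pr (discard A) \<tau> \<le> 1"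
  shows "\<exists>\<rho> \<in> St A. \<forall>a \<in> Eff A. pr a \<rho> = s * pr a \<sigma> + t * pr a \<tau>"
  using conic_combination[of UNIV "\<lambda>b. if b then \<sigma> else \<tau>" A "\<lambda>b. if b then s else t"] assms
  by (simp add: UNIV_bool add.commute)

text \<open>Extremality among normalised states suffices for purity in the sense of tests: a
  component of weight strictly between 0 and 1 is one end of a two-term mixture whose other end
  gathers all remaining components.\<close>

lemma pure_stateI:
  assumes "\<alpha> \<in> normalised_states A"
    and "\<And>\<sigma> \<tau> t. \<sigma> \<in> normalised_states A \<Longrightarrow> \<tau> \<in> normalised_states A \<Longrightarrow> 0 < t \<Longrightarrow> t < 1 \<Longrightarrow>
      (\<And>a. a \<in> Eff A \<Longrightarrow> pr a \<alpha> = t * pr a \<sigma> + (1 - t) * pr a \<tau>) \<Longrightarrow> \<sigma> = \<alpha>"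
  shows "pure \<one> A \<alpha>"
  unfolding pure_def
proof (intro conjI ballI allI impI)
  show \<alpha>: "\<alpha> \<in> St A" using assms(1) normalised_state by blast
  fix ds X i assume ds: "ds \<in> tests T \<one> A" and X: "X \<subseteq> {..<length ds}"
    and sum: "is_sum \<one> A \<alpha> X ((!) ds)" and i: "i \<in> X"
  have fin: "finite X" using X finite_subset by blast
  have mem: "\<And>i. i \<in> X \<Longrightarrow> ds ! i \<in> St A" using X by (auto intro!: test_nth[OF ds])
  have total: "pr a \<alpha> = pr a (ds ! i) + (\<Sum>j\<in>X - {i}. pr a (ds ! j))" if "a \<in> Eff A" for a
    using sum lincomb_state[OF \<alpha>, of X "\<lambda>i. ds ! i" "\<lambda>_. 1"] mem that i fin by (simp add: is_sum_def sum.remove)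
  let ?r = "pr (discard A) (ds ! i)"
  have r0: "0 \<le> ?r" using pr_nonneg[OF mem[OF i] discard_transf] .
  have rest: "(\<Sum>j\<in>X - {i}. pr (discard A) (ds ! j)) = 1 - ?r"
    using total[OF discard_transf] assms(1) by (simp add: normalised_iff)
  have nn: "0 \<le> (\<Sum>j\<in>X - {i}. pr (discard A) (ds ! j))"
    using mem pr_nonneg[OF _ discard_transf] by (intro sum_nonneg) auto
  consider "?r = 0" | "?r = 1" | "0 < ?r" "?r < 1" using r0 nn rest by linarith
  then have "\<forall>a \<in> Eff A. pr a (ds ! i) = ?r * pr a \<alpha>"
  proof cases
    case 1
    then show ?thesis using null_state mem[OF i] by simp
  next
    case 2
    have "(\<Sum>j\<in>X - {i}. pr a (ds ! j)) = 0" if a: "a \<in> Eff A" for a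
    proof (rule antisym)
      have "(\<Sum>j\<in>X - {i}. pr a (ds ! j)) \<le> (\<Sum>j\<in>X - {i}. pr (discard A) (ds ! j))"
        using a mem pr_le_discard by (intro sum_mono) auto
      then show "(\<Sum>j\<in>X - {i}. pr a (ds ! j)) \<le> 0" using rest 2 by simp
      show "0 \<le> (\<Sum>j\<in>X - {i}. pr a (ds ! j))"
        using a mem pr_nonneg by (intro sum_nonneg) auto
    qed
    then show ?thesis using total 2 by simp
  next
    case 3
    obtain \<sigma> where \<sigma>: "\<sigma> \<in> normalised_states A" "\<forall>a \<in> Eff A. pr a (ds ! i) = ?r * pr a \<sigma>"
      using normalise_any[OF mem[OF i]] by blast
    obtain \<tau> where \<tau>: "\<tau> \<in> St A"
      "\<forall>a \<in> Eff A. pr a \<tau> = (\<Sum>j\<in>X - {i}. inverse (1 - ?r) * pr a (ds ! j))"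
    proof -
      have "(\<Sum>j\<in>X - {i}. inverse (1 - ?r) * pr (discard A) (ds ! j)) \<le> 1"
        using rest 3 by (simp flip: sum_distrib_left)
      then show ?thesis
        using conic_combination[of "X - {i}" "\<lambda>j. ds ! j" A "\<lambda>_. inverse (1 - ?r)"] fin mem 3 that by auto
    qed
    have \<tau>': "(1 - ?r) * pr a \<tau> = (\<Sum>j\<in>X - {i}. pr a (ds ! j))" if "a \<in> Eff A" for a
      using \<tau>(2) that 3 by (simp flip: sum_distrib_left)
    have "\<tau> \<in> normalised_states A"
      using \<tau>(1) \<tau>'[OF discard_transf] rest 3 by (simp add: normalised_iff)
    then have "\<sigma> = \<alpha>"
    proof (rule assms(2)[OF \<sigma>(1) _ 3])
      fix a assume a: "a \<in> Eff A"
      have "pr a (ds ! i) = ?r * pr a \<sigma>" using \<sigma>(2) a by blast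
      then show "pr a \<alpha> = ?r * pr a \<sigma> + (1 - ?r) * pr a \<tau>"
        unfolding total[OF a] \<tau>'[OF a] by (rule arg_cong)
    qed
    then show ?thesis using \<sigma>(2) by metis
  qed
  then show "is_multiple \<one> A (ds ! i) \<alpha>"
    using multiple_state[OF mem[OF i] \<alpha>] by blast
qed

lemma pure_stateD:
  assumes "pure \<one> A \<alpha>" "\<sigma> \<in> St A" "\<tau> \<in> St A"
    and "\<And>a. a \<in> Eff A \<Longrightarrow> pr a \<alpha> = pr a \<sigma> + pr a \<tau>"
  shows "\<exists>r. \<forall>a \<in> Eff A. pr a \<sigma> = r * pr a \<alpha>"
proof -
  have \<alpha>: "\<alpha> \<in> St A" using pure_transf assms(1) .
  obtain \<kappa> where \<kappa>: "\<kappa> \<in> normalised_states A" using normalised_exists by blast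
  obtain \<kappa>' where \<kappa>': "\<kappa>' \<in> St A"
    "\<forall>a \<in> Eff A. pr a \<kappa>' = (1 - pr (discard A) \<alpha>) * pr a \<kappa>"
    using scaled_state[OF normalised_state[OF \<kappa>], of "1 - pr (discard A) \<alpha>"] pr_range[OF \<alpha> discard_transf] by auto
  \<comment> \<open>The third outcome brings the total probability to 1, since
    \<open>\<alpha>\<close> may be subnormalised.\<close>
  let ?ds = "[\<sigma>, \<tau>, \<kappa>']"
  have "?ds \<in> tests T \<one> A"
    using assms \<kappa> \<kappa>' by (intro prep_testI) (auto simp: lessThan_Suc numeral_eq_Suc normalised_iff)
  moreover have "is_sum \<one> A \<alpha> {0, 1} ((!) ?ds)"
    unfolding is_sum_def using assms \<alpha> by (subst lincomb_state) auto
  ultimately have "is_multiple \<one> A (?ds ! 0) \<alpha>"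
    using assms(1) unfolding pure_def by (metis (no_types, lifting) empty_subsetI insertI1 insert_subset length_Cons
        lessThan_iff zero_less_Suc One_nat_def Suc_less_eq)
  then show ?thesis using multiple_state[OF assms(2) \<alpha>] by simp
qed

lemma pure_stateD_normalised:
  assumes "pure \<one> A \<alpha>" "\<alpha> \<in> normalised_states A" "\<sigma> \<in> St A" "\<tau> \<in> St A"
    and "\<And>a. a \<in> Eff A \<Longrightarrow> pr a \<alpha> = pr a \<sigma> + pr a \<tau>" "b \<in> Eff A"
  shows "pr b \<sigma> = pr (discard A) \<sigma> * pr b \<alpha>"
  using pure_stateD[OF assms(1,3,4,5)] assms(2,6) by (auto simp: normalised_iff)

lemma pure_normalise:
  assumes "pure \<one> A \<rho>" "pr (discard A) \<rho> \<noteq> 0"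
  shows "\<exists>\<sigma> \<in> normalised_states A. pure \<one> A \<sigma> \<and> (\<forall>a \<in> Eff A. pr a \<rho> = pr (discard A) \<rho> * pr a \<sigma>)"
proof -
  have \<rho>: "\<rho> \<in> St A" using pure_transf assms(1) .
  let ?r = "pr (discard A) \<rho>"
  have r: "0 \<le> ?r" "?r \<le> 1" using pr_range[OF \<rho> discard_transf] by auto
  obtain \<sigma> where \<sigma>: "\<sigma> \<in> normalised_states A" "\<forall>a \<in> Eff A. pr a \<rho> = ?r * pr a \<sigma>"
    using normalise[OF \<rho> assms(2)] by blast
  have "pure \<one> A \<sigma>"
  proof (rule pure_stateI[OF \<sigma>(1)])
    fix \<sigma>1 \<tau>1 t assume 1: "\<sigma>1 \<in> normalised_states A" "\<tau>1 \<in> normalised_states A" "0 < t" "t < 1"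
      and dec: "\<And>a. a \<in> Eff A \<Longrightarrow> pr a \<sigma> = t * pr a \<sigma>1 + (1 - t) * pr a \<tau>1"
    have "0 \<le> ?r * t" "?r * t \<le> 1" "0 \<le> ?r * (1 - t)" "?r * (1 - t) \<le> 1"
      using r 1 by (auto intro: mult_le_one)
    then obtain s s' where s: "s \<in> St A" "\<forall>a \<in> Eff A. pr a s = ?r * t * pr a \<sigma>1"
      "s' \<in> St A" "\<forall>a \<in> Eff A. pr a s' = ?r * (1 - t) * pr a \<tau>1"
      using scaled_state[OF normalised_state[OF 1(1)]] scaled_state[OF normalised_state[OF 1(2)]] by metis
    have "pr a \<rho> = pr a s + pr a s'" if "a \<in> Eff A" for a
    proof -
      have "pr a \<rho> = ?r * pr a \<sigma>" "pr a s = ?r * t * pr a \<sigma>1" "pr a s' = ?r * (1 - t) * pr a \<tau>1"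
        using that s \<sigma>(2) by blast+
      then show ?thesis using dec[OF that] by (metis distrib_left mult.assoc)
    qed
    then obtain k where k: "\<forall>a \<in> Eff A. pr a s = k * pr a \<rho>"
      using pure_stateD[OF assms(1) s(1,3)] by blast
    have "k * ?r = ?r * t * pr (discard A) \<sigma>1" using k s(2) by (metis discard_transf)
    then have "k * ?r = ?r * t" using 1(1) by (simp add: normalised_iff)
    then have kt: "k = t" using assms(2) by simp
    show "\<sigma>1 = \<sigma>"
    proof (rule state_eqI)
      fix a assume a: "a \<in> Eff A"
      have "?r * t * pr a \<sigma>1 = t * (?r * pr a \<sigma>)" using k s(2) \<sigma>(2) kt a by metis
      then show "pr a \<sigma>1 = pr a \<sigma>" using assms(2) 1 by simp
    qed (use 1 \<sigma> in \<open>auto simp: normalised_iff\<close>)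
  qed
  then show ?thesis using \<sigma> by blast
qed

end

section \<open>Extreme states and steering\<close>

text \<open>The functions are maximised one after another, each on the maximisers of the previous
  ones. All become constant on what remains, so a separating list leaves a single extreme point, and
  the head of the list is maximised over the whole of \<open>K\<close>. Mixtures are expressed
  through values of the functions, so \<open>K\<close> carries a topology only.\<close>

lemma lexicographic_face:
  fixes K :: "'z::topological_space set" and gs :: "('z \<Rightarrow> real) list"
  assumes "compact K" "K \<noteq> {}" "\<forall>g\<in>set gs. continuous_on UNIV g"
  shows "\<exists>K' \<subseteq> K. compact K' \<and> K' \<noteq> {} \<and> (\<forall>g\<in>set gs. \<forall>x\<in>K'. \<forall>y\<in>K'. g x = g y) \<and>
    (\<forall>x\<in>K'. \<forall>y\<in>K. \<forall>z\<in>K. \<forall>t. 0 < t \<longrightarrow> t < 1 \<longrightarrow>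
       (\<forall>g\<in>set gs. g x = t * g y + (1 - t) * g z) \<longrightarrow> y \<in> K') \<and>
    (\<forall>g gs'. gs = g # gs' \<longrightarrow> (\<forall>x\<in>K'. \<forall>y\<in>K. g y \<le> g x))"
  using assms
proof (induction gs arbitrary: K)
  case Nil
  then show ?case by (intro exI[of _ K]) auto
next
  case (Cons g gs)
  have g: "continuous_on UNIV g" using Cons.prems(3) by simp
  then obtain m where m: "m \<in> K" "\<And>y. y \<in> K \<Longrightarrow> g y \<le> g m"
    using continuous_attains_sup[OF Cons.prems(1,2), of g] continuous_on_subset by blast
  define L where "L = K \<inter> {x. g x = g m}"
  have "compact L"
    unfolding L_def using Cons.prems(1) g
    by (intro compact_Int_closed closed_Collect_eq continuous_on_const) auto
  moreover have "L \<noteq> {}" using m by (auto simp: L_def)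
  ultimately obtain K' where K': "K' \<subseteq> L" "compact K'" "K' \<noteq> {}"
    "\<forall>g\<in>set gs. \<forall>x\<in>K'. \<forall>y\<in>K'. g x = g y"
    and face: "\<forall>x\<in>K'. \<forall>y\<in>L. \<forall>z\<in>L. \<forall>t. 0 < t \<longrightarrow> t < 1 \<longrightarrow>
       (\<forall>g\<in>set gs. g x = t * g y + (1 - t) * g z) \<longrightarrow> y \<in> K'"
    using Cons.IH[of L] Cons.prems(3) by auto
  have face': "y \<in> K'" if x: "x \<in> K'" and y: "y \<in> K" and z: "z \<in> K" and t: "0 < t" "t < 1"
    and mix: "\<forall>g\<in>set (g # gs). g x = t * g y + (1 - t) * g z" for x y z t
  proof -
    have eq: "g m = t * g y + (1 - t) * g z" using mix x K'(1) by (auto simp: L_def)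
    \<comment> \<open>A proper mixture attains the maximum only if both of its ends do.\<close>
    have "t * g y \<le> t * g m" "(1 - t) * g z \<le> (1 - t) * g m" using m y z t by auto
    moreover have "t * g m + (1 - t) * g m = g m" by (simp add: algebra_simps)
    ultimately have "t * g y = t * g m" "(1 - t) * g z = (1 - t) * g m" using eq by linarith+
    then have "y \<in> L" "z \<in> L" using y z t by (auto simp: L_def)
    then show ?thesis using face x t mix by auto
  qed
  show ?case
  proof (intro exI[of _ K'] conjI ballI allI impI)
    show "K' \<subseteq> K" using K'(1) by (auto simp: L_def)
    show "h x = h y" if "h \<in> set (g # gs)" "x \<in> K'" "y \<in> K'" for h x y
      using that K'(1,4) by (auto simp: L_def subset_iff)
    show "h y \<le> h x" if "g # gs = h # gs'" "x \<in> K'" "y \<in> K" for h gs' x y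
      using that K'(1) m(2) by (auto simp: L_def)
  qed (use K'(2,3) face' in blast)+
qed

context causal_opt
begin

text \<open>Coordinates are probabilities, so the image is a closed subset of a cube, which is
  compact by Tychonoff's theorem.\<close>

lemma compact_vect: "compact (vect A B ` transf A B)"
proof -
  have "compactin (product_topology (\<lambda>_. euclidean) UNIV) (PiE (UNIV :: ('a \<times> 'b \<times> 'b) set) (\<lambda>_. {0..1::real}))"
    by (subst compactin_PiE) auto
  then have "compact (PiE (UNIV :: ('a \<times> 'b \<times> 'b) set) (\<lambda>_. {0..1::real}))"
    by (simp add: euclidean_product_topology)
  moreover have "vect A B ` transf A B \<subseteq> PiE UNIV (\<lambda>_. {0..1})"
  proof -
    have "0 \<le> vect A B F z \<and> vect A B F z \<le> 1" if "F \<in> transf A B" for F z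
      using pr_range[OF seq_transf[OF _ par_transf[OF that ident_transf]]]
      by (cases z) (auto simp: vect_def states_def effects_def)
    then show ?thesis by auto
  qed
  ultimately show ?thesis
    using closed_transf[of A B] by (metis compact_Int_closed inf.absorb_iff2)
qed

lemma spanning_effects:
  obtains X where "finite X" "X \<subseteq> Eff A"
    "\<And>a. a \<in> Eff A \<Longrightarrow> \<exists>r. \<forall>\<rho> \<in> St A. pr a \<rho> = (\<Sum>b\<in>X. r b * pr b \<rho>)"
proof -
  obtain X where X: "finite X" "X \<subseteq> Eff A" "\<forall>F \<in> Eff A. \<exists>r. is_lincomb A \<one> F X r (\<lambda>G. G)"
    using finite_dimensional[of A \<one>] by blast
  show thesis
  proof (rule that[OF X(1,2)])
    fix a assume a: "a \<in> Eff A"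
    then obtain r where "is_lincomb A \<one> a X r (\<lambda>G. G)" using X(3) by blast
    then show "\<exists>r. \<forall>\<rho> \<in> St A. pr a \<rho> = (\<Sum>b\<in>X. r b * pr b \<rho>)"
      using lincomb_effect[OF a, of X "\<lambda>G. G"] X(2) by blast
  qed
qed

lemma spanning_states:
  obtains X where "finite X" "X \<subseteq> St A"
    "\<And>\<rho>. \<rho> \<in> St A \<Longrightarrow> \<exists>r. \<forall>a \<in> Eff A. pr a \<rho> = (\<Sum>\<sigma>\<in>X. r \<sigma> * pr a \<sigma>)"
proof -
  obtain X where X: "finite X" "X \<subseteq> St A" "\<forall>F \<in> St A. \<exists>r. is_lincomb \<one> A F X r (\<lambda>G. G)"
    using finite_dimensional[of \<one> A] by blast
  show thesis
  proof (rule that[OF X(1,2)])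
    fix a assume a: "a \<in> St A"
    then obtain r where "is_lincomb \<one> A a X r (\<lambda>G. G)" using X(3) by blast
    then show "\<exists>r. \<forall>b \<in> Eff A. pr b a = (\<Sum>\<sigma>\<in>X. r \<sigma> * pr b \<sigma>)"
      using lincomb_state[OF a, of X "\<lambda>G. G"] X(2) by blast
  qed
qed

end

context sharp_theory_with_purification
begin

text \<open>The normalised states annihilated by \<open>N\<close> form a compact face, since
  nonnegative numbers with a vanishing mixture vanish. On it a linear functional is maximised,
  followed by a finite spanning list of effects, which separates states; the surviving state is
  extreme and hence pure.\<close>

lemma extreme_pure_state:
  assumes "N \<subseteq> Eff A" "\<kappa> \<in> normalised_states A" "\<And>n. n \<in> N \<Longrightarrow> pr n \<kappa> = 0"
    and "\<And>i. i \<in> I \<Longrightarrow> e i \<in> Eff A"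
  shows "\<exists>\<alpha> \<in> normalised_states A. pure \<one> A \<alpha> \<and> (\<forall>n\<in>N. pr n \<alpha> = 0) \<and>
    (\<forall>\<sigma> \<in> normalised_states A. (\<forall>n\<in>N. pr n \<sigma> = 0) \<longrightarrow>
      (\<Sum>i\<in>I. c i * pr (e i) \<sigma>) \<le> (\<Sum>i\<in>I. c i * pr (e i) \<alpha>))"
proof -
  obtain X where X: "finite X" "X \<subseteq> Eff A"
    and span: "\<And>a. a \<in> Eff A \<Longrightarrow> \<exists>r. \<forall>\<rho> \<in> St A. pr a \<rho> = (\<Sum>b\<in>X. r b * pr b \<rho>)"
    by (rule spanning_effects[where A = A]) (rule that)
  obtain xs where xs: "set xs = X" using X(1) finite_list by blast
  define ev where "ev a f = f (\<one>, ident T \<one>, a)" for a and f :: "'a \<times> 'b \<times> 'b \<Rightarrow> real"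
  have ev_vect: "ev a (vect \<one> A \<rho>) = pr a \<rho>" if "\<rho> \<in> St A" "a \<in> Eff A" for a \<rho>
    using vect_state_unit[OF that] by (simp add: ev_def)
  have cont: "continuous_on UNIV (ev a)" for a
    unfolding ev_def by (rule continuous_on_product_coordinates)
  define K where "K = vect \<one> A ` St A \<inter> ({f. ev (discard A) f = 1} \<inter> (\<Inter>n\<in>N. {f. ev n f = 0}))"
  have K_iff: "f \<in> K \<longleftrightarrow> (\<exists>\<sigma> \<in> normalised_states A. (\<forall>n\<in>N. pr n \<sigma> = 0) \<and> f = vect \<one> A \<sigma>)" for f
    using assms(1) by (fastforce simp: K_def ev_vect normalised_iff)
  have cK: "compact K"
    unfolding K_def using cont
    by (intro compact_Int_closed compact_vect closed_Int closed_INT ballI closed_Collect_eq continuous_on_const) auto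
  have nK: "K \<noteq> {}" using assms(2,3) K_iff by blast
  define L where "L f = (\<Sum>i\<in>I. c i * ev (e i) f)" for f
  have L_vect: "L (vect \<one> A \<rho>) = (\<Sum>i\<in>I. c i * pr (e i) \<rho>)" if "\<rho> \<in> St A" for \<rho>
    using that assms(4) by (simp add: L_def ev_vect)
  have cL: "\<forall>g\<in>set (L # map ev xs). continuous_on UNIV g"
    using cont unfolding L_def by (auto intro!: continuous_intros)
  obtain K' where K': "K' \<subseteq> K" "K' \<noteq> {}" "\<forall>g\<in>set (L # map ev xs). \<forall>x\<in>K'. \<forall>y\<in>K'. g x = g y"
    and face: "\<forall>x\<in>K'. \<forall>y\<in>K. \<forall>z\<in>K. \<forall>t. 0 < t \<longrightarrow> t < 1 \<longrightarrow>
       (\<forall>g\<in>set (L # map ev xs). g x = t * g y + (1 - t) * g z) \<longrightarrow> y \<in> K'"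
    and "\<forall>g gs'. L # map ev xs = g # gs' \<longrightarrow> (\<forall>x\<in>K'. \<forall>y\<in>K. g y \<le> g x)"
    using lexicographic_face[OF cK nK cL] by (elim exE conjE) (rule that)
  then have maxi: "\<forall>x\<in>K'. \<forall>y\<in>K. L y \<le> L x" by blast
  obtain f where f: "f \<in> K'" using K'(2) by blast
  then obtain \<alpha> where \<alpha>: "\<alpha> \<in> normalised_states A" "\<forall>n\<in>N. pr n \<alpha> = 0" "vect \<one> A \<alpha> \<in> K'"
    using K'(1) K_iff[of f] by auto
  have \<alpha>s: "\<alpha> \<in> St A" using \<alpha>(1) normalised_state by blast
  have "pure \<one> A \<alpha>"
  proof (rule pure_stateI[OF \<alpha>(1)])
    fix \<sigma> \<tau> t assume s: "\<sigma> \<in> normalised_states A" "\<tau> \<in> normalised_states A" and t: "0 < t" "t < 1"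
      and mix: "\<And>a. a \<in> Eff A \<Longrightarrow> pr a \<alpha> = t * pr a \<sigma> + (1 - t) * pr a \<tau>"
    have st: "\<sigma> \<in> St A" "\<tau> \<in> St A" using s normalised_state by auto
    have "pr n \<sigma> = 0 \<and> pr n \<tau> = 0" if "n \<in> N" for n
    proof -
      have n: "n \<in> Eff A" using that assms(1) by blast
      have "0 = t * pr n \<sigma> + (1 - t) * pr n \<tau>" using mix[OF n] \<alpha>(2) that by simp
      moreover have "0 \<le> t * pr n \<sigma>" "0 \<le> (1 - t) * pr n \<tau>" using t st n pr_nonneg by simp_all
      ultimately have "t * pr n \<sigma> = 0" "(1 - t) * pr n \<tau> = 0" by linarith+
      then show ?thesis using t by simp
    qed
    then have K: "vect \<one> A \<sigma> \<in> K" "vect \<one> A \<tau> \<in> K" using K_iff s by blast+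
    have "g (vect \<one> A \<alpha>) = t * g (vect \<one> A \<sigma>) + (1 - t) * g (vect \<one> A \<tau>)" if g: "g \<in> set (L # map ev xs)" for g
    proof -
      consider "g = L" | a where "a \<in> X" "g = ev a" using g xs by auto
      then show ?thesis
      proof cases
        case 1
        have "L (vect \<one> A \<alpha>) = (\<Sum>i\<in>I. t * (c i * pr (e i) \<sigma>) + (1 - t) * (c i * pr (e i) \<tau>))"
          unfolding L_vect[OF \<alpha>s]
        proof (rule sum.cong[OF refl])
          fix i assume "i \<in> I"
          then have "pr (e i) \<alpha> = t * pr (e i) \<sigma> + (1 - t) * pr (e i) \<tau>" using mix assms(4) by blast
          then show "c i * pr (e i) \<alpha> = t * (c i * pr (e i) \<sigma>) + (1 - t) * (c i * pr (e i) \<tau>)"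
            by (metis distrib_left mult.left_commute)
        qed
        then show ?thesis
          using 1 st by (simp add: L_vect sum.distrib sum_distrib_left)
      next
        case 2
        then show ?thesis using mix[of a] X(2) st \<alpha>s by (auto simp: ev_vect)
      qed
    qed
    then have "vect \<one> A \<sigma> \<in> K'" using face \<alpha>(3) K t by blast
    then have same: "g (vect \<one> A \<sigma>) = g (vect \<one> A \<alpha>)" if "g \<in> set (L # map ev xs)" for g
      using K'(3) \<alpha>(3) that by blast
    have eq: "pr b \<sigma> = pr b \<alpha>" if b: "b \<in> X" for b
    proof -
      have "b \<in> Eff A" "ev b \<in> set (L # map ev xs)" using b X(2) xs by auto
      then show ?thesis
        using same[of "ev b"] ev_vect[OF st(1)] ev_vect[OF \<alpha>s] by metis
    qed
    show "\<sigma> = \<alpha>"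
    proof (rule state_eqI[OF st(1) \<alpha>s])
      fix a assume "a \<in> Eff A"
      then obtain r where r: "\<And>\<rho>. \<rho> \<in> St A \<Longrightarrow> pr a \<rho> = (\<Sum>b\<in>X. r b * pr b \<rho>)" using span by blast
      show "pr a \<sigma> = pr a \<alpha>"
        unfolding r[OF st(1)] r[OF \<alpha>s] by (rule sum.cong) (simp_all add: eq)
    qed
  qed
  moreover have "L (vect \<one> A \<sigma>) \<le> L (vect \<one> A \<alpha>)" if "\<sigma> \<in> normalised_states A" "\<forall>n\<in>N. pr n \<sigma> = 0" for \<sigma>
    using maxi \<alpha>(3) K_iff that by blast
  ultimately show ?thesis
    using \<alpha> \<alpha>s L_vect normalised_state by (intro bexI[of _ \<alpha>]) auto
qed

lemma pure_state_exists: "\<exists>\<alpha> \<in> normalised_states A. pure \<one> A \<alpha>"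
proof -
  obtain \<kappa> where "\<kappa> \<in> normalised_states A" using normalised_exists by blast
  then show ?thesis using extreme_pure_state[of "{}" A \<kappa> "{}::nat set" "\<lambda>_. discard A" "\<lambda>_. 0"] by auto
qed

lemma maximising_pure_state:
  assumes "e \<in> Eff A"
  shows "\<exists>\<alpha> \<in> normalised_states A. pure \<one> A \<alpha> \<and> (\<forall>\<sigma> \<in> normalised_states A. pr e \<sigma> \<le> pr e \<alpha>)"
proof -
  obtain \<kappa> where "\<kappa> \<in> normalised_states A" using normalised_exists by blast
  then show ?thesis using extreme_pure_state[of "{}" A \<kappa> "{()}" "\<lambda>_. e" "\<lambda>_. 1"] assms by auto
qed

text \<open>The difference of the two effects attains its maximum over normalised states at a pure
  state, where it is 0 by assumption; so does the opposite difference.\<close>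

lemma effect_eq_on_pure:
  assumes "e \<in> Eff A" "f \<in> Eff A"
    and "\<And>\<alpha>. \<alpha> \<in> normalised_states A \<Longrightarrow> pure \<one> A \<alpha> \<Longrightarrow> pr e \<alpha> = pr f \<alpha>"
  shows "e = f"
proof -
  have le: "pr e \<sigma> \<le> pr f \<sigma>" if prem: "\<sigma> \<in> normalised_states A" "e \<in> Eff A" "f \<in> Eff A"
    "\<And>\<alpha>. \<alpha> \<in> normalised_states A \<Longrightarrow> pure \<one> A \<alpha> \<Longrightarrow> pr e \<alpha> = pr f \<alpha>" for e f \<sigma>
  proof -
    have "(if b then e else f) \<in> Eff A" for b using prem(2,3) by simp
    then obtain \<alpha> where \<alpha>: "\<alpha> \<in> normalised_states A" "pure \<one> A \<alpha>"
      "\<forall>\<sigma> \<in> normalised_states A. (\<Sum>b\<in>UNIV. (if b then 1 else -1) * pr (if b then e else f) \<sigma>)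
        \<le> (\<Sum>b\<in>UNIV. (if b then 1 else -1) * pr (if b then e else f) \<alpha>)"
      using extreme_pure_state[of "{}" A \<sigma> UNIV "\<lambda>b. if b then e else f" "\<lambda>b. if b then 1 else -1"] prem(1)
      by auto
    then have "pr e \<sigma> - pr f \<sigma> \<le> pr e \<alpha> - pr f \<alpha>" using prem(1) by (auto simp: UNIV_bool)
    then show ?thesis using prem(4)[OF \<alpha>(1,2)] by simp
  qed
  show ?thesis
  proof (rule effect_eqI[OF assms(1,2)])
    fix \<rho> assume \<rho>: "\<rho> \<in> St A"
    obtain \<sigma> where \<sigma>: "\<sigma> \<in> normalised_states A" "\<forall>a \<in> Eff A. pr a \<rho> = pr (discard A) \<rho> * pr a \<sigma>"
      using normalise_any[OF \<rho>] by blast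
    have "pr e \<sigma> = pr f \<sigma>" using le[of \<sigma> e f] le[of \<sigma> f e] \<sigma>(1) assms by force
    then show "pr e \<rho> = pr f \<rho>" using \<sigma>(2) assms(1,2) by metis
  qed
qed

text \<open>All normalised states of \<open>A\<close> have the same marginal on the trivial system,
  so two pure ones are purifications of one state.\<close>

lemma pure_states_transitive:
  assumes "\<alpha> \<in> normalised_states A" "pure \<one> A \<alpha>" "\<beta> \<in> normalised_states A" "pure \<one> A \<beta>"
  shows "\<exists>U. reversible A A U \<and> \<beta> = U \<cdot> \<alpha>"
proof -
  have m: "marginal \<one> A \<gamma> = ident T \<one>" if "\<gamma> \<in> normalised_states A" for \<gamma>
    using discard_normalised[OF that] par_unit(2)[OF discard_transf] by (simp add: marginal_def)
  obtain U where U: "reversible A A U" "\<beta> = (ident T \<one> \<otimes> U) \<cdot> \<alpha>"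
    using purification_unique[of \<alpha> \<one> A \<beta>] assms m by auto
  then show ?thesis using par_unit(2) reversible_channel channel_transf by metis
qed

text \<open>A dilation followed by a purification puts the whole ensemble into one pure state
  \<open>\<Omega>\<close> of \<open>A \<odot> Z\<close>, where reading out \<open>X\<close> yields
  the outcomes. Since \<open>\<Omega>\<close> and \<open>\<Psi>\<close> have the same marginal on
  \<open>A\<close>, uniqueness of purification gives a channel on the purifying side that turns
  \<open>\<Psi>\<close> into \<open>\<Omega>\<close>; the readout follows it.\<close>

theorem steering:
  assumes \<Psi>: "\<Psi> \<in> normalised_states (A \<odot> B)" "pure \<one> (A \<odot> B) \<Psi>"
    and \<Theta>s: "\<Theta>s \<in> tests T \<one> (A \<odot> C)"
    and marg: "\<And>a. a \<in> Eff A \<Longrightarrow>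
      (\<Sum>i<length \<Theta>s. pr (a \<otimes> discard C) (\<Theta>s ! i)) = pr (a \<otimes> discard B) \<Psi>"
  shows "\<exists>Ts \<in> tests T B C. length Ts = length \<Theta>s \<and> (\<forall>i<length \<Theta>s. (ident T A \<otimes> Ts ! i) \<cdot> \<Psi> = \<Theta>s ! i)"
proof -
  obtain X F es where F: "channel \<one> (A \<odot> C \<odot> X) F" and es: "es \<in> tests T X \<one>" "length es = length \<Theta>s"
    and F\<Theta>: "\<And>i. i < length \<Theta>s \<Longrightarrow> \<Theta>s ! i = (ident T (A \<odot> C) \<otimes> es ! i) \<cdot> F"
    using test_dilation[OF \<Theta>s] by auto
  obtain Y \<Omega> where \<Omega>: "\<Omega> \<in> normalised_states (A \<odot> C \<odot> X \<odot> Y)" "pure \<one> (A \<odot> C \<odot> X \<odot> Y) \<Omega>"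
    and \<Omega>F: "marginal (A \<odot> C \<odot> X) Y \<Omega> = F"
    using purification_exists[of F "A \<odot> C \<odot> X"] channel_normalised[OF F] by blast
  define Z where "Z = C \<odot> X \<odot> Y"
  have AZ: "A \<odot> C \<odot> X \<odot> Y = A \<odot> Z" "(A \<odot> C) \<odot> (X \<odot> Y) = A \<odot> Z" by (simp_all add: Z_def)
  note \<Omega> = \<Omega>[unfolded AZ]
  \<comment> \<open>Uniqueness of purification compares states with the same purifying system. Pure
    states pad \<open>\<Psi>\<close> by \<open>Z\<close> and \<open>\<Omega>\<close> by
    \<open>B\<close>, and \<open>S\<close> brings the latter into the order \<open>A\<close>,
    \<open>B\<close>, \<open>Z\<close>.\<close>
  obtain \<beta> where \<beta>: "\<beta> \<in> normalised_states B" "pure \<one> B \<beta>" using pure_state_exists by blast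
  obtain \<phi> where \<phi>: "\<phi> \<in> normalised_states Z" "pure \<one> Z \<phi>" using pure_state_exists by blast
  note st = \<Psi>(1)[THEN normalised_state] \<Omega>(1)[THEN normalised_state] \<beta>(1)[THEN normalised_state]
    \<phi>(1)[THEN normalised_state] channel_transf[OF F]
  define S where "S = ident T A \<otimes> swap T Z B"
  have S: "S \<in> transf (A \<odot> Z \<odot> B) (A \<odot> B \<odot> Z)" "reversible (A \<odot> Z \<odot> B) (A \<odot> B \<odot> Z) S"
    using reversible_par_ident[OF reversible_swap, of A Z B] reversible_channel channel_transf
    by (auto simp: S_def)
  let ?\<Psi> = "\<Psi> \<otimes> \<phi>" and ?\<Omega> = "S \<cdot> (\<Omega> \<otimes> \<beta>)"
  have \<Psi>': "?\<Psi> \<in> normalised_states (A \<odot> B \<odot> Z)" "pure \<one> (A \<odot> B \<odot> Z) ?\<Psi>"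
    using normalised_prod[OF \<Psi>(1) \<phi>(1)] pure_par[OF \<Psi>(2) \<phi>(2)] by simp_all
  have \<Omega>\<beta>: "\<Omega> \<otimes> \<beta> \<in> normalised_states (A \<odot> Z \<odot> B)" "pure \<one> (A \<odot> Z \<odot> B) (\<Omega> \<otimes> \<beta>)"
    using normalised_prod[OF \<Omega>(1) \<beta>(1)] pure_par[OF \<Omega>(2) \<beta>(2)] by simp_all
  have \<Omega>\<beta>t: "\<Omega> \<otimes> \<beta> \<in> St (A \<odot> (Z \<odot> B))" using normalised_state[OF \<Omega>\<beta>(1)] by simp
  have \<Omega>': "?\<Omega> \<in> normalised_states (A \<odot> B \<odot> Z)" "pure \<one> (A \<odot> B \<odot> Z) ?\<Omega>"
    using channel_normalised_state[OF reversible_channel[OF S(2)] \<Omega>\<beta>(1)] pure_post_reversible[OF \<Omega>\<beta>(2) S(2)]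
    by simp_all
  have m1: "marginal A (B \<odot> Z) ?\<Psi> = (ident T A \<otimes> discard B) \<cdot> \<Psi>"
  proof -
    have "ident T A \<otimes> discard (B \<odot> Z) = (ident T A \<otimes> discard B) \<otimes> discard Z"
      using par_assoc[OF ident_transf discard_transf discard_transf, of A B Z] discard_par by simp
    then have "marginal A (B \<odot> Z) ?\<Psi> = ((ident T A \<otimes> discard B) \<cdot> \<Psi>) \<otimes> (discard Z \<cdot> \<phi>)"
      using prod_state_apply[OF st(1,4) right_transf[OF discard_transf] discard_transf]
      by (simp add: marginal_def)
    then show ?thesis
      using discard_normalised[OF \<phi>(1)] par_unit(1)[OF right_state[OF st(1) discard_transf]] by simp
  qed
  have \<Omega>back: "(ident T A \<otimes> (ident T Z \<otimes> discard B)) \<cdot> (\<Omega> \<otimes> \<beta>) = \<Omega>"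
  proof -
    have "ident T A \<otimes> (ident T Z \<otimes> discard B) = ident T (A \<odot> Z) \<otimes> discard B"
      using par_assoc[OF ident_transf ident_transf discard_transf, of A Z B] par_ident by simp
    then show ?thesis
      using prod_state_apply[OF st(2,3) ident_transf discard_transf] discard_normalised[OF \<beta>(1)]
        seq_ident(2)[OF st(2)] par_unit(1)[OF st(2)] by simp
  qed
  have F\<Omega>: "(ident T (A \<odot> C \<odot> X) \<otimes> discard Y) \<cdot> \<Omega> = F"
    using \<Omega>F by (simp add: marginal_def)
  have m2: "marginal A (B \<odot> Z) ?\<Omega> = (ident T A \<otimes> discard Z) \<cdot> \<Omega>"
  proof -
    have "marginal A (B \<odot> Z) ?\<Omega> = (ident T A \<otimes> (discard (B \<odot> Z) \<cdot> swap T Z B)) \<cdot> (\<Omega> \<otimes> \<beta>)"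
      unfolding marginal_def S_def
      by (rule right_of_right[OF \<Omega>\<beta>t swap_transf discard_transf])
    also have "discard (B \<odot> Z) \<cdot> swap T Z B = discard Z \<cdot> (ident T Z \<otimes> discard B)"
      using discard_channel[OF swap_channel[of Z B]]
        discard_channel[OF channel_par[OF ident_channel channel_discard], of Z B] by simp
    also have "(ident T A \<otimes> (discard Z \<cdot> (ident T Z \<otimes> discard B))) \<cdot> (\<Omega> \<otimes> \<beta>)
        = (ident T A \<otimes> discard Z) \<cdot> (ident T A \<otimes> (ident T Z \<otimes> discard B)) \<cdot> (\<Omega> \<otimes> \<beta>)"
      by (rule right_of_right[OF \<Omega>\<beta>t right_transf[OF discard_transf] discard_transf, symmetric])
    finally show ?thesis by (simp add: \<Omega>back)
  qed
  have CXY: "discard Z = (discard C \<otimes> discard X) \<otimes> discard Y" by (simp add: Z_def discard_par)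
  \<comment> \<open>The marginal hypothesis on the ensemble enters here: summing over the readout of
    \<open>X\<close> amounts to discarding it.\<close>
  have "(ident T A \<otimes> discard B) \<cdot> \<Psi> = (ident T A \<otimes> discard Z) \<cdot> \<Omega>"
  proof (rule state_eqI)
    show "(ident T A \<otimes> discard B) \<cdot> \<Psi> \<in> St A" "(ident T A \<otimes> discard Z) \<cdot> \<Omega> \<in> St A"
      using right_state st discard_transf by blast+
    fix a assume a: "a \<in> Eff A"
    have aC: "a \<otimes> discard C \<in> Eff (A \<odot> C)" by (rule pair_transf[OF a discard_transf])
    have "pr (a \<otimes> discard C) (\<Theta>s ! i) = pr (es ! i) (((a \<otimes> discard C) \<otimes> ident T X) \<cdot> F)" if "i < length \<Theta>s" for i
    proof -
      have e: "es ! i \<in> Eff X" using that es by (auto intro: test_nth)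
      have "F \<in> St ((A \<odot> C) \<odot> X)" using st(5) by simp
      then show ?thesis
        using pr_right[OF _ aC e] pr_left[OF _ aC e] F\<Theta>[OF that] by simp
    qed
    then have "(\<Sum>i<length \<Theta>s. pr (a \<otimes> discard C) (\<Theta>s ! i))
        = (\<Sum>i<length es. pr (es ! i) (((a \<otimes> discard C) \<otimes> ident T X) \<cdot> F))"
      using es(2) by simp
    also have "\<dots> = pr (discard X) (((a \<otimes> discard C) \<otimes> ident T X) \<cdot> F)"
      using effect_test_sum[OF es(1) left_state[OF _ aC]] st(5) by simp
    also have "\<dots> = pr ((a \<otimes> discard C) \<otimes> discard X) F"
      using pr_left[OF _ aC discard_transf] st(5) by simp
    also have "\<dots> = pr (((a \<otimes> discard C) \<otimes> discard X) \<otimes> discard Y) \<Omega>"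
    proof -
      have aCX: "(a \<otimes> discard C) \<otimes> discard X \<in> Eff (A \<odot> C \<odot> X)"
        using pair_transf[OF aC discard_transf, of X] by simp
      have "\<Omega> \<in> St ((A \<odot> C \<odot> X) \<odot> Y)" using st(2) by (simp add: Z_def)
      then show ?thesis using pr_right[OF _ aCX discard_transf] F\<Omega> by metis
    qed
    also have "((a \<otimes> discard C) \<otimes> discard X) \<otimes> discard Y = a \<otimes> discard Z"
      unfolding CXY
      using par_assoc[OF a discard_transf discard_transf, of C X] par_assoc[OF a _ discard_transf, of "discard C \<otimes> discard X" "C \<odot> X" \<one> Y]
        discard_par[of C X] discard_transf[of "C \<odot> X"] by simp
    also have "pr (a \<otimes> discard Z) \<Omega> = pr a ((ident T A \<otimes> discard Z) \<cdot> \<Omega>)"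
      using pr_right[OF st(2) a discard_transf] by simp
    finally show "pr a ((ident T A \<otimes> discard B) \<cdot> \<Psi>) = pr a ((ident T A \<otimes> discard Z) \<cdot> \<Omega>)"
      using marg[OF a] pr_right[OF st(1) a discard_transf] by simp
  qed
  then obtain U where U: "reversible (B \<odot> Z) (B \<odot> Z) U" "?\<Omega> = (ident T A \<otimes> U) \<cdot> ?\<Psi>"
    using purification_unique[of ?\<Psi> A "B \<odot> Z" ?\<Omega>] \<Psi>' \<Omega>' m1 m2 by auto
  have Ut: "U \<in> transf (B \<odot> Z) (B \<odot> Z)" using U(1) reversible_channel channel_transf by blast
  \<comment> \<open>\<open>Q\<close> undoes the reordering and discards the padding
    \<open>\<beta>\<close>. The channel \<open>R\<close> below appends \<open>\<phi>\<close>,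
    applies \<open>U\<close> and then \<open>Q\<close>, and so takes \<open>\<Psi>\<close> to
    \<open>\<Omega>\<close>.\<close>
  define Q where "Q = (ident T Z \<otimes> discard B) \<cdot> swap T B Z"
  have Qch: "channel (B \<odot> Z) Z Q"
    unfolding Q_def using channel_seq[OF swap_channel] channel_par[OF ident_channel channel_discard, of Z B] by simp
  have J: "channel B (B \<odot> Z) (ident T B \<otimes> \<phi>)"
    using channel_par[OF ident_channel normalised_channel[OF \<phi>(1)], of B] by simp
  define R where "R = Q \<cdot> U \<cdot> (ident T B \<otimes> \<phi>)"
  have Rch: "channel B Z R"
    unfolding R_def using J Qch reversible_channel[OF U(1)] channel_seq by blast
  have R\<Psi>: "(ident T A \<otimes> R) \<cdot> \<Psi> = \<Omega>"
  proof -
    have "(ident T A \<otimes> R) \<cdot> \<Psi> = (ident T A \<otimes> Q) \<cdot> (ident T A \<otimes> (U \<cdot> (ident T B \<otimes> \<phi>))) \<cdot> \<Psi>"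
      unfolding R_def using right_of_right[OF st(1) seq_transf[OF channel_transf[OF J] Ut] channel_transf[OF Qch]] by simp
    also have "(ident T A \<otimes> (U \<cdot> (ident T B \<otimes> \<phi>))) \<cdot> \<Psi>
        = (ident T A \<otimes> U) \<cdot> (ident T A \<otimes> (ident T B \<otimes> \<phi>)) \<cdot> \<Psi>"
      using right_of_right[OF st(1) channel_transf[OF J] Ut] by simp
    also have "(ident T A \<otimes> (ident T B \<otimes> \<phi>)) \<cdot> \<Psi> = ?\<Psi>"
      using par_assoc[OF ident_transf ident_transf st(4), of A B] par_ident[of A B] state_prod_ident(1)[OF st(1,4)] by simp
    also have "(ident T A \<otimes> U) \<cdot> ?\<Psi> = ?\<Omega>" using U(2) by simp
    also have "(ident T A \<otimes> Q) \<cdot> ?\<Omega> = (ident T A \<otimes> (Q \<cdot> swap T Z B)) \<cdot> (\<Omega> \<otimes> \<beta>)"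
      unfolding S_def by (rule right_of_right[OF \<Omega>\<beta>t swap_transf channel_transf[OF Qch]])
    also have "Q \<cdot> swap T Z B = ident T Z \<otimes> discard B"
      unfolding Q_def
      using seq_assoc[OF swap_transf swap_transf right_transf[OF discard_transf], of Z B]
        swap_inverse[of Z B] seq_ident(1)[OF right_transf[OF discard_transf]]
      by (simp add: swap_inverse)
    finally show ?thesis by (simp add: \<Omega>back)
  qed
  let ?G = "\<lambda>e. (ident T C \<otimes> e) \<otimes> discard Y"
  let ?Ts = "map (\<lambda>G. G \<cdot> R) (map (\<lambda>F. F \<otimes> discard Y) (map (\<lambda>e. ident T C \<otimes> e) es))"
  have G: "map (\<lambda>F. F \<otimes> discard Y) (map (\<lambda>e. ident T C \<otimes> e) es) \<in> tests T Z C"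
    using test_channel_par[OF test_par_channel[OF ident_channel[of C] es(1)] channel_discard[of Y]] by (simp add: Z_def)
  have "?Ts \<in> tests T B C" using test_pre_channel[OF Rch G] .
  moreover have "(ident T A \<otimes> ?Ts ! i) \<cdot> \<Psi> = \<Theta>s ! i" if i: "i < length \<Theta>s" for i
  proof -
    have e: "es ! i \<in> Eff X" using i es by (auto intro: test_nth)
    have Ce: "ident T C \<otimes> es ! i \<in> transf (C \<odot> X) C" by (rule right_transf[OF e])
    have Gi: "?G (es ! i) \<in> transf Z C"
      using par_transf[OF Ce discard_transf, of Y] by (simp add: Z_def)
    have "(ident T A \<otimes> ?Ts ! i) \<cdot> \<Psi> = (ident T A \<otimes> (?G (es ! i) \<cdot> R)) \<cdot> \<Psi>"
      using i es(2) by simp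
    also have "\<dots> = (ident T A \<otimes> ?G (es ! i)) \<cdot> \<Omega>"
      using right_of_right[OF st(1) channel_transf[OF Rch] Gi] R\<Psi> by simp
    also have "ident T A \<otimes> ?G (es ! i) = (ident T (A \<odot> C) \<otimes> es ! i) \<otimes> discard Y"
      using par_assoc[OF ident_transf Ce discard_transf, of A Y] par_assoc[OF ident_transf ident_transf e, of A C]
      by (simp add: par_ident)
    also have "\<dots> = (ident T (A \<odot> C) \<otimes> es ! i) \<cdot> (ident T (A \<odot> C \<odot> X) \<otimes> discard Y)"
      using par_split_left[OF right_transf[OF e, of "A \<odot> C"] discard_transf[of Y]]
        par_unit(1)[OF right_transf[OF e, of "A \<odot> C"]] by simp
    also have "\<dots> \<cdot> \<Omega> = (ident T (A \<odot> C) \<otimes> es ! i) \<cdot> F"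
    proof -
      have "\<Omega> \<in> St ((A \<odot> C \<odot> X) \<odot> Y)" using st(2) by (simp add: Z_def)
      moreover have "ident T (A \<odot> C) \<otimes> es ! i \<in> transf (A \<odot> C \<odot> X) (A \<odot> C)"
        using right_transf[OF e, of "A \<odot> C"] by simp
      ultimately show ?thesis
        using seq_assoc[OF _ right_transf[OF discard_transf]] F\<Omega> by metis
    qed
    also have "\<dots> = \<Theta>s ! i" using F\<Theta>[OF i] by simp
    finally show ?thesis .
  qed
  ultimately show ?thesis using es(2) by (intro bexI[of _ ?Ts]) auto
qed

end

section \<open>Pure effects\<close>

text \<open>Sampling a function of the span at finitely many points yields coefficients that are
  linear in the samples, through a matrix \<open>d\<close> independent of the function. They are
  thus bounded by the sampled values and continuous in them, which an arbitrary choice of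
  coefficients would not ensure.\<close>

lemma finite_reconstruction:
  fixes F :: "'i \<Rightarrow> 'x \<Rightarrow> real"
  assumes "finite X"
  shows "\<exists>S0 d. finite S0 \<and> S0 \<subseteq> S \<and> (\<forall>r f. (\<forall>x\<in>S. f x = (\<Sum>k\<in>X. r k * F k x)) \<longrightarrow>
    (\<forall>x\<in>S. f x = (\<Sum>k\<in>X. (\<Sum>s\<in>S0. d k s * f s) * F k x)))"
  using assms
proof induction
  case empty
  then show ?case by (intro exI[of _ "{}"]) auto
next
  case (insert h X)
  obtain S0 d where S0: "finite S0" "S0 \<subseteq> S" and rec0: "\<forall>r f. (\<forall>x\<in>S. f x = (\<Sum>k\<in>X. r k * F k x)) \<longrightarrow>
    (\<forall>x\<in>S. f x = (\<Sum>k\<in>X. (\<Sum>s\<in>S0. d k s * f s) * F k x))"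
    using insert.IH by (elim exE conjE) (rule that)
  have rec: "f x = (\<Sum>k\<in>X. (\<Sum>s\<in>S0. d k s * f s) * F k x)"
    if "\<And>x. x \<in> S \<Longrightarrow> f x = (\<Sum>k\<in>X. r k * F k x)" "x \<in> S" for r f x
    by (rule rec0[rule_format, OF that])
  \<comment> \<open>\<open>L f\<close> is the reconstruction with the functions of \<open>X\<close>,
    which fixes their span. Hence the residual of \<open>f\<close> is its coefficient at
    \<open>h\<close> times the residual \<open>h'\<close> of \<open>F h\<close>.\<close>
  define L where "L f x = (\<Sum>k\<in>X. (\<Sum>s\<in>S0. d k s * f s) * F k x)" for f x
  define h' where "h' x = F h x - L (F h) x" for x
  have split: "f x - L f x = r h * h' x"
    if f: "\<And>x. x \<in> S \<Longrightarrow> f x = (\<Sum>k\<in>insert h X. r k * F k x)" and x: "x \<in> S" for f r x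
  proof -
    let ?g = "\<lambda>x. f x - r h * F h x"
    have "?g x = (\<Sum>k\<in>X. (\<Sum>s\<in>S0. d k s * ?g s) * F k x)"
      by (rule rec[where r = r]) (use f x insert.hyps in simp_all)
    also have "\<dots> = (\<Sum>k\<in>X. ((\<Sum>s\<in>S0. d k s * f s) - r h * (\<Sum>s\<in>S0. d k s * F h s)) * F k x)"
      by (simp add: right_diff_distrib sum_subtractf sum_distrib_left mult.left_commute)
    also have "\<dots> = L f x - r h * L (F h) x"
      by (simp add: L_def left_diff_distrib sum_subtractf sum_distrib_left[where A = X] mult.assoc)
    finally show ?thesis by (simp add: h'_def algebra_simps)
  qed
  show ?case
  proof (cases "\<forall>x\<in>S. h' x = 0")
    case True
    have "f x = (\<Sum>k\<in>insert h X. (\<Sum>s\<in>S0. (if k = h then 0 else d k s) * f s) * F k x)"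
      if f: "\<forall>x\<in>S. f x = (\<Sum>k\<in>insert h X. r k * F k x)" and x: "x \<in> S" for r f x
    proof -
      have "f x = L f x" using split[of f r x] f x True by simp
      also have "\<dots> = (\<Sum>k\<in>X. (\<Sum>s\<in>S0. (if k = h then 0 else d k s) * f s) * F k x)"
        unfolding L_def
      proof (rule sum.cong[OF refl])
        fix k assume "k \<in> X"
        then have "k \<noteq> h" using insert.hyps by auto
        then show "(\<Sum>s\<in>S0. d k s * f s) * F k x = (\<Sum>s\<in>S0. (if k = h then 0 else d k s) * f s) * F k x"
          by simp
      qed
      finally show ?thesis using insert.hyps by simp
    qed
    then show ?thesis using S0 by (intro exI[of _ S0] exI[of _ "\<lambda>k s. if k = h then 0 else d k s"]) blast
  next
    case False
    then obtain s1 where s1: "s1 \<in> S" "h' s1 \<noteq> 0" by blast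
    define S1 where "S1 = insert s1 S0"
    \<comment> \<open>The functional \<open>e\<close> returns the coefficient at \<open>h\<close>:
      the residual of \<open>f\<close> at the new sampling point \<open>s1\<close>, divided by
      \<open>h' s1\<close>. In \<open>d'\<close> the old matrix acts on \<open>f\<close> with this
      multiple of \<open>F h\<close> removed.\<close>
    define e where "e s = ((if s = s1 then 1 else 0) - (if s \<in> S0 then (\<Sum>k\<in>X. d k s * F k s1) else 0)) / h' s1" for s
    define d' where "d' k s = (if k = h then e s else (if s \<in> S0 then d k s else 0) - e s * (\<Sum>s\<in>S0. d k s * F h s))" for k s
    have S1: "finite S1" "S1 \<subseteq> S" using S0 s1 by (auto simp: S1_def)
    have ext: "(\<Sum>s\<in>S1. (if s \<in> S0 then c s else 0) * f s) = (\<Sum>s\<in>S0. c s * f s)" for c f :: "'x \<Rightarrow> real"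
      using S1 S0 by (intro sum.mono_neutral_cong_right) (auto simp: S1_def)
    have one: "(\<Sum>s\<in>S1. (if s = s1 then 1 else 0) * f s) = f s1" for f :: "'x \<Rightarrow> real"
    proof -
      have "(\<Sum>s\<in>S1. (if s = s1 then 1 else 0) * f s) = (\<Sum>s\<in>{s1}. f s)"
        using S1 by (intro sum.mono_neutral_cong_right) (auto simp: S1_def)
      then show ?thesis by simp
    qed
    have L_s1: "L f s1 = (\<Sum>s\<in>S0. (\<Sum>k\<in>X. d k s * F k s1) * f s)" for f
      unfolding L_def sum_distrib_right by (subst sum.swap) (simp add: mult_ac)
    have e: "(\<Sum>s\<in>S1. e s * f s) = (f s1 - L f s1) / h' s1" for f
    proof -
      have "(\<Sum>s\<in>S1. e s * f s) = ((\<Sum>s\<in>S1. (if s = s1 then 1 else 0) * f s)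
          - (\<Sum>s\<in>S1. (if s \<in> S0 then (\<Sum>k\<in>X. d k s * F k s1) else 0) * f s)) / h' s1"
        by (simp only: e_def left_diff_distrib times_divide_eq_left sum_subtractf flip: sum_divide_distrib)
      then show ?thesis by (simp only: ext one L_s1)
    qed
    have "f x = (\<Sum>k\<in>insert h X. (\<Sum>s\<in>S1. d' k s * f s) * F k x)"
      if f: "\<forall>x\<in>S. f x = (\<Sum>k\<in>insert h X. r k * F k x)" and x: "x \<in> S" for r f x
    proof -
      have "(\<Sum>s\<in>S1. e s * f s) = r h"
        using e[of f] split[of f r s1] f s1 by simp
      then have eh: "(\<Sum>s\<in>S1. d' h s * f s) = r h" by (simp add: d'_def)
      have dk: "(\<Sum>s\<in>S1. d' k s * f s) = (\<Sum>s\<in>S0. d k s * f s) - r h * (\<Sum>s\<in>S0. d k s * F h s)" if "k \<in> X" for k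
      proof -
        have "k \<noteq> h" using that insert.hyps by auto
        have "(\<Sum>s\<in>S1. d' k s * f s) = (\<Sum>s\<in>S1. (if s \<in> S0 then d k s else 0) * f s)
            - (\<Sum>s\<in>S1. e s * f s) * (\<Sum>s\<in>S0. d k s * F h s)"
        proof -
          have "(a - b * c) * g = a * g - b * g * c" for a b c g :: real by (simp add: algebra_simps)
          then have "d' k s * f s = (if s \<in> S0 then d k s else 0) * f s - e s * f s * (\<Sum>s\<in>S0. d k s * F h s)" for s
            using \<open>k \<noteq> h\<close> by (simp only: d'_def if_False)
          then show ?thesis by (simp only: sum_subtractf sum_distrib_right)
        qed
        then show ?thesis using \<open>(\<Sum>s\<in>S1. e s * f s) = r h\<close> by (simp only: ext)
      qed
      have "(\<Sum>k\<in>insert h X. (\<Sum>s\<in>S1. d' k s * f s) * F k x)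
          = r h * F h x + (\<Sum>k\<in>X. ((\<Sum>s\<in>S0. d k s * f s) - r h * (\<Sum>s\<in>S0. d k s * F h s)) * F k x)"
        using insert.hyps eh dk by simp
      also have "\<dots> = r h * F h x + (L f x - r h * L (F h) x)"
        by (simp add: L_def left_diff_distrib sum_subtractf sum_distrib_left[where A = X] mult.assoc)
      also have "\<dots> = f x" using split[of f r x] f x by (simp add: h'_def algebra_simps)
      finally show ?thesis by simp
    qed
    then show ?thesis using S1 by (intro exI[of _ S1] exI[of _ d']) blast
  qed
qed

context causal_opt
begin

text \<open>Sampled values of effects lie in the unit interval, so these coordinates are bounded
  uniformly over all effects. Being linear in the values, they also make the pairing a continuous
  function of effect and state jointly.\<close>

lemma effect_coordinates:
  obtains X S d where "finite X" "X \<subseteq> Eff A" "finite S" "S \<subseteq> St A"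
    "\<And>b \<rho>. b \<in> Eff A \<Longrightarrow> \<rho> \<in> St A \<Longrightarrow> pr b \<rho> = (\<Sum>k\<in>X. (\<Sum>s\<in>S. d k s * pr b s) * pr k \<rho>)"
proof -
  obtain X where X: "finite X" "X \<subseteq> Eff A"
    and span: "\<And>a. a \<in> Eff A \<Longrightarrow> \<exists>r. \<forall>\<rho> \<in> St A. pr a \<rho> = (\<Sum>b\<in>X. r b * pr b \<rho>)"
    by (rule spanning_effects[where A = A]) (rule that)
  obtain S d where S: "finite S" "S \<subseteq> St A"
    and rec: "\<forall>r f. (\<forall>\<rho>\<in>St A. f \<rho> = (\<Sum>k\<in>X. r k * pr k \<rho>)) \<longrightarrow>
      (\<forall>\<rho>\<in>St A. f \<rho> = (\<Sum>k\<in>X. (\<Sum>s\<in>S. d k s * f s) * pr k \<rho>))"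
    using finite_reconstruction[OF X(1), of "St A" pr] by (elim exE conjE) (rule that)
  show thesis
  proof (rule that[OF X S])
    fix b \<rho> assume "b \<in> Eff A" "\<rho> \<in> St A"
    then show "pr b \<rho> = (\<Sum>k\<in>X. (\<Sum>s\<in>S. d k s * pr b s) * pr k \<rho>)"
      using span[of b] rec[rule_format, of "pr b"] by blast
  qed
qed

end

context sharp_theory_with_purification
begin

text \<open>The normalised sum of a finite spanning set of states lies in the interior: any state
  has finite coefficients in the spanning set, so a small multiple of it can be subtracted with
  nonnegative coefficients left.\<close>

lemma internal_state:
  "\<exists>\<omega> \<in> normalised_states A. \<forall>\<sigma> \<in> normalised_states A. \<exists>p>0. \<exists>\<tau> \<in> St A.
     \<forall>a \<in> Eff A. pr a \<omega> = p * pr a \<sigma> + pr a \<tau>"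
proof -
  obtain X where X: "finite X" "X \<subseteq> St A"
    and span: "\<And>\<rho>. \<rho> \<in> St A \<Longrightarrow> \<exists>r. \<forall>a \<in> Eff A. pr a \<rho> = (\<Sum>x\<in>X. r x * pr a x)"
    by (rule spanning_states[where A = A]) (rule that)
  define W where "W = (\<Sum>x\<in>X. pr (discard A) x)"
  have u: "0 \<le> pr (discard A) x" if "x \<in> X" for x using that X(2) pr_nonneg[OF _ discard_transf] by blast
  have "W \<noteq> 0"
  proof
    assume W: "W = 0"
    then have null: "pr (discard A) x = 0" if "x \<in> X" for x
      using that u X(1) unfolding W_def by (subst (asm) sum_nonneg_eq_0_iff) auto
    obtain \<kappa> where \<kappa>: "\<kappa> \<in> normalised_states A" using normalised_exists by blast
    then obtain r where "pr (discard A) \<kappa> = (\<Sum>x\<in>X. r x * pr (discard A) x)"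
      using span[OF normalised_state] discard_transf by blast
    then show False using null \<kappa> by (simp add: normalised_iff)
  qed
  then have W: "W > 0" using u unfolding W_def by (simp add: less_le sum_nonneg)
  have "(\<Sum>x\<in>X. 1 / W * pr (discard A) x) = 1" using W by (simp add: W_def flip: sum_divide_distrib)
  then obtain \<omega> where \<omega>: "\<omega> \<in> St A" "\<forall>a \<in> Eff A. pr a \<omega> = (\<Sum>x\<in>X. 1 / W * pr a x)"
    using conic_combination[of X "\<lambda>x. x" A "\<lambda>_. 1 / W"] X W by auto
  have \<omega>n: "\<omega> \<in> normalised_states A"
    using \<omega> \<open>(\<Sum>x\<in>X. 1 / W * pr (discard A) x) = 1\<close> by (simp add: normalised_iff)
  show ?thesis
  proof (intro bexI[OF _ \<omega>n] ballI)
    fix \<sigma> assume \<sigma>: "\<sigma> \<in> normalised_states A"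
    then obtain t where t: "\<forall>a \<in> Eff A. pr a \<sigma> = (\<Sum>x\<in>X. t x * pr a x)"
      using span normalised_state by blast
    \<comment> \<open>\<open>M\<close> dominates all coefficients of \<open>\<sigma>\<close>. The
      summand 1 keeps it positive, so that \<open>p\<close> below is positive too.\<close>
    define M where "M = 1 + (\<Sum>x\<in>X. \<bar>t x\<bar>)"
    have M: "M \<ge> 1" "\<And>x. x \<in> X \<Longrightarrow> t x \<le> M"
    proof -
      show "M \<ge> 1" by (simp add: M_def sum_nonneg)
      fix x assume "x \<in> X"
      then have "\<bar>t x\<bar> \<le> (\<Sum>x\<in>X. \<bar>t x\<bar>)" using X(1) by (intro member_le_sum) auto
      then show "t x \<le> M" by (simp add: M_def)
    qed
    define p where "p = 1 / (W * M)"
    have p: "p > 0" using W M by (simp add: p_def)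
    have c: "0 \<le> 1 / W - p * t x" if "x \<in> X" for x
      using M(1) M(2)[OF that] W by (simp add: p_def field_simps)
    have dec: "(\<Sum>x\<in>X. (1 / W - p * t x) * pr a x) = pr a \<omega> - p * pr a \<sigma>" if "a \<in> Eff A" for a
      using that t \<omega>(2) by (simp add: left_diff_distrib sum_subtractf sum_distrib_left mult.assoc)
    have "(\<Sum>x\<in>X. (1 / W - p * t x) * pr (discard A) x) \<le> 1"
      using dec[OF discard_transf] \<omega>n \<sigma> p by (simp add: normalised_iff)
    then obtain \<tau> where "\<tau> \<in> St A" "\<forall>a \<in> Eff A. pr a \<tau> = pr a \<omega> - p * pr a \<sigma>"
      using conic_combination[of X "\<lambda>x. x" A "\<lambda>x. 1 / W - p * t x"] X c dec by auto
    then show "\<exists>p>0. \<exists>\<tau> \<in> St A. \<forall>a \<in> Eff A. pr a \<omega> = p * pr a \<sigma> + pr a \<tau>"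
      using p by (intro exI[of _ p] conjI bexI[of _ \<tau>]) auto
  qed
qed

text \<open>The marginal of \<open>\<Sigma>\<close> is a component of the internal state, so
  \<open>\<Sigma>\<close> with its weight \<open>p\<close> can be completed to an ensemble whose
  marginal is that of \<open>\<Psi>\<close>. Steering then prepares \<open>\<Sigma>\<close> with
  probability \<open>p\<close> by acting on \<open>B\<close> alone.\<close>

lemma dynamically_faithful_state:
  "\<exists>B. \<exists>\<Psi> \<in> normalised_states (A \<odot> B). pure \<one> (A \<odot> B) \<Psi> \<and>
     (\<forall>S. \<forall>\<Sigma> \<in> normalised_states (A \<odot> S). \<exists>R \<in> transf B S. \<exists>p>0.
        \<forall>E \<in> Eff (A \<odot> S). pr E ((ident T A \<otimes> R) \<cdot> \<Psi>) = p * pr E \<Sigma>)"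
proof -
  obtain \<omega> where \<omega>: "\<omega> \<in> normalised_states A"
    and int: "\<And>\<sigma>. \<sigma> \<in> normalised_states A \<Longrightarrow> \<exists>p>0. \<exists>\<tau> \<in> St A.
     \<forall>a \<in> Eff A. pr a \<omega> = p * pr a \<sigma> + pr a \<tau>"
    using internal_state by blast
  obtain B \<Psi> where \<Psi>: "\<Psi> \<in> normalised_states (A \<odot> B)" "pure \<one> (A \<odot> B) \<Psi>" "(ident T A \<otimes> discard B) \<cdot> \<Psi> = \<omega>"
    using purification_exists[OF \<omega>] by (auto simp: marginal_def)
  note \<Psi>t = normalised_state[OF \<Psi>(1)]
  have "\<exists>R \<in> transf B S. \<exists>p>0. \<forall>E \<in> Eff (A \<odot> S). pr E ((ident T A \<otimes> R) \<cdot> \<Psi>) = p * pr E \<Sigma>"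
    if \<Sigma>: "\<Sigma> \<in> normalised_states (A \<odot> S)" for S \<Sigma>
  proof -
    note \<Sigma>t = normalised_state[OF \<Sigma>]
    define \<sigma> where "\<sigma> = (ident T A \<otimes> discard S) \<cdot> \<Sigma>"
    have \<sigma>pr: "pr a \<sigma> = pr (a \<otimes> discard S) \<Sigma>" if "a \<in> Eff A" for a
      unfolding \<sigma>_def by (rule pr_right[OF \<Sigma>t that discard_transf])
    have "\<sigma> \<in> normalised_states A"
      using right_state[OF \<Sigma>t discard_transf] \<sigma>pr[OF discard_transf] \<Sigma>
      by (simp add: normalised_iff \<sigma>_def discard_par)
    then obtain p \<tau> where p: "p > 0" and \<tau>: "\<tau> \<in> St A"
      and dec: "\<And>a. a \<in> Eff A \<Longrightarrow> pr a \<omega> = p * pr a \<sigma> + pr a \<tau>"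
      using int by blast
    have "p + pr (discard A) \<tau> = 1"
      using dec[OF discard_transf] \<omega> \<open>\<sigma> \<in> _\<close> by (simp add: normalised_iff)
    then have p1: "p \<le> 1" using pr_nonneg[OF \<tau> discard_transf] by simp
    obtain \<kappa> where \<kappa>: "\<kappa> \<in> normalised_states S" using normalised_exists by blast
    obtain \<Theta> where \<Theta>: "\<Theta> \<in> St (A \<odot> S)" "\<And>E. E \<in> Eff (A \<odot> S) \<Longrightarrow> pr E \<Theta> = p * pr E \<Sigma>"
      using scaled_state[OF \<Sigma>t, of p] p p1 by auto
    have \<tau>\<kappa>: "pr (a \<otimes> discard S) (\<tau> \<otimes> \<kappa>) = pr a \<tau>" if "a \<in> Eff A" for a
      using pr_prod[OF \<tau> normalised_state[OF \<kappa>] that discard_transf] \<kappa> by (simp add: normalised_iff)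
    let ?\<Theta>s = "[\<Theta>, \<tau> \<otimes> \<kappa>]"
    have "?\<Theta>s \<in> tests T \<one> (A \<odot> S)"
    proof (rule prep_testI)
      show "set ?\<Theta>s \<subseteq> St (A \<odot> S)" using \<Theta>(1) prod_state[OF \<tau> normalised_state[OF \<kappa>]] by simp
      have "pr (discard (A \<odot> S)) (\<tau> \<otimes> \<kappa>) = pr (discard A) \<tau>"
        using \<tau>\<kappa>[OF discard_transf] by (simp add: discard_par)
      moreover have "pr (discard (A \<odot> S)) \<Theta> = p"
        using \<Theta>(2)[OF discard_transf] \<Sigma> by (simp add: normalised_iff)
      ultimately show "(\<Sum>i<length ?\<Theta>s. pr (discard (A \<odot> S)) (?\<Theta>s ! i)) = 1"
        using \<open>p + pr (discard A) \<tau> = 1\<close> by (simp add: lessThan_Suc)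
    qed
    moreover have "(\<Sum>i<length ?\<Theta>s. pr (a \<otimes> discard S) (?\<Theta>s ! i)) = pr (a \<otimes> discard B) \<Psi>"
      if a: "a \<in> Eff A" for a
    proof -
      have "(\<Sum>i<length ?\<Theta>s. pr (a \<otimes> discard S) (?\<Theta>s ! i)) = p * pr a \<sigma> + pr a \<tau>"
        using \<tau>\<kappa>[OF a] \<Theta>(2)[OF pair_transf[OF a discard_transf]] \<sigma>pr[OF a] by (simp add: lessThan_Suc)
      also have "\<dots> = pr a \<omega>" using dec[OF a] by simp
      also have "\<dots> = pr (a \<otimes> discard B) \<Psi>" using pr_right[OF \<Psi>t a discard_transf] \<Psi>(3) by simp
      finally show ?thesis .
    qed
    ultimately obtain Ts where Ts: "Ts \<in> tests T B S" "length Ts = 2" "(ident T A \<otimes> Ts ! 0) \<cdot> \<Psi> = \<Theta>"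
      using steering[OF \<Psi>(1,2), of ?\<Theta>s S] by force
    then show ?thesis
      using p \<Theta>(2) test_nth[OF Ts(1), of 0] by (intro bexI[of _ "Ts ! 0"] exI[of _ p]) auto
  qed
  then show ?thesis using \<Psi>(1,2) by (intro exI[of _ B] bexI[of _ \<Psi>]) auto
qed

text \<open>A component \<open>D\<close> of the identity multiplies the pure state
  \<open>\<Psi>\<close> by a number \<open>r\<close>. Since \<open>D\<close> acts on
  \<open>A\<close> and commutes with what is done on \<open>B\<close>, it multiplies by the same
  \<open>r\<close> every state prepared from \<open>\<Psi>\<close> on the side of \<open>B\<close>,
  that is, every state of \<open>A \<odot> S\<close> up to scaling.\<close>

theorem ident_pure: "pure A A (ident T A)"
  unfolding pure_def
proof (intro conjI ballI allI impI)
  show "ident T A \<in> transf A A" by simp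
  fix ds X i assume ds: "ds \<in> tests T A A" and X: "X \<subseteq> {..<length ds}"
    and sum: "is_sum A A (ident T A) X ((!) ds)" and i: "i \<in> X"
  obtain B \<Psi> where \<Psi>: "\<Psi> \<in> normalised_states (A \<odot> B)" "pure \<one> (A \<odot> B) \<Psi>"
    and faith: "\<And>S \<Sigma>. \<Sigma> \<in> normalised_states (A \<odot> S) \<Longrightarrow> \<exists>R \<in> transf B S. \<exists>p>0.
        \<forall>E \<in> Eff (A \<odot> S). pr E ((ident T A \<otimes> R) \<cdot> \<Psi>) = p * pr E \<Sigma>"
    using dynamically_faithful_state[of A] by blast
  note \<Psi>t = normalised_state[OF \<Psi>(1)]
  have mem: "\<And>j. j \<in> X \<Longrightarrow> ds ! j \<in> transf A A" using X by (auto intro!: test_nth[OF ds])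
  define D where "D = ds ! i"
  have D: "D \<in> transf A A" using mem i by (simp add: D_def)
  let ?ds = "map (\<lambda>F. F \<cdot> \<Psi>) (map (\<lambda>F. F \<otimes> ident T B) ds)"
  have "is_lincomb \<one> (A \<odot> B) ((ident T A \<otimes> ident T B) \<cdot> \<Psi>) X (\<lambda>_. 1) (\<lambda>j. (ds ! j \<otimes> ident T B) \<cdot> \<Psi>)"
    by (rule lincomb_pre[OF par_transf[OF ident_transf ident_transf] par_transf[OF mem ident_transf] \<Psi>t
          lincomb_par_ident[OF ident_transf mem sum[unfolded is_sum_def]]])
  then have "is_sum \<one> (A \<odot> B) \<Psi> X ((!) ?ds)"
    using X \<Psi>t by (auto simp: is_sum_def is_lincomb_def par_ident seq_ident subset_iff intro!: sum.cong)
  moreover have "?ds \<in> tests T \<one> (A \<odot> B)"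
    using test_pre_channel[OF normalised_channel[OF \<Psi>(1)] test_channel_par[OF ds ident_channel]] .
  moreover have "X \<subseteq> {..<length ?ds}" using X by simp
  ultimately have "is_multiple \<one> (A \<odot> B) (?ds ! i) \<Psi>"
    using \<Psi>(2) i unfolding pure_def by blast
  moreover have "?ds ! i = (D \<otimes> ident T B) \<cdot> \<Psi>" using i X by (auto simp: D_def)
  ultimately have "is_multiple \<one> (A \<odot> B) ((D \<otimes> ident T B) \<cdot> \<Psi>) \<Psi>" by simp
  moreover have D\<Psi>: "(D \<otimes> ident T B) \<cdot> \<Psi> \<in> St (A \<odot> B)"
    using seq_transf[OF \<Psi>t par_transf[OF D ident_transf]] .
  ultimately obtain r where r: "\<And>E. E \<in> Eff (A \<odot> B) \<Longrightarrow> pr E ((D \<otimes> ident T B) \<cdot> \<Psi>) = r * pr E \<Psi>"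
    using multiple_state[OF _ \<Psi>t] by blast
  have main: "pr E ((D \<otimes> ident T S) \<cdot> \<rho>) = r * pr E \<rho>"
    if \<rho>: "\<rho> \<in> St (A \<odot> S)" and E: "E \<in> Eff (A \<odot> S)" for S \<rho> E
  proof -
    obtain \<Sigma> where \<Sigma>: "\<Sigma> \<in> normalised_states (A \<odot> S)"
      "\<forall>E \<in> Eff (A \<odot> S). pr E \<rho> = pr (discard (A \<odot> S)) \<rho> * pr E \<Sigma>"
      using normalise_any[OF \<rho>] by blast
    obtain R p where R: "R \<in> transf B S" and p: "p > 0"
      and R\<Sigma>: "\<And>E. E \<in> Eff (A \<odot> S) \<Longrightarrow> pr E ((ident T A \<otimes> R) \<cdot> \<Psi>) = p * pr E \<Sigma>"
      using faith[OF \<Sigma>(1)] by blast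
    have DS: "D \<otimes> ident T S \<in> transf (A \<odot> S) (A \<odot> S)" and RR: "ident T A \<otimes> R \<in> transf (A \<odot> B) (A \<odot> S)"
      using par_transf D R by simp_all
    have ED: "E \<cdot> (D \<otimes> ident T S) \<in> Eff (A \<odot> S)" using seq_transf[OF DS E] .
    have "p * pr (E \<cdot> (D \<otimes> ident T S)) \<Sigma> = pr E ((D \<otimes> ident T S) \<cdot> (ident T A \<otimes> R) \<cdot> \<Psi>)"
      using R\<Sigma>[OF ED] pr_seq[OF seq_transf[OF \<Psi>t RR] DS E] by simp
    also have "\<dots> = pr E ((ident T A \<otimes> R) \<cdot> (D \<otimes> ident T B) \<cdot> \<Psi>)"
      using left_right_commute[OF \<Psi>t D R] by simp
    also have "\<dots> = r * pr E ((ident T A \<otimes> R) \<cdot> \<Psi>)"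
      using r[OF seq_transf[OF RR E]] pr_seq[OF D\<Psi> RR E] pr_seq[OF \<Psi>t RR E] by simp
    also have "\<dots> = p * (r * pr E \<Sigma>)" using R\<Sigma>[OF E] by simp
    finally have *: "pr (E \<cdot> (D \<otimes> ident T S)) \<Sigma> = r * pr E \<Sigma>" using p by simp
    have "pr E ((D \<otimes> ident T S) \<cdot> \<rho>) = pr (E \<cdot> (D \<otimes> ident T S)) \<rho>"
      using pr_seq[OF \<rho> DS E] by simp
    also have "\<dots> = pr (discard (A \<odot> S)) \<rho> * (r * pr E \<Sigma>)" using \<Sigma>(2) ED * by metis
    also have "\<dots> = r * pr E \<rho>" using \<Sigma>(2) E by (metis mult.left_commute)
    finally show ?thesis .
  qed
  have "vect A A D z = r * vect A A (ident T A) z" for z :: "'a \<times> 'b \<times> 'b"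
  proof -
    obtain S \<rho> E where z: "z = (S, \<rho>, E)" by (cases z)
    show ?thesis
      using main[of \<rho> S E] by (auto simp: z vect_def states_def effects_def par_ident seq_ident)
  qed
  then show "is_multiple A A (ds ! i) (ident T A)" by (auto simp: is_multiple_def D_def)
qed

section \<open>Pure conditioning and sharp effects\<close>

lemma reversible_pure: "reversible A B U \<Longrightarrow> pure A B U"
  using pure_post_reversible[OF ident_pure] seq_ident(1) reversible_channel channel_transf by metis

lemma pure_left_state:
  "pure A \<one> a \<Longrightarrow> pure \<one> (A \<odot> B) \<Phi> \<Longrightarrow> pure \<one> B ((a \<otimes> ident T B) \<cdot> \<Phi>)"
  using pure_seq[of \<one> "A \<odot> B" \<Phi> B "a \<otimes> ident T B"] pure_par[of A \<one> a B B "ident T B"] ident_pure by simp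

lemma pure_right_state:
  "pure B \<one> b \<Longrightarrow> pure \<one> (A \<odot> B) \<Phi> \<Longrightarrow> pure \<one> A ((ident T A \<otimes> b) \<cdot> \<Phi>)"
  using pure_seq[of \<one> "A \<odot> B" \<Phi> A "ident T A \<otimes> b"] pure_par[of A A "ident T A" B \<one> b] ident_pure by simp

lemma left_purification_exists:
  assumes "\<rho> \<in> normalised_states A"
  shows "\<exists>B. \<exists>\<Phi> \<in> normalised_states (B \<odot> A). pure \<one> (B \<odot> A) \<Phi> \<and> (discard B \<otimes> ident T A) \<cdot> \<Phi> = \<rho>"
proof -
  obtain B \<Psi> where \<Psi>: "\<Psi> \<in> normalised_states (A \<odot> B)" "pure \<one> (A \<odot> B) \<Psi>" "(ident T A \<otimes> discard B) \<cdot> \<Psi> = \<rho>"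
    using purification_exists[OF assms] by (auto simp: marginal_def)
  have "(discard B \<otimes> ident T A) \<cdot> swap T A B \<cdot> \<Psi> = \<rho>"
    using seq_assoc[OF normalised_state[OF \<Psi>(1)] swap_transf left_transf[OF discard_transf]]
      swap_right[OF discard_transf] \<Psi>(3) by simp
  then show ?thesis
    using channel_normalised_state[OF swap_channel \<Psi>(1)] pure_post_reversible[OF \<Psi>(2) reversible_swap]
    by (intro exI[of _ B] bexI[of _ "swap T A B \<cdot> \<Psi>"]) auto
qed

text \<open>In a purification of \<open>\<rho>\<close> the outcome \<open>a\<close> is certain, so
  conditioning on it gives the marginal on \<open>B\<close>, which is therefore pure by Purity
  Preservation. Comparison with a pure product state of the same marginal shows that the
  purification is a product with \<open>\<rho>\<close> as a pure factor.\<close>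

lemma sharp_state_pure:
  assumes "pure A \<one> a" "\<rho> \<in> normalised_states A" "pr a \<rho> = 1"
  shows "pure \<one> A \<rho>"
proof -
  have a: "a \<in> Eff A" using pure_transf assms(1) .
  obtain B \<Phi> where \<Phi>: "\<Phi> \<in> normalised_states (B \<odot> A)" "pure \<one> (B \<odot> A) \<Phi>" "(discard B \<otimes> ident T A) \<cdot> \<Phi> = \<rho>"
    using left_purification_exists[OF assms(2)] by blast
  note \<Phi>t = normalised_state[OF \<Phi>(1)]
  define \<beta> where "\<beta> = (ident T B \<otimes> a) \<cdot> \<Phi>"
  have \<beta>t: "\<beta> \<in> St B" unfolding \<beta>_def by (rule right_state[OF \<Phi>t a])
  have \<beta>p: "pure \<one> B \<beta>" unfolding \<beta>_def by (rule pure_right_state[OF assms(1) \<Phi>(2)])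
  have "pr (discard B) \<beta> = 1"
    using pr_right[OF \<Phi>t discard_transf a] pr_left[OF \<Phi>t discard_transf a] \<Phi>(3) assms(3) by (simp add: \<beta>_def)
  then have \<beta>n: "\<beta> \<in> normalised_states B" using \<beta>t by (simp add: normalised_iff)
  obtain a' where a': "a' \<in> Eff A" "\<And>\<rho>. \<rho> \<in> St A \<Longrightarrow> pr a' \<rho> = pr (discard A) \<rho> - pr a \<rho>"
    using complement_effect[OF a] by blast
  have "(ident T B \<otimes> discard A) \<cdot> \<Phi> = \<beta>"
  proof (rule state_eqI[OF right_state[OF \<Phi>t discard_transf] \<beta>t])
    fix b assume b: "b \<in> Eff B"
    \<comment> \<open>The complement \<open>a'\<close> has probability 0 in \<open>\<rho>\<close>,
      hence also jointly with any effect \<open>b\<close>.\<close>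
    have "pr a' ((b \<otimes> ident T A) \<cdot> \<Phi>) = pr b ((ident T B \<otimes> a') \<cdot> \<Phi>)"
      using pr_left[OF \<Phi>t b a'(1)] pr_right[OF \<Phi>t b a'(1)] by simp
    also have "\<dots> \<le> pr (discard B) ((ident T B \<otimes> a') \<cdot> \<Phi>)"
      by (rule pr_le_discard[OF b right_state[OF \<Phi>t a'(1)]])
    also have "\<dots> = pr a' \<rho>"
      using pr_left[OF \<Phi>t discard_transf a'(1)] pr_right[OF \<Phi>t discard_transf a'(1)] \<Phi>(3) by simp
    also have "\<dots> = 0" using a'(2) assms(2,3) by (simp add: normalised_iff)
    finally have "pr (discard A) ((b \<otimes> ident T A) \<cdot> \<Phi>) \<le> pr a ((b \<otimes> ident T A) \<cdot> \<Phi>)"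
      using a'(2)[OF left_state[OF \<Phi>t b]] by simp
    then have "pr (discard A) ((b \<otimes> ident T A) \<cdot> \<Phi>) = pr a ((b \<otimes> ident T A) \<cdot> \<Phi>)"
      using pr_le_discard[OF a left_state[OF \<Phi>t b]] by simp
    then show "pr b ((ident T B \<otimes> discard A) \<cdot> \<Phi>) = pr b \<beta>"
      using pr_left[OF \<Phi>t b] pr_right[OF \<Phi>t b] a discard_transf by (simp add: \<beta>_def)
  qed
  then have m: "marginal B A \<Phi> = \<beta>" by (simp add: marginal_def)
  obtain \<alpha> where \<alpha>: "\<alpha> \<in> normalised_states A" "pure \<one> A \<alpha>" using pure_state_exists by blast
  have m': "marginal B A (\<beta> \<otimes> \<alpha>) = \<beta>"
    using prod_state_apply[OF \<beta>t normalised_state[OF \<alpha>(1)] ident_transf discard_transf]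
      discard_normalised[OF \<alpha>(1)] \<beta>t by (simp add: marginal_def seq_ident par_unit)
  have "pure \<one> (B \<odot> A) (\<beta> \<otimes> \<alpha>)" using pure_par[OF \<beta>p \<alpha>(2)] by simp
  then obtain U where U: "reversible A A U" "\<Phi> = (ident T B \<otimes> U) \<cdot> (\<beta> \<otimes> \<alpha>)"
    using purification_unique[OF normalised_prod[OF \<beta>n \<alpha>(1)] _ \<Phi>(1,2)] m m' by auto
  have Ut: "U \<in> transf A A" using U(1) reversible_channel channel_transf by blast
  have "\<Phi> = \<beta> \<otimes> (U \<cdot> \<alpha>)"
    using U(2) prod_state_apply[OF \<beta>t normalised_state[OF \<alpha>(1)] ident_transf Ut] \<beta>t by (simp add: seq_ident)
  then have "\<rho> = U \<cdot> \<alpha>"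
    using \<Phi>(3) prod_state_apply[OF \<beta>t seq_transf[OF normalised_state[OF \<alpha>(1)] Ut] discard_transf ident_transf]
      discard_normalised[OF \<beta>n] seq_transf[OF normalised_state[OF \<alpha>(1)] Ut] by (simp add: seq_ident par_unit)
  then show ?thesis using pure_post_reversible[OF \<alpha>(2) U(1)] by simp
qed

text \<open>The effect is certain on the midpoint \<open>m\<close> too, so \<open>m\<close> is pure
  and both of its components coincide with it.\<close>

lemma sharp_state_unique:
  assumes "pure A \<one> a" "\<alpha> \<in> normalised_states A" "pr a \<alpha> = 1" "\<alpha>' \<in> normalised_states A" "pr a \<alpha>' = 1"
  shows "\<alpha> = \<alpha>'"
proof -
  have a: "a \<in> Eff A" using pure_transf assms(1) .
  note t = normalised_state[OF assms(2)] normalised_state[OF assms(4)]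
  obtain m where m: "m \<in> St A" "\<And>b. b \<in> Eff A \<Longrightarrow> pr b m = 1/2 * pr b \<alpha> + 1/2 * pr b \<alpha>'"
    using sum_of_two_states[OF t, of "1/2" "1/2"] assms(2,4) by (auto simp: normalised_iff)
  have mn: "m \<in> normalised_states A" using m(1) m(2)[OF discard_transf] assms(2,4) by (simp add: normalised_iff)
  have mp: "pure \<one> A m" using sharp_state_pure[OF assms(1) mn] m(2)[OF a] assms by simp
  obtain s s' where s: "s \<in> St A" "\<And>b. b \<in> Eff A \<Longrightarrow> pr b s = 1/2 * pr b \<alpha>"
    and s': "s' \<in> St A" "\<And>b. b \<in> Eff A \<Longrightarrow> pr b s' = 1/2 * pr b \<alpha>'"
    using scaled_state[OF t(1), of "1/2"] scaled_state[OF t(2), of "1/2"] by auto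
  show ?thesis
  proof (rule state_eqI[OF t])
    fix b assume b: "b \<in> Eff A"
    have "pr b s = pr (discard A) s * pr b m"
      by (rule pure_stateD_normalised[OF mp mn s(1) s'(1) _ b]) (simp add: m s s')
    then have "pr b \<alpha> = pr b m" using s(2)[OF b] s(2)[OF discard_transf] assms(2) by (simp add: normalised_iff)
    then show "pr b \<alpha> = pr b \<alpha>'" using m(2)[OF b] by simp
  qed
qed

text \<open>One effect \<open>a\<close>, given by Pure Sharpness, is carried to all pure states by
  reversible channels. The single orbit is what later gives equal weights in an invariant
  state.\<close>

lemma sharp_effect_orbit:
  "\<exists>a. pure A \<one> a \<and> (\<forall>\<alpha> \<in> normalised_states A. pure \<one> A \<alpha> \<longrightarrow> (\<exists>V. reversible A A V \<and> pr (a \<cdot> V) \<alpha> = 1))"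
proof -
  obtain a \<rho> where a: "pure A \<one> a" and \<rho>: "\<rho> \<in> St A" "pr a \<rho> = 1"
    using pure_sharpness[of A] by (auto simp: states_def)
  note at = pure_transf[OF a]
  have \<rho>n: "\<rho> \<in> normalised_states A"
    using \<rho> pr_le_discard[OF at \<rho>(1)] pr_range[OF \<rho>(1) discard_transf] by (simp add: normalised_iff)
  have "\<exists>V. reversible A A V \<and> pr (a \<cdot> V) \<alpha> = 1" if \<alpha>: "\<alpha> \<in> normalised_states A" "pure \<one> A \<alpha>" for \<alpha>
  proof -
    obtain V where V: "reversible A A V" "\<rho> = V \<cdot> \<alpha>"
      using pure_states_transitive[OF \<alpha> \<rho>n sharp_state_pure[OF a \<rho>n \<rho>(2)]] by blast
    then show ?thesis
      using pr_seq[OF normalised_state[OF \<alpha>(1)] channel_transf[OF reversible_channel[OF V(1)]] at] \<rho>(2) by auto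
  qed
  then show ?thesis using a by blast
qed

lemma sharp_effect_exists:
  assumes "\<alpha> \<in> normalised_states A" "pure \<one> A \<alpha>"
  shows "\<exists>a. pure A \<one> a \<and> pr a \<alpha> = 1"
  using sharp_effect_orbit[of A] assms pure_seq[OF reversible_pure] by metis

text \<open>Every effect that vanishes on \<open>\<rho>\<close> is imposed as a constraint on the
  extreme state. That some pure state is a component of \<open>\<rho>\<close> takes the further
  argument below.\<close>

lemma pure_state_in_support:
  assumes "\<rho> \<in> normalised_states A"
  shows "\<exists>\<alpha> \<in> normalised_states A. pure \<one> A \<alpha> \<and> (\<forall>a \<in> Eff A. pr a \<alpha> \<noteq> 0 \<longrightarrow> pr a \<rho> > 0)"
proof -
  let ?N = "{n \<in> Eff A. pr n \<rho> = 0}"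
  have N: "?N \<subseteq> Eff A" "\<And>n. n \<in> ?N \<Longrightarrow> pr n \<rho> = 0" by blast+
  obtain \<alpha> where \<alpha>: "\<alpha> \<in> normalised_states A" "pure \<one> A \<alpha>" "\<forall>n\<in>?N. pr n \<alpha> = 0"
    using extreme_pure_state[OF N(1) assms N(2), of "{}::nat set" "\<lambda>_. discard A"] by blast
  have "pr a \<rho> > 0" if "a \<in> Eff A" "pr a \<alpha> \<noteq> 0" for a
    using that \<alpha>(3) pr_nonneg[OF normalised_state[OF assms] that(1)] by fastforce
  then show ?thesis using \<alpha> by blast
qed

text \<open>Components of \<open>\<rho>\<close> arise by conditioning a purification on effects of
  \<open>B\<close>. The sharp effect of a pure state in the support of the other marginal has
  positive probability, and being pure it leaves a pure state of \<open>A\<close>.\<close>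

lemma pure_component:
  assumes "\<rho> \<in> normalised_states A"
  shows "\<exists>\<alpha> \<in> normalised_states A. pure \<one> A \<alpha> \<and> (\<exists>p>0. \<exists>\<tau> \<in> St A.
     \<forall>a \<in> Eff A. pr a \<rho> = p * pr a \<alpha> + pr a \<tau>)"
proof -
  obtain B \<Psi> where \<Psi>: "\<Psi> \<in> normalised_states (A \<odot> B)" "pure \<one> (A \<odot> B) \<Psi>" "(ident T A \<otimes> discard B) \<cdot> \<Psi> = \<rho>"
    using purification_exists[OF assms] by (auto simp: marginal_def)
  note \<Psi>t = normalised_state[OF \<Psi>(1)]
  define \<rho>' where "\<rho>' = (discard A \<otimes> ident T B) \<cdot> \<Psi>"
  have "\<rho>' \<in> normalised_states B"
    using left_state[OF \<Psi>t discard_transf] pr_left[OF \<Psi>t discard_transf discard_transf] \<Psi>(1)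
    by (simp add: normalised_iff \<rho>'_def discard_par)
  then obtain \<beta> where \<beta>: "\<beta> \<in> normalised_states B" "pure \<one> B \<beta>" "\<forall>b \<in> Eff B. pr b \<beta> \<noteq> 0 \<longrightarrow> pr b \<rho>' > 0"
    using pure_state_in_support by blast
  obtain b where b: "pure B \<one> b" "pr b \<beta> = 1" using sharp_effect_exists[OF \<beta>(1,2)] by blast
  note bt = pure_transf[OF b(1)]
  obtain b' where b': "b' \<in> Eff B" "\<And>\<rho>. \<rho> \<in> St B \<Longrightarrow> pr b' \<rho> = pr (discard B) \<rho> - pr b \<rho>"
    using complement_effect[OF bt] by blast
  let ?\<sigma> = "(ident T A \<otimes> b) \<cdot> \<Psi>" and ?\<tau> = "(ident T A \<otimes> b') \<cdot> \<Psi>"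
  have w: "pr (discard A) ?\<sigma> = pr b \<rho>'"
    using pr_right[OF \<Psi>t discard_transf bt] pr_left[OF \<Psi>t discard_transf bt] by (simp add: \<rho>'_def)
  have pos: "pr b \<rho>' > 0" using \<beta>(3) bt b(2) by auto
  obtain \<alpha> where \<alpha>: "\<alpha> \<in> normalised_states A" "pure \<one> A \<alpha>" "\<forall>a \<in> Eff A. pr a ?\<sigma> = pr b \<rho>' * pr a \<alpha>"
    using pure_normalise[OF pure_right_state[OF b(1) \<Psi>(2)]] w pos by auto
  have "pr a \<rho> = pr b \<rho>' * pr a \<alpha> + pr a ?\<tau>" if a: "a \<in> Eff A" for a
  proof -
    have "pr a \<rho> = pr (discard B) ((a \<otimes> ident T B) \<cdot> \<Psi>)"
      using pr_right[OF \<Psi>t a discard_transf] pr_left[OF \<Psi>t a discard_transf] \<Psi>(3) by simp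
    also have "\<dots> = pr b ((a \<otimes> ident T B) \<cdot> \<Psi>) + pr b' ((a \<otimes> ident T B) \<cdot> \<Psi>)"
      using b'(2)[OF left_state[OF \<Psi>t a]] by simp
    also have "\<dots> = pr a ?\<sigma> + pr a ?\<tau>"
      using pr_right[OF \<Psi>t a] pr_left[OF \<Psi>t a] bt b'(1) by simp
    finally show ?thesis using \<alpha>(3) a by simp
  qed
  then show ?thesis
    using \<alpha>(1,2) pos right_state[OF \<Psi>t b'(1)] by (intro bexI[of _ \<alpha>] conjI exI[of _ "pr b \<rho>'"] bexI[of _ ?\<tau>]) auto
qed

section \<open>Invariant states and their purifications\<close>

text \<open>The function minimised is the supremum of \<open>N g \<sigma>\<close> over all
  reversible \<open>g\<close>, invariant because \<open>g\<close> ranges over a group. By the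
  parallelogram law the midpoint of a minimiser \<open>x\<close> and its image
  \<open>h \<cdot> x\<close> would be better, unless for suitable \<open>g\<close> the two states
  moved by \<open>g\<close> have arbitrarily close pairings with \<open>X\<close>. Pulling back by
  the inverse of \<open>g\<close>, with coordinates bounded independently of \<open>g\<close>, makes
  the two states equal.\<close>

theorem invariant_state_exists:
  "\<exists>\<mu> \<in> normalised_states A. \<forall>U. reversible A A U \<longrightarrow> U \<cdot> \<mu> = \<mu>"
proof -
  obtain X S d where X: "finite X" "X \<subseteq> Eff A" and S: "finite S" "S \<subseteq> St A"
    and coord: "\<And>b \<rho>. b \<in> Eff A \<Longrightarrow> \<rho> \<in> St A \<Longrightarrow> pr b \<rho> = (\<Sum>k\<in>X. (\<Sum>s\<in>S. d k s * pr b s) * pr k \<rho>)"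
    by (rule effect_coordinates[where A = A]) (rule that)
  let ?G = "{g. reversible A A g}"
  have Gt: "g \<in> transf A A" if "g \<in> ?G" for g using that reversible_channel channel_transf by blast
  define N where "N g \<rho> = (\<Sum>k\<in>X. (pr (k \<cdot> g) \<rho>)\<^sup>2)" for g \<rho>
  have kg: "k \<cdot> g \<in> Eff A" if "k \<in> X" "g \<in> ?G" for k g
    using seq_transf[OF Gt[OF that(2)]] X(2) that(1) by blast
  \<comment> \<open>Numbers that bound \<open>N g \<sigma>\<close> for all \<open>g\<close> at some
    state \<open>\<sigma>\<close>; the infimum of \<open>M\<close> is that of the suprema.\<close>
  define M where "M = {m. \<exists>\<sigma> \<in> normalised_states A. \<forall>g\<in>?G. N g \<sigma> \<le> m}"
  have M0: "0 \<le> m" if m: "m \<in> M" for m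
  proof -
    obtain \<sigma> where "N (ident T A) \<sigma> \<le> m" using m reversible_ident unfolding M_def by blast
    moreover have "0 \<le> N (ident T A) \<sigma>" unfolding N_def by (simp add: sum_nonneg)
    ultimately show ?thesis by simp
  qed
  have bdd: "bdd_below M" by (rule bdd_belowI[of M 0]) (rule M0)
  have "real (card X) \<in> M"
  proof -
    obtain \<kappa> where \<kappa>: "\<kappa> \<in> normalised_states A" using normalised_exists by blast
    have "N g \<kappa> \<le> card X" if g: "g \<in> ?G" for g
    proof -
      have "(pr (k \<cdot> g) \<kappa>)\<^sup>2 \<le> 1" if "k \<in> X" for k
        using pr_range[OF normalised_state[OF \<kappa>] kg[OF that g]] by (simp add: power_le_one)
      then have "N g \<kappa> \<le> (\<Sum>k\<in>X. 1)" unfolding N_def by (intro sum_mono) auto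
      then show ?thesis by simp
    qed
    then show ?thesis using \<kappa> unfolding M_def by blast
  qed
  then have ne: "M \<noteq> {}" by blast
  define m where "m = Inf M"
  define K where "K = vect \<one> A ` St A \<inter> {f. f (\<one>, ident T \<one>, discard A) = 1}"
  have K_iff: "f \<in> K \<longleftrightarrow> (\<exists>\<sigma> \<in> normalised_states A. f = vect \<one> A \<sigma>)" for f
    by (auto simp: K_def vect_state_unit normalised_iff)
  have cont: "continuous_on UNIV (\<lambda>f. f (\<one>, ident T \<one>, a))" for a :: 'b and f :: "'a \<times> 'b \<times> 'b \<Rightarrow> real"
    by (rule continuous_on_product_coordinates)
  have cK: "compact K"
    unfolding K_def by (intro compact_Int_closed compact_vect closed_Collect_eq cont continuous_on_const)
  define L where "L \<epsilon> = (\<Inter>g\<in>?G. {f :: 'a \<times> 'b \<times> 'b \<Rightarrow> real. (\<Sum>k\<in>X. (f (\<one>, ident T \<one>, k \<cdot> g))\<^sup>2) \<le> m + \<epsilon>})" for \<epsilon> :: real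
  have L_vect: "vect \<one> A \<sigma> \<in> L \<epsilon> \<longleftrightarrow> (\<forall>g\<in>?G. N g \<sigma> \<le> m + \<epsilon>)" if "\<sigma> \<in> St A" for \<sigma> \<epsilon>
    unfolding L_def N_def using vect_state_unit[OF that kg] by (simp cong: sum.cong)
  \<comment> \<open>The infimum is attained: the sets \<open>L \<epsilon>\<close> are closed, and
    finitely many of them meet the compact set \<open>K\<close> because the smallest
    \<open>\<epsilon>\<close> decides. The 1 in \<open>\<delta>\<close> covers an empty index
    set.\<close>
  have "K \<inter> (\<Inter>\<epsilon>\<in>{0<..}. L \<epsilon>) \<noteq> {}"
  proof (rule compact_imp_fip_image[OF cK])
    show "closed (L \<epsilon>)" for \<epsilon>
      unfolding L_def
      by (intro closed_INT ballI closed_Collect_le continuous_on_sum continuous_on_power cont continuous_on_const)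
    fix I :: "real set" assume I: "finite I" "I \<subseteq> {0<..}"
    define \<delta> where "\<delta> = Min (insert 1 I)"
    have \<delta>: "\<delta> > 0" "\<And>\<epsilon>. \<epsilon> \<in> I \<Longrightarrow> \<delta> \<le> \<epsilon>" using I by (auto simp: \<delta>_def)
    have "Inf M < m + \<delta>" using \<delta> by (simp add: m_def)
    then obtain m' where "m' \<in> M" "m' < m + \<delta>" using cInf_less_iff[OF ne bdd] by blast
    then obtain \<sigma> where \<sigma>: "\<sigma> \<in> normalised_states A" "\<forall>g\<in>?G. N g \<sigma> \<le> m'" unfolding M_def by blast
    have "vect \<one> A \<sigma> \<in> L \<epsilon>" if "\<epsilon> \<in> I" for \<epsilon>
      unfolding L_vect[OF normalised_state[OF \<sigma>(1)]] using \<sigma>(2) \<delta>(2)[OF that] \<open>m' < m + \<delta>\<close> by fastforce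
    then show "K \<inter> (\<Inter>\<epsilon>\<in>I. L \<epsilon>) \<noteq> {}" using \<sigma>(1) K_iff by blast
  qed
  then obtain x where x: "x \<in> normalised_states A" and xL: "\<forall>\<epsilon>>0. vect \<one> A x \<in> L \<epsilon>"
    using K_iff by fastforce
  note xt = normalised_state[OF x]
  have Nx: "N g x \<le> m" if "g \<in> ?G" for g
  proof (rule field_le_epsilon)
    fix \<epsilon> :: real assume "\<epsilon> > 0"
    then show "N g x \<le> m + \<epsilon>" using xL L_vect[OF xt] that by blast
  qed
  have "h \<cdot> x = x" if h: "h \<in> ?G" for h
  proof -
    define y where "y = h \<cdot> x"
    have y: "y \<in> normalised_states A"
      unfolding y_def using channel_normalised_state reversible_channel h x by blast
    note yt = normalised_state[OF y]
    have Ny: "N g y \<le> m" if g: "g \<in> ?G" for g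
    proof -
      have gh: "g \<cdot> h \<in> ?G" using reversible_seq g h by blast
      have "pr (k \<cdot> g) y = pr (k \<cdot> (g \<cdot> h)) x" if "k \<in> X" for k
        unfolding y_def
        using pr_seq[OF xt Gt[OF h] kg[OF that g]] seq_assoc[OF Gt[OF h] Gt[OF g]] X(2) that by auto
      then have "N g y = N (g \<cdot> h) x" unfolding N_def by (intro sum.cong) auto
      then show ?thesis using Nx[OF gh] by simp
    qed
    obtain z where z: "z \<in> St A" "\<And>b. b \<in> Eff A \<Longrightarrow> pr b z = 1/2 * pr b x + 1/2 * pr b y"
      using sum_of_two_states[OF xt yt, of "1/2" "1/2"] x y by (auto simp: normalised_iff)
    have zn: "z \<in> normalised_states A" using z(1) z(2)[OF discard_transf] x y by (simp add: normalised_iff)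
    define C where "C = (\<Sum>k\<in>X. \<Sum>s\<in>S. \<bar>d k s\<bar>)"
    have close: "\<bar>pr b x - pr b y\<bar> \<le> C * (2 * \<delta>)" if b: "b \<in> Eff A" and \<delta>: "\<delta> > 0" for b \<delta>
    proof -
      \<comment> \<open>The midpoint cannot improve on the minimal value by
        \<open>\<delta>\<^sup>2\<close> for all \<open>g\<close>. At a \<open>g\<close> where it
        fails to, the parallelogram law bounds half the difference.\<close>
      have "\<not> (\<forall>g\<in>?G. N g z \<le> m - \<delta>\<^sup>2)"
      proof
        assume "\<forall>g\<in>?G. N g z \<le> m - \<delta>\<^sup>2"
        then have "m - \<delta>\<^sup>2 \<in> M" using zn unfolding M_def by blast
        then have "m \<le> m - \<delta>\<^sup>2" unfolding m_def by (rule cInf_lower[OF _ bdd])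
        then show False using \<delta> by simp
      qed
      then obtain g where g: "g \<in> ?G" "m - \<delta>\<^sup>2 < N g z" by force
      define u v where "u k = pr (k \<cdot> g) x" and "v k = pr (k \<cdot> g) y" for k
      have "N g z = (\<Sum>k\<in>X. ((u k + v k) / 2)\<^sup>2)"
        unfolding N_def u_def v_def using z(2)[OF kg[OF _ g(1)]] by (intro sum.cong) (auto simp: add_divide_distrib)
      moreover have "(\<Sum>k\<in>X. ((u k - v k) / 2)\<^sup>2) = ((\<Sum>k\<in>X. (u k)\<^sup>2) + (\<Sum>k\<in>X. (v k)\<^sup>2)) / 2 - (\<Sum>k\<in>X. ((u k + v k) / 2)\<^sup>2)"
        unfolding sum.distrib[symmetric] sum_divide_distrib sum_subtractf[symmetric]
        by (intro sum.cong) (auto simp: power2_eq_square field_simps)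
      moreover have "(\<Sum>k\<in>X. (u k)\<^sup>2) \<le> m" "(\<Sum>k\<in>X. (v k)\<^sup>2) \<le> m"
        using Nx[OF g(1)] Ny[OF g(1)] by (simp_all add: N_def u_def v_def)
      ultimately have small: "(\<Sum>k\<in>X. ((u k - v k) / 2)\<^sup>2) < \<delta>\<^sup>2" using g(2) by argo
      have uv: "\<bar>u k - v k\<bar> \<le> 2 * \<delta>" if "k \<in> X" for k
      proof -
        have "((u k - v k) / 2)\<^sup>2 \<le> (\<Sum>k\<in>X. ((u k - v k) / 2)\<^sup>2)"
          using that X(1) by (intro member_le_sum) auto
        then have "((u k - v k) / 2)\<^sup>2 \<le> \<delta>\<^sup>2" using small by simp
        then have "\<bar>(u k - v k) / 2\<bar> \<le> \<delta>" using \<delta> by (metis abs_le_square_iff abs_of_pos)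
        then show ?thesis by simp
      qed
      obtain g' where g': "g' \<in> transf A A" "g' \<cdot> g = ident T A"
        using g(1) channel_transf unfolding reversible_def by blast
      define r where "r k = (\<Sum>s\<in>S. d k s * pr (b \<cdot> g') s)" for k
      have bg: "b \<cdot> g' \<in> Eff A" using seq_transf g' b by blast
      \<comment> \<open>The inverse of \<open>g\<close> enters only through the effect
        \<open>b \<cdot> g'\<close>, whose coordinates are bounded by
        \<open>\<Sum>s\<in>S. \<bar>d k s\<bar>\<close> whatever \<open>g\<close> is.\<close>
      have pullback: "pr b \<sigma> = (\<Sum>k\<in>X. r k * pr (k \<cdot> g) \<sigma>)" if \<sigma>: "\<sigma> \<in> St A" for \<sigma>
      proof -
        have "g' \<cdot> (g \<cdot> \<sigma>) = \<sigma>" using seq_assoc[OF \<sigma> Gt[OF g(1)] g'(1)] g'(2) seq_ident(2)[OF \<sigma>] by simp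
        then have "pr b \<sigma> = pr (b \<cdot> g') (g \<cdot> \<sigma>)"
          using pr_seq[OF seq_transf[OF \<sigma> Gt[OF g(1)]] g'(1) b] by simp
        also have "\<dots> = (\<Sum>k\<in>X. r k * pr k (g \<cdot> \<sigma>))"
          unfolding r_def by (rule coord[OF bg seq_transf[OF \<sigma> Gt[OF g(1)]]])
        also have "\<dots> = (\<Sum>k\<in>X. r k * pr (k \<cdot> g) \<sigma>)"
          using pr_seq[OF \<sigma> Gt[OF g(1)]] X(2) by (intro sum.cong) auto
        finally show ?thesis .
      qed
      have rk: "\<bar>r k\<bar> \<le> (\<Sum>s\<in>S. \<bar>d k s\<bar>)" for k
      proof -
        have "\<bar>r k\<bar> \<le> (\<Sum>s\<in>S. \<bar>d k s * pr (b \<cdot> g') s\<bar>)" unfolding r_def by (rule sum_abs)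
        also have "\<dots> \<le> (\<Sum>s\<in>S. \<bar>d k s\<bar>)"
        proof (rule sum_mono)
          fix s assume "s \<in> S"
          then have "0 \<le> pr (b \<cdot> g') s \<and> pr (b \<cdot> g') s \<le> 1" using pr_range[OF _ bg] S(2) by blast
          then show "\<bar>d k s * pr (b \<cdot> g') s\<bar> \<le> \<bar>d k s\<bar>" by (simp add: abs_mult mult_left_le)
        qed
        finally show ?thesis .
      qed
      have "\<bar>pr b x - pr b y\<bar> = \<bar>\<Sum>k\<in>X. r k * (u k - v k)\<bar>"
        unfolding pullback[OF xt] pullback[OF yt] u_def v_def by (simp add: right_diff_distrib sum_subtractf)
      also have "\<dots> \<le> (\<Sum>k\<in>X. \<bar>r k * (u k - v k)\<bar>)" by (rule sum_abs)
      also have "\<dots> \<le> (\<Sum>k\<in>X. (\<Sum>s\<in>S. \<bar>d k s\<bar>) * (2 * \<delta>))"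
        unfolding abs_mult using rk uv \<delta> by (intro sum_mono mult_mono) (auto intro: sum_nonneg)
      also have "\<dots> = C * (2 * \<delta>)" by (simp add: C_def sum_distrib_right)
      finally show ?thesis .
    qed
    have "y = x"
    proof (rule state_eqI[OF yt xt])
      fix b assume b: "b \<in> Eff A"
      have C0: "C \<ge> 0" unfolding C_def by (intro sum_nonneg) auto
      have "\<bar>pr b x - pr b y\<bar> \<le> 0 + \<epsilon>" if "\<epsilon> > 0" for \<epsilon>
      proof -
        have "\<bar>pr b x - pr b y\<bar> \<le> C * (2 * (\<epsilon> / (2 * (C + 1))))"
          using close[OF b, of "\<epsilon> / (2 * (C + 1))"] that C0 by simp
        also have "\<dots> \<le> \<epsilon>" using that C0 by (simp add: field_simps)
        finally show ?thesis by simp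
      qed
      then have "\<bar>pr b x - pr b y\<bar> \<le> 0" by (rule field_le_epsilon)
      then show "pr b y = pr b x" by simp
    qed
    then show ?thesis by (simp add: y_def)
  qed
  then show ?thesis using x by blast
qed

end

text \<open>\<open>\<mu>\<close> is any invariant state: its uniqueness, and with it the meaning of
  \<open>microcanonical A\<close>, is a consequence of this locale. \<open>A\<close> stands on the
  right so that steering with \<open>\<Phi>\<close> yields transformations out of
  \<open>A\<close>.\<close>

locale invariant_purification = sharp_theory_with_purification T
  for T :: "('s, 't) opt" (structure) +
  fixes A B :: 's and \<mu> \<Phi> :: 't
  assumes \<mu>_normalised: "\<mu> \<in> normalised_states A"
    and \<mu>_invariant: "reversible A A U \<Longrightarrow> U \<cdot> \<mu> = \<mu>"
    and \<Phi>_normalised: "\<Phi> \<in> normalised_states (B \<odot> A)"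
    and \<Phi>_pure: "pure \<one> (B \<odot> A) \<Phi>"
    and \<Phi>_marginal: "(discard B \<otimes> ident T A) \<cdot> \<Phi> = \<mu>"
begin

abbreviation w :: "'t \<Rightarrow> 't \<Rightarrow> real" where
  "w b a \<equiv> pr (b \<otimes> a) \<Phi>"

lemmas \<Phi>_state = normalised_state[OF \<Phi>_normalised]

lemma w_right: "b \<in> Eff B \<Longrightarrow> a \<in> Eff A \<Longrightarrow> pr b ((ident T B \<otimes> a) \<cdot> \<Phi>) = w b a"
  by (rule pr_right[OF \<Phi>_state])

lemma w_left: "b \<in> Eff B \<Longrightarrow> a \<in> Eff A \<Longrightarrow> pr a ((b \<otimes> ident T A) \<cdot> \<Phi>) = w b a"
  by (rule pr_left[OF \<Phi>_state])

lemma w_discard: "a \<in> Eff A \<Longrightarrow> w (discard B) a = pr a \<mu>"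
  using w_left[OF discard_transf] \<Phi>_marginal by simp

lemma w_nonneg: "b \<in> Eff B \<Longrightarrow> a \<in> Eff A \<Longrightarrow> 0 \<le> w b a"
  using pr_nonneg[OF \<Phi>_state pair_transf] .

lemma w_le_right: "b \<in> Eff B \<Longrightarrow> a \<in> Eff A \<Longrightarrow> w b a \<le> w b (discard A)"
  using pr_le_discard[OF _ left_state[OF \<Phi>_state]] w_left by (metis discard_transf)

lemma w_le_left: "b \<in> Eff B \<Longrightarrow> a \<in> Eff A \<Longrightarrow> w b a \<le> w (discard B) a"
  using pr_le_discard[OF _ right_state[OF \<Phi>_state]] w_right by (metis discard_transf)

lemma w_sum_left:
  assumes "a \<in> Eff A" "e \<in> Eff B" "\<And>i. i < n \<Longrightarrow> b i \<in> Eff B"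
    and "\<And>\<rho>. \<rho> \<in> St B \<Longrightarrow> pr e \<rho> = pr (discard B) \<rho> - (\<Sum>i<n::nat. pr (b i) \<rho>)"
  shows "w e a = w (discard B) a - (\<Sum>i<n. w (b i) a)"
  using assms(4)[OF right_state[OF \<Phi>_state assms(1)]] w_right[OF _ assms(1)] assms(2,3) by simp

lemma w_pure_right:
  assumes "pure A \<one> a" "w (discard B) a \<noteq> 0"
  shows "\<exists>\<beta> \<in> normalised_states B. pure \<one> B \<beta> \<and> (\<forall>b \<in> Eff B. w b a = w (discard B) a * pr b \<beta>)"
  using pure_normalise[OF pure_right_state[OF assms(1) \<Phi>_pure]] assms(2)
    w_right[OF _ pure_transf[OF assms(1)]] discard_transf by metis

lemma w_pure_left:
  assumes "pure B \<one> b" "w b (discard A) \<noteq> 0"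
  shows "\<exists>\<alpha> \<in> normalised_states A. pure \<one> A \<alpha> \<and> (\<forall>a \<in> Eff A. w b a = w b (discard A) * pr a \<alpha>)"
  using pure_normalise[OF pure_left_state[OF assms(1) \<Phi>_pure]] assms(2)
    w_left[OF pure_transf[OF assms(1)]] discard_transf by metis

text \<open>Moving the effect of the orbit by a reversible channel does not change its probability
  on an invariant state. This probability is positive because it is also that of the sharp effect of
  a pure state in the support of \<open>\<mu>\<close>.\<close>

lemma weight_exists:
  "\<exists>q>0. \<forall>\<alpha> \<in> normalised_states A. pure \<one> A \<alpha> \<longrightarrow> (\<exists>a. pure A \<one> a \<and> pr a \<alpha> = 1 \<and> pr a \<mu> = q)"
proof -
  obtain a where a: "pure A \<one> a"
    and orbit: "\<And>\<alpha>. \<alpha> \<in> normalised_states A \<Longrightarrow> pure \<one> A \<alpha> \<Longrightarrow> \<exists>V. reversible A A V \<and> pr (a \<cdot> V) \<alpha> = 1"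
    using sharp_effect_orbit by blast
  have dual: "\<exists>a'. pure A \<one> a' \<and> pr a' \<alpha> = 1 \<and> pr a' \<mu> = pr a \<mu>"
    if \<alpha>: "\<alpha> \<in> normalised_states A" "pure \<one> A \<alpha>" for \<alpha>
  proof -
    obtain V where V: "reversible A A V" "pr (a \<cdot> V) \<alpha> = 1" using orbit[OF \<alpha>] by blast
    have "pr (a \<cdot> V) \<mu> = pr a \<mu>"
      using pr_seq[OF normalised_state[OF \<mu>_normalised] channel_transf[OF reversible_channel[OF V(1)]] pure_transf[OF a]]
        \<mu>_invariant[OF V(1)] by simp
    then show ?thesis using V pure_seq[OF reversible_pure[OF V(1)] a] by blast
  qed
  obtain \<alpha> where \<alpha>: "\<alpha> \<in> normalised_states A" "pure \<one> A \<alpha>" "\<forall>a \<in> Eff A. pr a \<alpha> \<noteq> 0 \<longrightarrow> pr a \<mu> > 0"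
    using pure_state_in_support[OF \<mu>_normalised] by blast
  obtain a' where "pure A \<one> a'" "pr a' \<alpha> = 1" "pr a' \<mu> = pr a \<mu>" using dual \<alpha>(1,2) by blast
  then have "pr a \<mu> > 0" using \<alpha>(3) pure_transf by fastforce
  then show ?thesis using dual by blast
qed

text \<open>The weight of one orbit of sharp effects. That every sharp effect of every pure state
  has this weight is shown in \<open>sharp_effect_weight\<close>.\<close>

definition q :: real where
  "q = (SOME q. q > 0 \<and> (\<forall>\<alpha> \<in> normalised_states A. pure \<one> A \<alpha> \<longrightarrow>
    (\<exists>a. pure A \<one> a \<and> pr a \<alpha> = 1 \<and> pr a \<mu> = q)))"

lemma q_pos: "q > 0"
  and q_effect: "\<alpha> \<in> normalised_states A \<Longrightarrow> pure \<one> A \<alpha> \<Longrightarrow> \<exists>a. pure A \<one> a \<and> pr a \<alpha> = 1 \<and> pr a \<mu> = q"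
  using someI_ex[OF weight_exists] unfolding q_def by blast+

text \<open>The outcome \<open>b\<close> leaves \<open>A\<close> in a pure state. Joining the sharp
  effect of that state does not lower the probability, which therefore cannot exceed the probability
  \<open>q\<close> of that effect in \<open>\<mu>\<close>.\<close>

lemma pure_left_weight:
  assumes "pure B \<one> b"
  shows "w b (discard A) \<le> q"
proof (cases "w b (discard A) = 0")
  case True
  then show ?thesis using q_pos by simp
next
  case False
  then obtain \<alpha> where \<alpha>: "\<alpha> \<in> normalised_states A" "pure \<one> A \<alpha>"
    "\<forall>a \<in> Eff A. w b a = w b (discard A) * pr a \<alpha>"
    using w_pure_left[OF assms] by blast
  obtain a where a: "pure A \<one> a" "pr a \<alpha> = 1" "pr a \<mu> = q" using q_effect \<alpha>(1,2) by blast
  have "w b (discard A) = w b a" using \<alpha>(3) a(1,2) pure_transf by (metis mult.right_neutral)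
  also have "\<dots> \<le> q" using w_le_left[OF pure_transf[OF assms] pure_transf[OF a(1)]] w_discard[OF pure_transf[OF a(1)]] a(3) by simp
  finally show ?thesis .
qed

text \<open>Conditioning \<open>\<Phi>\<close> on a sharp effect of \<open>\<alpha>\<close> leaves a
  pure state \<open>\<beta>\<close>, and conditioning on a sharp effect of \<open>\<beta>\<close>
  returns to \<open>\<alpha>\<close>, because the bound \<open>q\<close> on pure outcomes of
  \<open>B\<close> leaves no room for another state.\<close>

lemma correspondence:
  assumes "\<alpha> \<in> normalised_states A" "pure \<one> A \<alpha>"
  shows "\<exists>\<beta> \<in> normalised_states B. pure \<one> B \<beta> \<and>
    (\<forall>a. pure A \<one> a \<longrightarrow> pr a \<alpha> = 1 \<longrightarrow> (\<forall>b \<in> Eff B. w b a = q * pr b \<beta>)) \<and>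
    (\<forall>b. pure B \<one> b \<longrightarrow> pr b \<beta> = 1 \<longrightarrow> (\<forall>a \<in> Eff A. w b a = q * pr a \<alpha>))"
proof -
  \<comment> \<open>The weight \<open>s\<close> is kept general because it is known to be
    \<open>q\<close> only in the chosen orbit. The squeeze
    \<open>q \<le> s = w b a \<le> w b (discard A) \<le> q\<close> makes \<open>a\<close> certain on
    the state conditioned by \<open>b\<close>.\<close>
  have left: "\<forall>a' \<in> Eff A. w b a' = q * pr a' \<alpha>"
    if a: "pure A \<one> a" "pr a \<alpha> = 1" and \<beta>: "\<beta> \<in> normalised_states B" "\<forall>b \<in> Eff B. w b a = s * pr b \<beta>"
      and s: "s \<ge> q" and b: "pure B \<one> b" "pr b \<beta> = 1" for a \<beta> s b
  proof -
    note t = pure_transf[OF a(1)] pure_transf[OF b(1)]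
    have s': "w b a = s" using \<beta>(2) t b(2) by simp
    then have "w b (discard A) = q"
      using w_le_right[OF t(2,1)] pure_left_weight[OF b(1)] s by simp
    moreover obtain \<alpha>' where \<alpha>': "\<alpha>' \<in> normalised_states A" "pure \<one> A \<alpha>'"
      "\<forall>a \<in> Eff A. w b a = w b (discard A) * pr a \<alpha>'"
      using w_pure_left[OF b(1)] \<open>w b (discard A) = q\<close> q_pos by auto
    ultimately have w': "\<And>a. a \<in> Eff A \<Longrightarrow> w b a = q * pr a \<alpha>'" by metis
    have "q * 1 \<le> q * pr a \<alpha>'" using w'[OF t(1)] s s' by simp
    then have "pr a \<alpha>' = 1"
      using q_pos pr_range[OF normalised_state[OF \<alpha>'(1)] t(1)] by (simp add: mult_le_cancel_left_pos)
    then have "\<alpha>' = \<alpha>" using sharp_state_unique[OF a(1) \<alpha>'(1) _ assms(1) a(2)] by blast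
    then show ?thesis using w' by blast
  qed
  obtain a where a: "pure A \<one> a" "pr a \<alpha> = 1" "pr a \<mu> = q" using q_effect assms by blast
  note at = pure_transf[OF a(1)]
  obtain \<beta> where \<beta>: "\<beta> \<in> normalised_states B" "pure \<one> B \<beta>" "\<forall>b \<in> Eff B. w b a = w (discard B) a * pr b \<beta>"
    using w_pure_right[OF a(1)] w_discard[OF at] a(3) q_pos by auto
  then have wa: "\<forall>b \<in> Eff B. w b a = q * pr b \<beta>" using w_discard[OF at] a(3) by metis
  have leftb: "\<forall>a' \<in> Eff A. w b a' = q * pr a' \<alpha>" if "pure B \<one> b" "pr b \<beta> = 1" for b
    using left[OF a(1,2) \<beta>(1) wa order.refl that] .
  \<comment> \<open>For another sharp effect \<open>a'\<close> of \<open>\<alpha>\<close> the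
    outcome \<open>b\<close> alone accounts for weight \<open>q\<close>, so the total is at least
    \<open>q\<close>. The same squeeze gives equality; then \<open>b\<close> is certain on the
    conditional state, which must be \<open>\<beta>\<close>.\<close>
  have "\<forall>b \<in> Eff B. w b a' = q * pr b \<beta>" if a': "pure A \<one> a'" "pr a' \<alpha> = 1" for a'
  proof -
    note at' = pure_transf[OF a'(1)]
    obtain b where b: "pure B \<one> b" "pr b \<beta> = 1" using sharp_effect_exists[OF \<beta>(1,2)] by blast
    note bt = pure_transf[OF b(1)]
    have wb: "w b a' = q" using leftb[OF b] at' a'(2) by simp
    define s where "s = w (discard B) a'"
    have s: "s \<ge> q" unfolding s_def using w_le_left[OF bt at'] wb by simp
    obtain \<beta>' where \<beta>': "\<beta>' \<in> normalised_states B" "pure \<one> B \<beta>'" "\<forall>b \<in> Eff B. w b a' = s * pr b \<beta>'"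
      using w_pure_right[OF a'(1)] s q_pos unfolding s_def by auto
    obtain b' where b': "pure B \<one> b'" "pr b' \<beta>' = 1" using sharp_effect_exists[OF \<beta>'(1,2)] by blast
    have "w b' a' = q" using left[OF a' \<beta>'(1,3) s b'] at' a'(2) by simp
    then have sq: "s = q" using \<beta>'(3) b' pure_transf by force
    have "q * pr b \<beta>' = q" using \<beta>'(3) bt wb sq by simp
    then have "pr b \<beta>' = 1" using q_pos by simp
    then have "\<beta>' = \<beta>" using sharp_state_unique[OF b(1) \<beta>'(1) _ \<beta>(1) b(2)] by blast
    then show ?thesis using \<beta>'(3) sq by simp
  qed
  then show ?thesis using \<beta>(1,2) leftb by blast
qed

lemma correspondenceE:
  assumes "\<alpha> \<in> normalised_states A" "pure \<one> A \<alpha>"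
  obtains \<beta> b where "\<beta> \<in> normalised_states B" "pure \<one> B \<beta>" "pure B \<one> b" "pr b \<beta> = 1"
    "\<And>a b'. pure A \<one> a \<Longrightarrow> pr a \<alpha> = 1 \<Longrightarrow> b' \<in> Eff B \<Longrightarrow> w b' a = q * pr b' \<beta>"
    "\<And>a. a \<in> Eff A \<Longrightarrow> w b a = q * pr a \<alpha>"
proof -
  obtain \<beta> where \<beta>: "\<beta> \<in> normalised_states B" "pure \<one> B \<beta>"
    and *: "\<forall>a. pure A \<one> a \<longrightarrow> pr a \<alpha> = 1 \<longrightarrow> (\<forall>b \<in> Eff B. w b a = q * pr b \<beta>)"
      "\<forall>b. pure B \<one> b \<longrightarrow> pr b \<beta> = 1 \<longrightarrow> (\<forall>a \<in> Eff A. w b a = q * pr a \<alpha>)"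
    using correspondence[OF assms] by blast
  obtain b where "pure B \<one> b" "pr b \<beta> = 1" using sharp_effect_exists[OF \<beta>] by blast
  then show thesis using that \<beta> * by blast
qed

text \<open>Each pure state of \<open>A\<close> arises from \<open>\<Phi>\<close> with weight
  \<open>q\<close> by conditioning on \<open>B\<close>, and pure states separate effects.\<close>

lemma faithful:
  assumes "e \<in> Eff A" "f \<in> Eff A" "\<And>b. b \<in> Eff B \<Longrightarrow> w b e = w b f"
  shows "e = f"
proof (rule effect_eq_on_pure[OF assms(1,2)])
  fix \<alpha> assume \<alpha>: "\<alpha> \<in> normalised_states A" "pure \<one> A \<alpha>"
  obtain \<beta> b where b: "pure B \<one> b" "\<And>a. a \<in> Eff A \<Longrightarrow> w b a = q * pr a \<alpha>"
    by (rule correspondenceE[OF \<alpha>]) (rule that)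
  have "q * pr e \<alpha> = q * pr f \<alpha>" using b(2) assms pure_transf[OF b(1)] by metis
  then show "pr e \<alpha> = pr f \<alpha>" using q_pos by simp
qed

lemma sharp_effect_weight:
  assumes "\<alpha> \<in> normalised_states A" "pure \<one> A \<alpha>" "pure A \<one> a" "pr a \<alpha> = 1"
  shows "pr a \<mu> = q"
proof -
  obtain \<beta> where "\<beta> \<in> normalised_states B"
    "\<forall>a. pure A \<one> a \<longrightarrow> pr a \<alpha> = 1 \<longrightarrow> (\<forall>b \<in> Eff B. w b a = q * pr b \<beta>)"
    using correspondence[OF assms(1,2)] by blast
  then have "w (discard B) a = q * 1" using assms(3,4) by (simp add: normalised_discard)
  then show ?thesis using w_discard[OF pure_transf[OF assms(3)]] by simp
qed

text \<open>Steering to a purification of the state that \<open>e\<close> leaves on \<open>B\<close>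
  implements \<open>e\<close> as a transformation \<open>F\<close> followed by the discard. A pure
  effect \<open>c\<close> after \<open>F\<close> refines \<open>e\<close>, and \<open>c\<close> can
  be chosen so that weights in \<open>\<Phi>\<close> identify \<open>c \<cdot> F\<close> with
  \<open>a\<close>. The rest of \<open>e\<close> is \<open>c' \<cdot> F\<close>.\<close>

lemma dominates_sharp_effect':
  assumes \<alpha>: "\<alpha> \<in> normalised_states A" "pure \<one> A \<alpha>" and a: "pure A \<one> a" "pr a \<alpha> = 1"
    and e: "e \<in> Eff A" "pr e \<alpha> = 1"
  shows "\<exists>e' \<in> Eff A. \<forall>\<rho> \<in> St A. pr e' \<rho> = pr e \<rho> - pr a \<rho>"
proof -
  note at = pure_transf[OF a(1)]
  obtain \<beta> b where \<beta>: "\<beta> \<in> normalised_states B" "pure \<one> B \<beta>" and b: "pure B \<one> b" "pr b \<beta> = 1"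
    and wa: "\<And>a b'. pure A \<one> a \<Longrightarrow> pr a \<alpha> = 1 \<Longrightarrow> b' \<in> Eff B \<Longrightarrow> w b' a = q * pr b' \<beta>"
    and wb: "\<And>a. a \<in> Eff A \<Longrightarrow> w b a = q * pr a \<alpha>"
    by (rule correspondenceE[OF \<alpha>]) (rule that)
  note bt = pure_transf[OF b(1)]
  obtain e' where e': "e' \<in> Eff A" "\<And>\<rho>. \<rho> \<in> St A \<Longrightarrow> pr e' \<rho> = pr (discard A) \<rho> - pr e \<rho>"
    using complement_effect[OF e(1)] by blast
  have wee: "w b' e + w b' e' = w b' (discard A)" if b': "b' \<in> Eff B" for b'
    using e'(2)[OF left_state[OF \<Phi>_state b']] w_left[OF b'] e(1) e'(1) by simp
  define \<tau> where "\<tau> = (ident T B \<otimes> e) \<cdot> \<Phi>"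
  have \<tau>: "\<tau> \<in> St B" unfolding \<tau>_def by (rule right_state[OF \<Phi>_state e(1)])
  have \<tau>w: "pr b' \<tau> = w b' e" if "b' \<in> Eff B" for b'
    unfolding \<tau>_def by (rule w_right[OF that e(1)])
  define t where "t = pr (discard B) \<tau>"
  have be: "w b e = q" using wb[OF e(1)] e(2) by simp
  have t: "q \<le> t" "t \<le> 1"
    using w_le_left[OF bt e(1)] be \<tau>w[OF discard_transf] pr_range[OF \<tau> discard_transf] by (simp_all add: t_def)
  then have t0: "t > 0" using q_pos by simp
  obtain \<tau>1 where \<tau>1: "\<tau>1 \<in> normalised_states B" "\<And>b'. b' \<in> Eff B \<Longrightarrow> pr b' \<tau> = t * pr b' \<tau>1"
    using normalise[OF \<tau>] t0 unfolding t_def by (metis less_irrefl)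
  obtain C \<Theta>1 where \<Theta>1: "\<Theta>1 \<in> normalised_states (B \<odot> C)" "pure \<one> (B \<odot> C) \<Theta>1" "(ident T B \<otimes> discard C) \<cdot> \<Theta>1 = \<tau>1"
    using purification_exists[OF \<tau>1(1)] by (auto simp: marginal_def)
  note \<Theta>1t = normalised_state[OF \<Theta>1(1)]
  have \<Theta>1m: "pr (b' \<otimes> discard C) \<Theta>1 = pr b' \<tau>1" if "b' \<in> Eff B" for b'
    using pr_right[OF \<Theta>1t that discard_transf] \<Theta>1(3) by simp
  obtain \<Theta> where \<Theta>: "\<Theta> \<in> St (B \<odot> C)" "\<And>E. E \<in> Eff (B \<odot> C) \<Longrightarrow> pr E \<Theta> = t * pr E \<Theta>1"
    using scaled_state[OF \<Theta>1t, of t] t t0 by auto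
  obtain \<kappa> where \<kappa>: "\<kappa> \<in> normalised_states C" using normalised_exists by blast
  define \<tau>' where "\<tau>' = (ident T B \<otimes> e') \<cdot> \<Phi>"
  have \<tau>': "\<tau>' \<in> St B" unfolding \<tau>'_def by (rule right_state[OF \<Phi>_state e'(1)])
  \<comment> \<open>The second outcome stands for the complement of \<open>e\<close> and completes
    the marginal to that of \<open>\<Phi>\<close>.\<close>
  let ?\<Theta>s = "[\<Theta>, \<tau>' \<otimes> \<kappa>]"
  have marg: "(\<Sum>i<length ?\<Theta>s. pr (b' \<otimes> discard C) (?\<Theta>s ! i)) = w b' (discard A)"
    if b': "b' \<in> Eff B" for b'
  proof -
    have "pr (b' \<otimes> discard C) (\<tau>' \<otimes> \<kappa>) = w b' e'"
      using pr_prod[OF \<tau>' normalised_state[OF \<kappa>] b' discard_transf] \<kappa> w_right[OF b' e'(1)]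
      by (simp add: normalised_iff \<tau>'_def)
    moreover have "pr (b' \<otimes> discard C) \<Theta> = w b' e"
      using \<Theta>(2)[OF pair_transf[OF b' discard_transf]] \<Theta>1m[OF b'] \<tau>1(2)[OF b'] \<tau>w[OF b'] by simp
    ultimately show ?thesis using wee[OF b'] by (simp add: lessThan_Suc)
  qed
  have "?\<Theta>s \<in> tests T \<one> (B \<odot> C)"
  proof (rule prep_testI)
    show "set ?\<Theta>s \<subseteq> St (B \<odot> C)" using \<Theta>(1) prod_state[OF \<tau>' normalised_state[OF \<kappa>]] by simp
    show "(\<Sum>i<length ?\<Theta>s. pr (discard (B \<odot> C)) (?\<Theta>s ! i)) = 1"
      using marg[OF discard_transf] \<Phi>_normalised by (simp add: discard_par normalised_discard)
  qed
  then obtain Ts where Ts: "Ts \<in> tests T A C" "length Ts = 2" "(ident T B \<otimes> Ts ! 0) \<cdot> \<Phi> = \<Theta>"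
    using steering[OF \<Phi>_normalised \<Phi>_pure, of ?\<Theta>s C] marg by force
  define F where "F = Ts ! 0"
  have F: "F \<in> transf A C" "(ident T B \<otimes> F) \<cdot> \<Phi> = \<Theta>"
    using test_nth[OF Ts(1), of 0] Ts(2,3) by (auto simp: F_def)
  have wF: "w b' (c \<cdot> F) = t * pr (b' \<otimes> c) \<Theta>1" if b': "b' \<in> Eff B" and c: "c \<in> Eff C" for b' c
  proof -
    have "w b' (c \<cdot> F) = pr b' ((ident T B \<otimes> c) \<cdot> \<Theta>)"
      using w_right[OF b' seq_transf[OF F(1) c]] right_of_right[OF \<Phi>_state F(1) c] F(2) by simp
    also have "\<dots> = t * pr (b' \<otimes> c) \<Theta>1" using pr_right[OF \<Theta>(1) b' c] \<Theta>(2)[OF pair_transf[OF b' c]] by simp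
    finally show ?thesis .
  qed
  have b\<tau>1: "t * pr b \<tau>1 = q" using \<tau>1(2)[OF bt] \<tau>w[OF bt] be by simp
  then have b\<tau>1': "pr b \<tau>1 \<noteq> 0" using q_pos by auto
  have "pr (discard C) ((b \<otimes> ident T C) \<cdot> \<Theta>1) = pr b \<tau>1"
    using pr_left[OF \<Theta>1t bt discard_transf] \<Theta>1m[OF bt] by simp
  \<comment> \<open>Jointly with \<open>b\<close>, the effect \<open>e\<close> has the full weight
    \<open>q\<close>. Conditioning \<open>\<Theta>1\<close> on \<open>b\<close> leaves a pure state
    \<open>\<gamma>\<close>, and its sharp effect \<open>c\<close> retains that weight.\<close>
  then obtain \<gamma> where \<gamma>: "\<gamma> \<in> normalised_states C" "pure \<one> C \<gamma>"
    "\<forall>c \<in> Eff C. pr c ((b \<otimes> ident T C) \<cdot> \<Theta>1) = pr b \<tau>1 * pr c \<gamma>"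
    using pure_normalise[OF pure_left_state[OF b(1) \<Theta>1(2)]] b\<tau>1' by auto
  obtain c where c: "pure C \<one> c" "pr c \<gamma> = 1" using sharp_effect_exists[OF \<gamma>(1,2)] by blast
  note ct = pure_transf[OF c(1)]
  have cF: "c \<cdot> F \<in> Eff A" using seq_transf[OF F(1) ct] .
  have wbc: "w b (c \<cdot> F) = q"
    using wF[OF bt ct] \<gamma>(3) ct c(2) pr_left[OF \<Theta>1t bt ct] b\<tau>1 by simp
  define s1 where "s1 = pr (discard B) ((ident T B \<otimes> c) \<cdot> \<Theta>1)"
  have s1: "s1 = pr (discard B \<otimes> c) \<Theta>1" unfolding s1_def by (rule pr_right[OF \<Theta>1t discard_transf ct])
  have "s1 \<noteq> 0"
  proof
    assume "s1 = 0"
    then have "w (discard B) (c \<cdot> F) = 0" using wF[OF discard_transf ct] s1 by simp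
    then show False using w_le_left[OF bt cF] wbc q_pos by simp
  qed
  then obtain \<delta> where \<delta>: "\<delta> \<in> normalised_states B" "pure \<one> B \<delta>"
    "\<forall>b' \<in> Eff B. pr b' ((ident T B \<otimes> c) \<cdot> \<Theta>1) = s1 * pr b' \<delta>"
    using pure_normalise[OF pure_right_state[OF c(1) \<Theta>1(2)]] unfolding s1_def by auto
  have w\<delta>: "w b' (c \<cdot> F) = (t * s1) * pr b' \<delta>" if "b' \<in> Eff B" for b'
    using wF[OF that ct] \<delta>(3) pr_right[OF \<Theta>1t that ct] that by simp
  obtain d where d: "pure B \<one> d" "pr d \<delta> = 1" using sharp_effect_exists[OF \<delta>(1,2)] by blast
  \<comment> \<open>The state \<open>\<delta>\<close> that \<open>c \<cdot> F\<close> leaves on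
    \<open>B\<close> is pure since \<open>\<Theta>1\<close> and \<open>c\<close> are. Its sharp
    effect bounds the weight by \<open>q\<close>, while \<open>b\<close> alone already uses
    \<open>q\<close>; so \<open>b\<close> is certain on \<open>\<delta>\<close>, which must be
    \<open>\<beta>\<close>.\<close>
  have "t * s1 \<le> q"
    using w\<delta>[OF pure_transf[OF d(1)]] d(2) w_le_right[OF pure_transf[OF d(1)] cF] pure_left_weight[OF d(1)] by simp
  moreover have qb: "q = (t * s1) * pr b \<delta>" using w\<delta>[OF bt] wbc by simp
  moreover have b\<delta>: "0 \<le> pr b \<delta>" "pr b \<delta> \<le> 1" using pr_range[OF normalised_state[OF \<delta>(1)] bt] by auto
  ultimately have tq: "t * s1 = q" using q_pos
    by (smt (verit) mult_left_le zero_less_mult_iff)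
  then have "pr b \<delta> = 1" using qb[unfolded tq] q_pos by simp
  then have "\<delta> = \<beta>" using sharp_state_unique[OF b(1) \<delta>(1) _ \<beta>(1) b(2)] by blast
  then have cFa: "c \<cdot> F = a"
    using w\<delta> tq wa[OF a] by (intro faithful[OF cF at]) simp
  have uF: "discard C \<cdot> F = e"
    using wF[OF _ discard_transf] \<Theta>1m \<tau>1(2) \<tau>w seq_transf[OF F(1) discard_transf] e(1)
    by (intro faithful) auto
  obtain c' where c': "c' \<in> Eff C" "\<And>\<rho>. \<rho> \<in> St C \<Longrightarrow> pr c' \<rho> = pr (discard C) \<rho> - pr c \<rho>"
    using complement_effect[OF ct] by blast
  have "pr (c' \<cdot> F) \<rho> = pr e \<rho> - pr a \<rho>" if \<rho>: "\<rho> \<in> St A" for \<rho>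
    using c'(2)[OF seq_transf[OF \<rho> F(1)]] pr_seq[OF \<rho> F(1)] c'(1) ct discard_transf uF cFa by metis
  then show ?thesis using seq_transf[OF F(1) c'(1)] by blast
qed

text \<open>The states left on \<open>B\<close> by the given effects form an ensemble with the
  marginal of \<open>\<Phi>\<close>. Steering to the trivial system realises it by a test, and
  faithfulness of \<open>\<Phi>\<close> identifies the outcomes with the given effects, which may
  come from different tests.\<close>

lemma observation_testI':
  assumes "set es \<subseteq> Eff A"
    and "\<And>\<rho>. \<rho> \<in> St A \<Longrightarrow> (\<Sum>i<length es. pr (es ! i) \<rho>) = pr (discard A) \<rho>"
  shows "es \<in> tests T A \<one>"
proof -
  have mem: "es ! i \<in> Eff A" if "i < length es" for i using that assms(1) by auto
  let ?\<Theta>s = "map (\<lambda>e. (ident T B \<otimes> e) \<cdot> \<Phi>) es"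
  have marg: "(\<Sum>i<length ?\<Theta>s. pr (b \<otimes> discard \<one>) (?\<Theta>s ! i)) = w b (discard A)" if b: "b \<in> Eff B" for b
  proof -
    have "(\<Sum>i<length ?\<Theta>s. pr (b \<otimes> discard \<one>) (?\<Theta>s ! i)) = (\<Sum>i<length es. w b (es ! i))"
      using w_right[OF b mem] by (simp add: discard_triv par_unit(1)[OF b])
    also have "\<dots> = (\<Sum>i<length es. pr (es ! i) ((b \<otimes> ident T A) \<cdot> \<Phi>))" using w_left[OF b mem] by simp
    also have "\<dots> = w b (discard A)" using assms(2)[OF left_state[OF \<Phi>_state b]] w_left[OF b discard_transf] by simp
    finally show ?thesis .
  qed
  have "?\<Theta>s \<in> tests T \<one> (B \<odot> \<one>)"
  proof (rule prep_testI)
    show "set ?\<Theta>s \<subseteq> St (B \<odot> \<one>)" using right_state[OF \<Phi>_state] assms(1) by auto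
    have "discard B \<otimes> discard \<one> = discard (B \<odot> \<one>)" by (rule discard_par)
    then show "(\<Sum>i<length ?\<Theta>s. pr (discard (B \<odot> \<one>)) (?\<Theta>s ! i)) = 1"
      using marg[OF discard_transf] \<Phi>_normalised discard_par[of B A] by (metis normalised_discard)
  qed
  then obtain Ts where Ts: "Ts \<in> tests T A \<one>" "length Ts = length es"
    "\<And>i. i < length es \<Longrightarrow> (ident T B \<otimes> Ts ! i) \<cdot> \<Phi> = (ident T B \<otimes> es ! i) \<cdot> \<Phi>"
    using steering[OF \<Phi>_normalised \<Phi>_pure, of ?\<Theta>s \<one>] marg by fastforce
  have "Ts = es"
  proof (rule nth_equalityI[OF Ts(2)])
    fix i assume i: "i < length Ts"
    have Ti: "Ts ! i \<in> Eff A" using test_nth[OF Ts(1) i] .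
    have ei: "es ! i \<in> Eff A" using mem i Ts(2) by simp
    show "Ts ! i = es ! i"
      using w_right[OF _ Ti] w_right[OF _ ei] Ts(2,3) i by (intro faithful[OF Ti ei]) metis
  qed
  then show ?thesis using Ts(1) by simp
qed

end

context sharp_theory_with_purification
begin

lemma invariant_purification_exists:
  assumes "\<mu> \<in> normalised_states A" "\<And>U. reversible A A U \<Longrightarrow> U \<cdot> \<mu> = \<mu>"
  shows "\<exists>B \<Phi>. invariant_purification T A B \<mu> \<Phi>"
proof -
  obtain B \<Phi> where "\<Phi> \<in> normalised_states (B \<odot> A)" "pure \<one> (B \<odot> A) \<Phi>" "(discard B \<otimes> ident T A) \<cdot> \<Phi> = \<mu>"
    using left_purification_exists[OF assms(1)] by blast
  then show ?thesis
    using assms by (intro exI[of _ B] exI[of _ \<Phi>] invariant_purification.intro invariant_purification_axioms.intro)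
      (auto intro: sharp_theory_with_purification_axioms)
qed

lemma some_invariant_purification: "\<exists>B \<mu> \<Phi>. invariant_purification T A B \<mu> \<Phi>"
  using invariant_state_exists[of A] invariant_purification_exists by metis

lemma dominates_sharp_effect:
  assumes "\<alpha> \<in> normalised_states A" "pure \<one> A \<alpha>" "pure A \<one> a" "pr a \<alpha> = 1"
    and "e \<in> Eff A" "pr e \<alpha> = 1"
  shows "\<exists>e' \<in> Eff A. \<forall>\<rho> \<in> St A. pr e' \<rho> = pr e \<rho> - pr a \<rho>"
  using some_invariant_purification[of A] invariant_purification.dominates_sharp_effect'[OF _ assms] by blast

lemma observation_testI:
  assumes "set es \<subseteq> Eff A"
    and "\<And>\<rho>. \<rho> \<in> St A \<Longrightarrow> (\<Sum>i<length es. pr (es ! i) \<rho>) = pr (discard A) \<rho>"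
  shows "es \<in> tests T A \<one>"
  using some_invariant_purification[of A] invariant_purification.observation_testI'[OF _ assms] by blast

section \<open>Pure maximal sets and diagonalisation\<close>

text \<open>Effects are required to vanish on later states only, as this is what a construction
  adding one state at a time delivers. Full orthogonality is recovered in
  \<open>triangular_orthogonal\<close>.\<close>

definition triangular :: "'a \<Rightarrow> nat \<Rightarrow> (nat \<Rightarrow> 'b) \<Rightarrow> (nat \<Rightarrow> 'b) \<Rightarrow> bool" where
  "triangular A n \<alpha> a \<longleftrightarrow>
     (\<forall>i<n. \<alpha> i \<in> normalised_states A \<and> pure \<one> A (\<alpha> i) \<and> pure A \<one> (a i) \<and> pr (a i) (\<alpha> i) = 1) \<and>
     (\<forall>i j. i < j \<longrightarrow> j < n \<longrightarrow> pr (a i) (\<alpha> j) = 0)"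

lemma triangularD:
  assumes "triangular A n \<alpha> a" "i < n"
  shows "\<alpha> i \<in> normalised_states A" "pure \<one> A (\<alpha> i)" "pure A \<one> (a i)" "pr (a i) (\<alpha> i) = 1"
    "\<alpha> i \<in> St A" "a i \<in> Eff A"
  using assms pure_transf normalised_state unfolding triangular_def by blast+

lemma triangular_0 [simp]: "triangular A 0 \<alpha> a"
  by (simp add: triangular_def)

lemma triangular_Suc:
  "triangular A (Suc n) \<alpha> a \<longleftrightarrow> triangular A n \<alpha> a \<and> \<alpha> n \<in> normalised_states A \<and> pure \<one> A (\<alpha> n) \<and>
     pure A \<one> (a n) \<and> pr (a n) (\<alpha> n) = 1 \<and> (\<forall>i<n. pr (a i) (\<alpha> n) = 0)"
  unfolding triangular_def less_Suc_eq by blast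

lemma triangular_extend:
  assumes "triangular A n \<alpha> a" "\<beta> \<in> normalised_states A" "pure \<one> A \<beta>" "pure A \<one> b" "pr b \<beta> = 1"
    and "\<And>i. i < n \<Longrightarrow> pr (a i) \<beta> = 0"
  shows "triangular A (Suc n) (\<alpha>(n := \<beta>)) (a(n := b))"
  using assms unfolding triangular_Suc by (auto simp: triangular_def)

lemma triangular_shift: "triangular A (Suc n) \<alpha> a \<Longrightarrow> triangular A n (\<lambda>i. \<alpha> (Suc i)) (\<lambda>i. a (Suc i))"
  unfolding triangular_def by (meson Suc_less_eq)

text \<open>The effect remaining after the first \<open>n\<close> sharp effects is certain on
  \<open>\<alpha> n\<close>, where these vanish, so it dominates \<open>a n\<close>, which can be
  subtracted too.\<close>

lemma triangular_complement:
  assumes "triangular A n \<alpha> a"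
  shows "\<exists>e \<in> Eff A. \<forall>\<rho> \<in> St A. pr e \<rho> = pr (discard A) \<rho> - (\<Sum>i<n. pr (a i) \<rho>)"
  using assms
proof (induction n)
  case 0
  then show ?case by (intro bexI[of _ "discard A"]) auto
next
  case (Suc n)
  then have n: "triangular A n \<alpha> a" "\<alpha> n \<in> normalised_states A" "pure \<one> A (\<alpha> n)" "pure A \<one> (a n)"
    "pr (a n) (\<alpha> n) = 1" "\<forall>i<n. pr (a i) (\<alpha> n) = 0"
    by (auto simp: triangular_Suc)
  obtain e where e: "e \<in> Eff A" "\<And>\<rho>. \<rho> \<in> St A \<Longrightarrow> pr e \<rho> = pr (discard A) \<rho> - (\<Sum>i<n. pr (a i) \<rho>)"
    using Suc.IH[OF n(1)] by blast
  have "pr e (\<alpha> n) = 1" using e(2)[OF normalised_state[OF n(2)]] n(2,6) by (simp add: normalised_discard)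
  then obtain e' where "e' \<in> Eff A" "\<And>\<rho>. \<rho> \<in> St A \<Longrightarrow> pr e' \<rho> = pr e \<rho> - pr (a n) \<rho>"
    using dominates_sharp_effect[OF n(2-5) e(1)] by blast
  then show ?case using e(2) by (intro bexI[of _ e']) auto
qed

text \<open>The sharp effects add up to at most the discard, and \<open>a j\<close> alone exhausts
  the probability on \<open>\<alpha> j\<close>.\<close>

lemma triangular_orthogonal:
  assumes "triangular A n \<alpha> a" "i < n" "j < n"
  shows "pr (a i) (\<alpha> j) = (if i = j then 1 else 0)"
proof (cases "i = j")
  case True
  then show ?thesis using triangularD(4)[OF assms(1,2)] by simp
next
  case False
  obtain e where e: "e \<in> Eff A" "\<And>\<rho>. \<rho> \<in> St A \<Longrightarrow> pr e \<rho> = pr (discard A) \<rho> - (\<Sum>i<n. pr (a i) \<rho>)"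
    using triangular_complement[OF assms(1)] by blast
  note j = triangularD[OF assms(1,3)]
  have nn: "0 \<le> pr (a k) (\<alpha> j)" if "k < n" for k using pr_nonneg[OF j(5) triangularD(6)[OF assms(1) that]] .
  have "(\<Sum>k<n. pr (a k) (\<alpha> j)) \<le> 1"
    using e(2)[OF j(5)] pr_nonneg[OF j(5) e(1)] j(1) by (simp add: normalised_discard)
  moreover have "(\<Sum>k\<in>{i, j}. pr (a k) (\<alpha> j)) \<le> (\<Sum>k<n. pr (a k) (\<alpha> j))"
    using assms nn by (intro sum_mono2) auto
  ultimately have "pr (a i) (\<alpha> j) \<le> 0" using False j(4) by simp
  then show ?thesis using nn[OF assms(2)] False by simp
qed

lemma triangular_perfectly_distinguishable:
  assumes "triangular A n \<alpha> a" "n > 0"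
  shows "perfectly_distinguishable A (map \<alpha> [0..<n])"
proof -
  obtain m where m: "n = Suc m" using assms(2) by (cases n) auto
  \<comment> \<open>The test must have exactly \<open>n\<close> outcomes, so the remainder is joined
    to one of them: \<open>f\<close> replaces \<open>a 0\<close> by the complement of all the
    others. This is where \<open>n > 0\<close> matters.\<close>
  obtain f where f: "f \<in> Eff A"
    "\<And>\<rho>. \<rho> \<in> St A \<Longrightarrow> pr f \<rho> = pr (discard A) \<rho> - (\<Sum>i<m. pr (a (Suc i)) \<rho>)"
    using triangular_complement[OF triangular_shift[OF assms(1)[unfolded m]]] by blast
  define g where "g i = (if i = 0 then f else a i)" for i
  let ?es = "map g [0..<n]"
  have "?es \<in> tests T A \<one>"
  proof (rule observation_testI)
    show "set ?es \<subseteq> Eff A" using f(1) triangularD(6)[OF assms(1)] by (auto simp: g_def)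
    fix \<rho> assume \<rho>: "\<rho> \<in> St A"
    have "(\<Sum>i<length ?es. pr (?es ! i) \<rho>) = (\<Sum>i<n. pr (g i) \<rho>)" by simp
    also have "\<dots> = (\<Sum>i<Suc m. pr (g i) \<rho>)" by (simp only: m)
    also have "\<dots> = pr f \<rho> + (\<Sum>i<m. pr (a (Suc i)) \<rho>)" unfolding sum.lessThan_Suc_shift by (simp add: g_def)
    finally show "(\<Sum>i<length ?es. pr (?es ! i) \<rho>) = pr (discard A) \<rho>" using f(2)[OF \<rho>] by simp
  qed
  moreover have "pr (g i) (\<alpha> j) = (if i = j then 1 else 0)" if "i < n" "j < n" for i j
  proof (cases "i = 0")
    case False
    then show ?thesis using triangular_orthogonal[OF assms(1) that] by (simp add: g_def)
  next
    case True
    have "(\<Sum>k<m. pr (a (Suc k)) (\<alpha> j)) = (\<Sum>k<m. if Suc k = j then 1 else 0)"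
      using triangular_orthogonal[OF assms(1) _ that(2)] m by (intro sum.cong) auto
    also have "\<dots> = (if j = 0 then 0 else 1)"
      using that(2) m by (cases j) auto
    finally show ?thesis
      using True f(2)[OF triangularD(5)[OF assms(1) that(2)]] triangularD(1)[OF assms(1) that(2)]
      by (simp add: g_def normalised_discard)
  qed
  ultimately show ?thesis
    unfolding perfectly_distinguishable_def using triangularD(1)[OF assms(1)]
    by (auto intro!: bexI[of _ ?es])
qed

text \<open>The discriminating effect \<open>es ! i\<close> is certain on its state and so dominates
  the sharp effect of that state, which then vanishes wherever \<open>es ! i\<close> does.\<close>

lemma distinguishable_triangular:
  assumes "perfectly_distinguishable A \<alpha>s" "\<And>\<alpha>. \<alpha> \<in> set \<alpha>s \<Longrightarrow> pure \<one> A \<alpha>"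
  shows "\<exists>a. triangular A (length \<alpha>s) ((!) \<alpha>s) a"
proof -
  let ?n = "length \<alpha>s"
  obtain es where es: "es \<in> tests T A \<one>" "length es = ?n"
    "\<And>i j. i < ?n \<Longrightarrow> j < ?n \<Longrightarrow> pr (es ! i) (\<alpha>s ! j) = (if i = j then 1 else 0)"
    and norm: "set \<alpha>s \<subseteq> normalised_states A"
    using assms(1) unfolding perfectly_distinguishable_def by blast
  have \<alpha>: "\<alpha>s ! i \<in> normalised_states A" "pure \<one> A (\<alpha>s ! i)" if "i < ?n" for i
    using norm assms(2) that by auto
  have "\<forall>i. \<exists>a. i < ?n \<longrightarrow> pure A \<one> a \<and> pr a (\<alpha>s ! i) = 1"
    using sharp_effect_exists[OF \<alpha>] by blast
  then obtain a where a: "\<And>i. i < ?n \<Longrightarrow> pure A \<one> (a i)" "\<And>i. i < ?n \<Longrightarrow> pr (a i) (\<alpha>s ! i) = 1" by metis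
  have "pr (a i) (\<alpha>s ! j) = 0" if "i < j" "j < ?n" for i j
  proof -
    have i: "i < ?n" using that by simp
    note \<alpha>j = normalised_state[OF \<alpha>(1)[OF that(2)]]
    obtain e' where "e' \<in> Eff A" "pr e' (\<alpha>s ! j) = pr (es ! i) (\<alpha>s ! j) - pr (a i) (\<alpha>s ! j)"
      using dominates_sharp_effect[OF \<alpha>[OF i] a(1,2)[OF i], of "es ! i"] test_nth[OF es(1)] es(2,3) i \<alpha>j
      by fastforce
    then have "pr (a i) (\<alpha>s ! j) \<le> 0"
      using pr_nonneg[OF \<alpha>j, of e'] es(3)[OF i that(2)] that(1) by simp
    then show ?thesis using pr_nonneg[OF \<alpha>j pure_transf[OF a(1)[OF i]]] by simp
  qed
  then show ?thesis using \<alpha> a by (intro exI[of _ a]) (auto simp: triangular_def)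
qed

end

context invariant_purification
begin

text \<open>Each sharp effect takes the share \<open>q\<close> of the total probability 1 of
  \<open>\<mu>\<close>.\<close>

lemma triangular_length_bound:
  assumes "triangular A n \<alpha> a"
  shows "real n * q \<le> 1"
proof -
  obtain e where e: "e \<in> Eff A" "\<And>\<rho>. \<rho> \<in> St A \<Longrightarrow> pr e \<rho> = pr (discard A) \<rho> - (\<Sum>i<n. pr (a i) \<rho>)"
    using triangular_complement[OF assms] by blast
  note \<mu> = normalised_state[OF \<mu>_normalised]
  have "(\<Sum>i<n. pr (a i) \<mu>) = (\<Sum>i<n. q)"
    using sharp_effect_weight[OF triangularD(1-4)[OF assms]] by (intro sum.cong) auto
  then show ?thesis
    using e(2)[OF \<mu>] pr_nonneg[OF \<mu> e(1)] \<mu>_normalised by (simp add: normalised_discard)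
qed

text \<open>The correspondence mirrors the set in an orthogonal family on \<open>B\<close>. If the
  effect left over on \<open>A\<close> had positive weight, a pure component of the state it leaves
  on \<open>B\<close> would mirror back to a further state of \<open>A\<close>, against maximality.
  So the weights \<open>q\<close> exhaust \<open>\<mu>\<close>, and exhaustion on the side of
  \<open>B\<close> expresses \<open>\<mu>\<close> by the states themselves.\<close>

lemma maximal_set_uniform:
  assumes "pure_maximal_set A \<alpha>s"
  shows "real (length \<alpha>s) * q = 1"
    and "a \<in> Eff A \<Longrightarrow> pr a \<mu> = q * (\<Sum>i<length \<alpha>s. pr a (\<alpha>s ! i))"
proof -
  define n where "n = length \<alpha>s"
  have pd: "perfectly_distinguishable A \<alpha>s" and max: "\<And>\<sigma>. \<not> perfectly_distinguishable A (\<alpha>s @ [\<sigma>])"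
    using assms unfolding pure_maximal_set_def by blast+
  obtain c where c: "triangular A n ((!) \<alpha>s) c"
    using distinguishable_triangular[OF pd] assms unfolding pure_maximal_set_def n_def by blast
  note cD = triangularD[OF c]
  have "\<forall>i. \<exists>\<beta> b. i < n \<longrightarrow> \<beta> \<in> normalised_states B \<and> pure \<one> B \<beta> \<and> pure B \<one> b \<and> pr b \<beta> = 1 \<and>
    (\<forall>b' \<in> Eff B. w b' (c i) = q * pr b' \<beta>) \<and> (\<forall>a \<in> Eff A. w b a = q * pr a (\<alpha>s ! i))"
  proof
    fix i
    show "\<exists>\<beta> b. i < n \<longrightarrow> \<beta> \<in> normalised_states B \<and> pure \<one> B \<beta> \<and> pure B \<one> b \<and> pr b \<beta> = 1 \<and>
      (\<forall>b' \<in> Eff B. w b' (c i) = q * pr b' \<beta>) \<and> (\<forall>a \<in> Eff A. w b a = q * pr a (\<alpha>s ! i))"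
    proof (cases "i < n")
      case True
      then show ?thesis using correspondenceE[OF cD(1,2)[OF True]] cD(3,4)[OF True] by metis
    qed auto
  qed
  then obtain \<beta> where "\<forall>i. \<exists>b. i < n \<longrightarrow> \<beta> i \<in> normalised_states B \<and> pure \<one> B (\<beta> i) \<and> pure B \<one> b \<and> pr b (\<beta> i) = 1 \<and>
    (\<forall>b' \<in> Eff B. w b' (c i) = q * pr b' (\<beta> i)) \<and> (\<forall>a \<in> Eff A. w b a = q * pr a (\<alpha>s ! i))"
    by (rule choice[THEN exE])
  then obtain b where corr: "\<forall>i. i < n \<longrightarrow> \<beta> i \<in> normalised_states B \<and> pure \<one> B (\<beta> i) \<and> pure B \<one> (b i) \<and> pr (b i) (\<beta> i) = 1 \<and>
    (\<forall>b' \<in> Eff B. w b' (c i) = q * pr b' (\<beta> i)) \<and> (\<forall>a \<in> Eff A. w (b i) a = q * pr a (\<alpha>s ! i))"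
    by (rule choice[THEN exE])
  have \<beta>: "\<beta> i \<in> normalised_states B" "pure \<one> B (\<beta> i)"
    and b: "pure B \<one> (b i)" "pr (b i) (\<beta> i) = 1"
    and wc: "b' \<in> Eff B \<Longrightarrow> w b' (c i) = q * pr b' (\<beta> i)"
    and wb: "a \<in> Eff A \<Longrightarrow> w (b i) a = q * pr a (\<alpha>s ! i)" if "i < n" for i b' a
    using corr that by blast+
  have bt: "b i \<in> Eff B" if "i < n" for i using pure_transf[OF b(1)[OF that]] .
  \<comment> \<open>Reading \<open>w (b i) (c j)\<close> from both sides transposes the matrix of
    pairings, so vanishing for \<open>i < j\<close> on \<open>B\<close> uses the opposite half of
    orthogonality on \<open>A\<close>.\<close>
  have "pr (b i) (\<beta> j) = 0" if "i < j" "j < n" for i j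
  proof -
    have i: "i < n" using that by simp
    have "q * pr (b i) (\<beta> j) = q * pr (c j) (\<alpha>s ! i)"
      using wc[OF that(2) bt[OF i]] wb[OF i cD(6)[OF that(2)]] by metis
    then show ?thesis using triangular_orthogonal[OF c that(2) i] that(1) q_pos by simp
  qed
  then have tb: "triangular B n \<beta> b" using \<beta> b by (simp add: triangular_def)
  obtain e where e: "e \<in> Eff A" "\<And>\<rho>. \<rho> \<in> St A \<Longrightarrow> pr e \<rho> = pr (discard A) \<rho> - (\<Sum>i<n. pr (c i) \<rho>)"
    using triangular_complement[OF c] by blast
  note \<mu>t = normalised_state[OF \<mu>_normalised]
  have "pr e \<mu> = 0"
  proof (rule ccontr)
    assume r: "pr e \<mu> \<noteq> 0"
    define \<tau> where "\<tau> = (ident T B \<otimes> e) \<cdot> \<Phi>"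
    have \<tau>: "\<tau> \<in> St B" unfolding \<tau>_def by (rule right_state[OF \<Phi>_state e(1)])
    have \<tau>w: "pr b' \<tau> = w b' e" if "b' \<in> Eff B" for b'
      unfolding \<tau>_def by (rule w_right[OF that e(1)])
    define s where "s = pr e \<mu>"
    have s0: "s > 0" using r pr_nonneg[OF \<mu>t e(1)] by (simp add: s_def)
    have \<tau>s: "pr (discard B) \<tau> = s" using \<tau>w[OF discard_transf] w_discard[OF e(1)] by (simp add: s_def)
    then have "pr (discard B) \<tau> \<noteq> 0" using s0 by simp
    from normalise[OF \<tau> this] obtain \<tau>1 where \<tau>1: "\<tau>1 \<in> normalised_states B"
      "\<And>b'. b' \<in> Eff B \<Longrightarrow> pr b' \<tau> = s * pr b' \<tau>1"
      unfolding \<tau>s by blast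
    obtain \<gamma> p \<tau>2 where \<gamma>: "\<gamma> \<in> normalised_states B" "pure \<one> B \<gamma>" and p: "p > 0" and \<tau>2: "\<tau>2 \<in> St B"
      and dec: "\<And>b'. b' \<in> Eff B \<Longrightarrow> pr b' \<tau>1 = p * pr b' \<gamma> + pr b' \<tau>2"
      using pure_component[OF \<tau>1(1)] by blast
    note \<gamma>t = normalised_state[OF \<gamma>(1)]
    have \<tau>\<gamma>: "s * p * pr b' \<gamma> \<le> w b' e" if b': "b' \<in> Eff B" for b'
      using \<tau>w[OF b'] \<tau>1(2)[OF b'] dec[OF b'] s0 mult_nonneg_nonneg[OF less_imp_le[OF s0] pr_nonneg[OF \<tau>2 b']]
      by (simp add: distrib_left mult.assoc)
    have b\<gamma>: "pr (b i) \<gamma> = 0" if i: "i < n" for i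
    proof -
      have "pr e (\<alpha>s ! i) = 0"
      proof -
        have "(\<Sum>k<n. pr (c k) (\<alpha>s ! i)) = (\<Sum>k<n. if k = i then 1 else 0)"
          using triangular_orthogonal[OF c _ i] by (intro sum.cong) auto
        then show ?thesis using e(2)[OF cD(5)[OF i]] cD(1)[OF i] i by (simp add: normalised_discard)
      qed
      then have "s * p * pr (b i) \<gamma> \<le> 0" using \<tau>\<gamma>[OF bt[OF i]] wb[OF i e(1)] by simp
      then have "pr (b i) \<gamma> \<le> 0" using s0 p by (simp add: mult_le_0_iff)
      then show ?thesis using pr_nonneg[OF \<gamma>t bt[OF i]] by simp
    qed
    obtain b' where b': "pure B \<one> b'" "pr b' \<gamma> = 1" using sharp_effect_exists[OF \<gamma>] by blast
    note bt' = pure_transf[OF b'(1)]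
    have tb': "triangular B (Suc n) (\<beta>(n := \<gamma>)) (b(n := b'))"
      by (rule triangular_extend[OF tb \<gamma> b' b\<gamma>])
    \<comment> \<open>The construction makes the old effects vanish on \<open>\<gamma>\<close>. The
      converse vanishing, which is the one that mirrors back to \<open>A\<close>, comes from full
      orthogonality.\<close>
    have b'\<beta>: "pr b' (\<beta> i) = 0" if "i < n" for i
      using triangular_orthogonal[OF tb', of n i] that by simp
    have "0 < w b' e" using \<tau>\<gamma>[OF bt'] b'(2) s0 p by (smt (verit) mult_pos_pos)
    then have w': "w b' (discard A) \<noteq> 0" using w_le_right[OF bt' e(1)] by simp
    from w_pure_left[OF b'(1) this] obtain \<alpha>' where \<alpha>': "\<alpha>' \<in> normalised_states A" "pure \<one> A \<alpha>'"
      "\<And>a. a \<in> Eff A \<Longrightarrow> w b' a = w b' (discard A) * pr a \<alpha>'"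
      by blast
    have "pr (c i) \<alpha>' = 0" if "i < n" for i
      using wc[OF that bt'] \<alpha>'(3)[OF cD(6)[OF that]] b'\<beta>[OF that] w' by simp
    moreover obtain a' where a': "pure A \<one> a'" "pr a' \<alpha>' = 1" using sharp_effect_exists[OF \<alpha>'(1,2)] by blast
    ultimately have "triangular A (Suc n) (((!) \<alpha>s)(n := \<alpha>')) (c(n := a'))"
      using triangular_extend[OF c \<alpha>'(1,2) a'] by blast
    from triangular_perfectly_distinguishable[OF this]
    have "perfectly_distinguishable A (map (((!) \<alpha>s)(n := \<alpha>')) [0..<Suc n])" by simp
    moreover have "map (((!) \<alpha>s)(n := \<alpha>')) [0..<Suc n] = \<alpha>s @ [\<alpha>']"
      by (rule nth_equalityI) (auto simp: n_def nth_append less_Suc_eq simp del: upt_Suc)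
    ultimately show False using max by simp
  qed
  moreover have "(\<Sum>i<n. pr (c i) \<mu>) = real n * q"
    using sharp_effect_weight[OF cD(1-4)] by simp
  ultimately have nq: "real n * q = 1" using e(2)[OF \<mu>t] \<mu>_normalised by (simp add: normalised_discard)
  then show "real (length \<alpha>s) * q = 1" by (simp add: n_def)
  assume a: "a \<in> Eff A"
  \<comment> \<open>The effect left over on \<open>B\<close> has probability
    \<open>1 - n * q = 0\<close>, so it contributes nothing to \<open>\<mu>\<close>.\<close>
  obtain f where f: "f \<in> Eff B" "\<And>\<rho>. \<rho> \<in> St B \<Longrightarrow> pr f \<rho> = pr (discard B) \<rho> - (\<Sum>i<n. pr (b i) \<rho>)"
    using triangular_complement[OF tb] by blast
  have sum: "w f a' = pr a' \<mu> - q * (\<Sum>i<n. pr a' (\<alpha>s ! i))" if a': "a' \<in> Eff A" for a'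
    using w_sum_left[OF a' f(1) bt f(2)] wb[OF _ a'] w_discard[OF a'] by (simp add: sum_distrib_left)
  have "(\<Sum>i<n. pr (discard A) (\<alpha>s ! i)) = real n"
    using cD(1) by (simp add: normalised_discard)
  then have "w f (discard A) = 0"
    using sum[OF discard_transf] \<mu>_normalised nq by (simp add: normalised_discard mult.commute)
  then have "w f a = 0" using w_le_right[OF f(1) a] w_nonneg[OF f(1) a] by simp
  then show "pr a \<mu> = q * (\<Sum>i<length \<alpha>s. pr a (\<alpha>s ! i))" using sum[OF a] by (simp add: n_def)
qed

text \<open>Coordinates make the pairing jointly continuous, so the pairs \<open>(e, \<sigma>)\<close> of an effect with weight
  \<open>q\<close> in \<open>\<mu>\<close> and a state on which it is certain form a compact set.  Such effects are exactly
  the sharp ones.\<close>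

lemma maximal_sharp_effect':
  assumes \<rho>: "\<rho> \<in> normalised_states A"
  shows "\<exists>\<alpha> \<in> normalised_states A. \<exists>a. pure \<one> A \<alpha> \<and> pure A \<one> a \<and> pr a \<alpha> = 1 \<and>
    (\<forall>\<alpha>' \<in> normalised_states A. \<forall>a'. pure \<one> A \<alpha>' \<longrightarrow> pure A \<one> a' \<longrightarrow> pr a' \<alpha>' = 1 \<longrightarrow> pr a' \<rho> \<le> pr a \<rho>)"
proof -
  obtain X S d where X: "finite X" "X \<subseteq> Eff A" and S: "finite S" "S \<subseteq> St A"
    and coord: "\<And>b \<rho>. b \<in> Eff A \<Longrightarrow> \<rho> \<in> St A \<Longrightarrow> pr b \<rho> = (\<Sum>k\<in>X. (\<Sum>s\<in>S. d k s * pr b s) * pr k \<rho>)"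
    by (rule effect_coordinates[where A = A]) (rule that)
  define pe where "pe s z = fst z (\<one>, s, ident T \<one>)" for s :: 't and z :: "('s \<times> 't \<times> 't \<Rightarrow> real) \<times> ('s \<times> 't \<times> 't \<Rightarrow> real)"
  define ps where "ps k z = snd z (\<one>, ident T \<one>, k)" for k :: 't and z :: "('s \<times> 't \<times> 't \<Rightarrow> real) \<times> ('s \<times> 't \<times> 't \<Rightarrow> real)"
  have cpe: "continuous_on UNIV (pe s)" for s
    unfolding pe_def by (rule continuous_on_product_then_coordinatewise[OF continuous_on_fst[OF continuous_on_id]])
  have cps: "continuous_on UNIV (ps k)" for k
    unfolding ps_def by (rule continuous_on_product_then_coordinatewise[OF continuous_on_snd[OF continuous_on_id]])
  define Q where "Q z = (\<Sum>k\<in>X. (\<Sum>s\<in>S. d k s * pe s z) * ps k z)" for z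
  have cQ: "continuous_on UNIV Q"
    unfolding Q_def using cpe cps by (intro continuous_on_sum continuous_on_mult continuous_on_const)
  have pe: "pe s (vect A \<one> e, g) = pr e s" if "e \<in> Eff A" "s \<in> St A" for e s g
    using vect_effect_unit[OF that] by (simp add: pe_def)
  have ps: "ps k (f, vect \<one> A \<sigma>) = pr k \<sigma>" if "k \<in> Eff A" "\<sigma> \<in> St A" for k \<sigma> f
    using vect_state_unit[OF that(2,1)] by (simp add: ps_def)
  have Q: "Q (vect A \<one> e, vect \<one> A \<sigma>) = pr e \<sigma>" if e: "e \<in> Eff A" and \<sigma>: "\<sigma> \<in> St A" for e \<sigma>
    unfolding Q_def coord[OF that]
    using pe[OF e] ps[OF _ \<sigma>] X(2) S(2) by (intro sum.cong arg_cong2[where f = "(*)"]) auto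
  \<comment> \<open>Carrying a witness state along turns the existence of a state on which
    \<open>e\<close> is certain into a closed condition.\<close>
  define H where "H = (vect A \<one> ` Eff A \<times> vect \<one> A ` St A) \<inter>
    ({z. pe \<mu> z = q} \<inter> ({z. ps (discard A) z = 1} \<inter> {z. Q z = 1}))"
  note \<mu>t = normalised_state[OF \<mu>_normalised] and \<rho>t = normalised_state[OF \<rho>]
  have H_iff: "(vect A \<one> e, vect \<one> A \<sigma>) \<in> H \<longleftrightarrow> pr e \<mu> = q \<and> \<sigma> \<in> normalised_states A \<and> pr e \<sigma> = 1"
    if "e \<in> Eff A" "\<sigma> \<in> St A" for e \<sigma>
    using that \<mu>t by (auto simp: H_def pe ps Q normalised_iff)
  have cH: "compact H"
    unfolding H_def using cpe cps cQ
    by (intro compact_Int_closed compact_Times compact_vect closed_Int closed_Collect_eq continuous_on_const) auto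
  obtain \<alpha>0 where \<alpha>0: "\<alpha>0 \<in> normalised_states A" "pure \<one> A \<alpha>0" using pure_state_exists by blast
  obtain a0 where a0: "pure A \<one> a0" "pr a0 \<alpha>0 = 1" "pr a0 \<mu> = q" using q_effect[OF \<alpha>0] by blast
  have "(vect A \<one> a0, vect \<one> A \<alpha>0) \<in> H"
    using H_iff[OF pure_transf[OF a0(1)] normalised_state[OF \<alpha>0(1)]] \<alpha>0 a0 by simp
  then have nH: "H \<noteq> {}" by blast
  obtain z where z: "z \<in> H" "\<And>y. y \<in> H \<Longrightarrow> pe \<rho> y \<le> pe \<rho> z"
    using continuous_attains_sup[OF cH nH continuous_on_subset[OF cpe subset_UNIV]] by blast
  obtain e \<sigma> where e: "e \<in> Eff A" and \<sigma>t: "\<sigma> \<in> St A" and z_eq: "z = (vect A \<one> e, vect \<one> A \<sigma>)"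
    using z(1) unfolding H_def by blast
  have e\<mu>: "pr e \<mu> = q" and \<sigma>: "\<sigma> \<in> normalised_states A" "pr e \<sigma> = 1"
    using z(1) H_iff[OF e \<sigma>t] z_eq by auto
  obtain \<alpha> where \<alpha>: "\<alpha> \<in> normalised_states A" "pure \<one> A \<alpha>" "\<forall>\<sigma> \<in> normalised_states A. pr e \<sigma> \<le> pr e \<alpha>"
    using maximising_pure_state[OF e] by blast
  have "pr e \<alpha> = 1"
    using \<alpha>(3) \<sigma> pr_range[OF normalised_state[OF \<alpha>(1)] e] by fastforce
  obtain a where a: "pure A \<one> a" "pr a \<alpha> = 1" "pr a \<mu> = q" using q_effect[OF \<alpha>(1,2)] by blast
  obtain e' where e': "e' \<in> Eff A" "\<And>\<rho>. \<rho> \<in> St A \<Longrightarrow> pr e' \<rho> = pr e \<rho> - pr a \<rho>"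
    using dominates_sharp_effect'[OF \<alpha>(1,2) a(1,2) e \<open>pr e \<alpha> = 1\<close>] by blast
  \<comment> \<open>The difference \<open>e'\<close> of \<open>e\<close> and \<open>a\<close> has
    probability 0 in \<open>\<mu>\<close>, in which every pure state occurs with weight
    \<open>q\<close>; so it vanishes on all pure states.\<close>
  have "e = a"
  proof (rule effect_eq_on_pure[OF e pure_transf[OF a(1)]])
    fix \<beta> assume \<beta>: "\<beta> \<in> normalised_states A" "pure \<one> A \<beta>"
    obtain \<gamma> b where b: "pure B \<one> b" "\<And>a. a \<in> Eff A \<Longrightarrow> w b a = q * pr a \<beta>"
      by (rule correspondenceE[OF \<beta>]) (rule that)
    have "q * pr e' \<beta> \<le> 0"
      using b(2)[OF e'(1)] w_le_left[OF pure_transf[OF b(1)] e'(1)] w_discard[OF e'(1)] e'(2)[OF \<mu>t] e\<mu> a(3) by simp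
    then have "pr e' \<beta> = 0"
      using q_pos pr_nonneg[OF normalised_state[OF \<beta>(1)] e'(1)] by (simp add: mult_le_0_iff)
    then show "pr e \<beta> = pr a \<beta>" using e'(2)[OF normalised_state[OF \<beta>(1)]] by simp
  qed
  moreover have "pr a' \<rho> \<le> pr e \<rho>"
    if \<alpha>': "\<alpha>' \<in> normalised_states A" "pure \<one> A \<alpha>'" and a': "pure A \<one> a'" "pr a' \<alpha>' = 1" for \<alpha>' a'
  proof -
    note t = pure_transf[OF a'(1)] normalised_state[OF \<alpha>'(1)]
    have "(vect A \<one> a', vect \<one> A \<alpha>') \<in> H"
      using H_iff[OF t] sharp_effect_weight[OF \<alpha>' a'] \<alpha>' a' by simp
    then show ?thesis using z(2) pe[OF t(1) \<rho>t] pe[OF e \<rho>t] z_eq by metis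
  qed
  ultimately show ?thesis using \<alpha>(1,2) a(1,2) by blast
qed

end

context sharp_theory_with_purification
begin

section \<open>Splitting off pure components of maximal weight\<close>

lemma maximal_sharp_effect:
  assumes "\<rho> \<in> normalised_states A"
  shows "\<exists>\<alpha> \<in> normalised_states A. \<exists>a. pure \<one> A \<alpha> \<and> pure A \<one> a \<and> pr a \<alpha> = 1 \<and>
    (\<forall>\<alpha>' \<in> normalised_states A. \<forall>a'. pure \<one> A \<alpha>' \<longrightarrow> pure A \<one> a' \<longrightarrow> pr a' \<alpha>' = 1 \<longrightarrow> pr a' \<rho> \<le> pr a \<rho>)"
  using some_invariant_purification[of A] invariant_purification.maximal_sharp_effect'[OF _ assms] by blast

lemma triangular_bounded: "\<exists>N. \<forall>n \<alpha> a. triangular A n \<alpha> a \<longrightarrow> n \<le> N"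
proof -
  obtain B \<mu> \<Phi> where "invariant_purification T A B \<mu> \<Phi>" using some_invariant_purification[of A] by blast
  then interpret invariant_purification T A B \<mu> \<Phi> .
  have "n \<le> nat \<lceil>1 / q\<rceil>" if "triangular A n \<alpha> a" for n \<alpha> a
  proof -
    have "real n \<le> 1 / q" using triangular_length_bound[OF that] q_pos by (simp add: field_simps)
    then show ?thesis by linarith
  qed
  then show ?thesis by blast
qed

text \<open>A purification is conditioned on the maximising effect \<open>a\<close>, and separately
  on a sharp effect \<open>b\<close> of the pure state that \<open>a\<close> leaves on
  \<open>B\<close>. The weight \<open>p'\<close> of \<open>b\<close> is at least \<open>p\<close>,
  and at most the probability of some sharp effect in \<open>\<rho>\<close>, hence at most
  \<open>p\<close> by maximality. So \<open>b\<close> splits off \<open>\<alpha>\<close> with weight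
  \<open>p\<close>, which is all that \<open>a\<close> sees of \<open>\<rho>\<close>, and
  \<open>a\<close> vanishes on the remainder.\<close>

lemma extremal_component:
  assumes "\<rho> \<in> normalised_states A"
  shows "\<exists>\<alpha> \<in> normalised_states A. \<exists>a. \<exists>p>0. \<exists>\<tau> \<in> St A. pure \<one> A \<alpha> \<and> pure A \<one> a \<and> pr a \<alpha> = 1 \<and>
    pr a \<tau> = 0 \<and> (\<forall>c \<in> Eff A. pr c \<rho> = p * pr c \<alpha> + pr c \<tau>)"
proof -
  obtain \<alpha> a where \<alpha>: "\<alpha> \<in> normalised_states A" "pure \<one> A \<alpha>" and a: "pure A \<one> a" "pr a \<alpha> = 1"
    and maxi: "\<And>\<alpha>' a'. \<alpha>' \<in> normalised_states A \<Longrightarrow> pure \<one> A \<alpha>' \<Longrightarrow> pure A \<one> a' \<Longrightarrow> pr a' \<alpha>' = 1 \<Longrightarrow> pr a' \<rho> \<le> pr a \<rho>"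
    using maximal_sharp_effect[OF assms] by blast
  note at = pure_transf[OF a(1)]
  define p where "p = pr a \<rho>"
  have p: "p > 0"
  proof -
    obtain \<alpha>' where \<alpha>': "\<alpha>' \<in> normalised_states A" "pure \<one> A \<alpha>'" "\<forall>a \<in> Eff A. pr a \<alpha>' \<noteq> 0 \<longrightarrow> pr a \<rho> > 0"
      using pure_state_in_support[OF assms] by blast
    obtain a' where a': "pure A \<one> a'" "pr a' \<alpha>' = 1" using sharp_effect_exists[OF \<alpha>'(1,2)] by blast
    have "pr a' \<rho> > 0" using \<alpha>'(3) pure_transf[OF a'(1)] a'(2) by simp
    then show ?thesis using maxi[OF \<alpha>'(1,2) a'] by (simp add: p_def)
  qed
  obtain B \<Psi> where \<Psi>: "\<Psi> \<in> normalised_states (B \<odot> A)" "pure \<one> (B \<odot> A) \<Psi>" "(discard B \<otimes> ident T A) \<cdot> \<Psi> = \<rho>"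
    using left_purification_exists[OF assms] by blast
  note \<Psi>t = normalised_state[OF \<Psi>(1)]
  have m\<rho>: "pr (discard B \<otimes> c) \<Psi> = pr c \<rho>" if "c \<in> Eff A" for c
    using pr_left[OF \<Psi>t discard_transf that] \<Psi>(3) by simp
  have "pr (discard B) ((ident T B \<otimes> a) \<cdot> \<Psi>) = p"
    using pr_right[OF \<Psi>t discard_transf at] m\<rho>[OF at] by (simp add: p_def)
  then obtain \<beta> where \<beta>: "\<beta> \<in> normalised_states B" "pure \<one> B \<beta>"
    "\<forall>b \<in> Eff B. pr b ((ident T B \<otimes> a) \<cdot> \<Psi>) = p * pr b \<beta>"
    using pure_normalise[OF pure_right_state[OF a(1) \<Psi>(2)]] p by auto
  obtain b where b: "pure B \<one> b" "pr b \<beta> = 1" using sharp_effect_exists[OF \<beta>(1,2)] by blast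
  note bt = pure_transf[OF b(1)]
  have ba: "pr (b \<otimes> a) \<Psi> = p" using pr_right[OF \<Psi>t bt at] \<beta>(3) bt b(2) by simp
  define p' where "p' = pr (discard A) ((b \<otimes> ident T A) \<cdot> \<Psi>)"
  have "p \<le> p'"
    using pr_le_discard[OF at left_state[OF \<Psi>t bt]] pr_left[OF \<Psi>t bt at] ba by (simp add: p'_def)
  then obtain \<alpha>' where \<alpha>': "\<alpha>' \<in> normalised_states A" "pure \<one> A \<alpha>'"
    "\<forall>c \<in> Eff A. pr c ((b \<otimes> ident T A) \<cdot> \<Psi>) = p' * pr c \<alpha>'"
    using pure_normalise[OF pure_left_state[OF b(1) \<Psi>(2)]] p unfolding p'_def by auto
  obtain a' where a': "pure A \<one> a'" "pr a' \<alpha>' = 1" using sharp_effect_exists[OF \<alpha>'(1,2)] by blast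
  note at' = pure_transf[OF a'(1)]
  have "p' = pr b ((ident T B \<otimes> a') \<cdot> \<Psi>)"
    using \<alpha>'(3) at' a'(2) pr_left[OF \<Psi>t bt at'] pr_right[OF \<Psi>t bt at'] by simp
  also have "\<dots> \<le> pr (discard B) ((ident T B \<otimes> a') \<cdot> \<Psi>)"
    by (rule pr_le_discard[OF bt right_state[OF \<Psi>t at']])
  also have "\<dots> = pr a' \<rho>" using pr_right[OF \<Psi>t discard_transf at'] m\<rho>[OF at'] by simp
  also have "\<dots> \<le> p" using maxi[OF \<alpha>'(1,2) a'] by (simp add: p_def)
  finally have p': "p' = p" using \<open>p \<le> p'\<close> by simp
  have "p * pr a \<alpha>' = p" using \<alpha>'(3) at p' pr_left[OF \<Psi>t bt at] ba by simp
  then have "pr a \<alpha>' = 1" using p by simp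
  then have "\<alpha>' = \<alpha>" using sharp_state_unique[OF a(1) \<alpha>'(1) _ \<alpha>(1) a(2)] by blast
  obtain b' where b': "b' \<in> Eff B" "\<And>\<rho>. \<rho> \<in> St B \<Longrightarrow> pr b' \<rho> = pr (discard B) \<rho> - pr b \<rho>"
    using complement_effect[OF bt] by blast
  define \<tau> where "\<tau> = (b' \<otimes> ident T A) \<cdot> \<Psi>"
  have \<tau>: "\<tau> \<in> St A" unfolding \<tau>_def by (rule left_state[OF \<Psi>t b'(1)])
  have dec: "pr c \<rho> = p * pr c \<alpha> + pr c \<tau>" if c: "c \<in> Eff A" for c
  proof -
    have "pr c \<tau> = pr b' ((ident T B \<otimes> c) \<cdot> \<Psi>)"
      unfolding \<tau>_def using pr_left[OF \<Psi>t b'(1) c] pr_right[OF \<Psi>t b'(1) c] by simp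
    also have "\<dots> = pr (discard B) ((ident T B \<otimes> c) \<cdot> \<Psi>) - pr b ((ident T B \<otimes> c) \<cdot> \<Psi>)"
      by (rule b'(2)[OF right_state[OF \<Psi>t c]])
    also have "pr (discard B) ((ident T B \<otimes> c) \<cdot> \<Psi>) = pr c \<rho>"
      using pr_right[OF \<Psi>t discard_transf c] m\<rho>[OF c] by simp
    also have "pr b ((ident T B \<otimes> c) \<cdot> \<Psi>) = p * pr c \<alpha>"
      using pr_right[OF \<Psi>t bt c] pr_left[OF \<Psi>t bt c] \<alpha>'(3) c p' \<open>\<alpha>' = \<alpha>\<close> by simp
    finally show ?thesis by simp
  qed
  have "pr a \<tau> = 0" using dec[OF at] a(2) by (simp add: p_def)
  then show ?thesis using \<alpha> a p \<tau> dec by blast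
qed

text \<open>The earlier effects vanish on the remainder and hence on its components, so each state
  split off extends the family. The uniform bound \<open>N\<close> on the length of such families
  forces the remainder to become null.\<close>

lemma triangular_decomposition_extend:
  assumes "\<And>n \<alpha> a. triangular A n \<alpha> a \<Longrightarrow> n \<le> N" "triangular A n \<alpha> a" "\<And>i. i < n \<Longrightarrow> 0 \<le> p i"
    and "\<tau> \<in> St A" "\<And>i. i < n \<Longrightarrow> pr (a i) \<tau> = 0"
    and "\<And>c. c \<in> Eff A \<Longrightarrow> pr c \<rho> = (\<Sum>i<n. p i * pr c (\<alpha> i)) + pr c \<tau>"
  shows "\<exists>n \<alpha> a p. triangular A n \<alpha> a \<and> (\<forall>i<n. 0 \<le> p i) \<and> (\<forall>c \<in> Eff A. pr c \<rho> = (\<Sum>i<n. p i * pr c (\<alpha> i)))"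
  using assms(2-)
proof (induction "N - n" arbitrary: n \<alpha> a p \<tau> rule: less_induct)
  case less
  note tri = less.prems(1) and p = less.prems(2) and \<tau> = less.prems(3,4) and dec = less.prems(5)
  show ?case
  proof (cases "pr (discard A) \<tau> = 0")
    case True
    then have "pr c \<rho> = (\<Sum>i<n. p i * pr c (\<alpha> i))" if "c \<in> Eff A" for c
      using dec[OF that] null_state[OF that \<tau>(1)] by simp
    then show ?thesis using tri p by blast
  next
    case False
    define t where "t = pr (discard A) \<tau>"
    have t: "0 < t" "t \<le> 1" using False pr_range[OF \<tau>(1) discard_transf] by (auto simp: t_def)
    obtain \<tau>1 where \<tau>1: "\<tau>1 \<in> normalised_states A" "\<And>c. c \<in> Eff A \<Longrightarrow> pr c \<tau> = t * pr c \<tau>1"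
      using normalise[OF \<tau>(1) False] unfolding t_def by blast
    obtain \<beta> b r \<tau>2 where \<beta>: "\<beta> \<in> normalised_states A" "pure \<one> A \<beta>" and b: "pure A \<one> b" "pr b \<beta> = 1"
      and r: "r > 0" and \<tau>2: "\<tau>2 \<in> St A" "pr b \<tau>2 = 0"
      and dec1: "\<And>c. c \<in> Eff A \<Longrightarrow> pr c \<tau>1 = r * pr c \<beta> + pr c \<tau>2"
      using extremal_component[OF \<tau>1(1)] by blast
    obtain \<tau>3 where \<tau>3: "\<tau>3 \<in> St A" "\<And>c. c \<in> Eff A \<Longrightarrow> pr c \<tau>3 = t * pr c \<tau>2"
      using scaled_state[OF \<tau>2(1), of t] t by auto
    have zero: "pr (a i) \<beta> = 0" "pr (a i) \<tau>3 = 0" if i: "i < n" for i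
    proof -
      note ai = triangularD(6)[OF tri i]
      have "t * (r * pr (a i) \<beta> + pr (a i) \<tau>2) = 0"
        using \<tau>(2)[OF i] \<tau>1(2)[OF ai] dec1[OF ai] by simp
      then have "r * pr (a i) \<beta> + pr (a i) \<tau>2 = 0" using t by simp
      moreover have "0 \<le> r * pr (a i) \<beta>" "0 \<le> pr (a i) \<tau>2"
        using r pr_nonneg[OF normalised_state[OF \<beta>(1)] ai] pr_nonneg[OF \<tau>2(1) ai] by simp_all
      ultimately have "r * pr (a i) \<beta> = 0" "pr (a i) \<tau>2 = 0" by linarith+
      then show "pr (a i) \<beta> = 0" "pr (a i) \<tau>3 = 0" using r \<tau>3(2)[OF ai] by simp_all
    qed
    have tri': "triangular A (Suc n) (\<alpha>(n := \<beta>)) (a(n := b))"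
      by (rule triangular_extend[OF tri \<beta> b zero(1)])
    have "n < N" using assms(1)[OF tri'] by simp
    then have "N - Suc n < N - n" by simp
    then show ?thesis
    proof (rule less.hyps[OF _ tri', of "p(n := t * r)" \<tau>3])
      show "0 \<le> (p(n := t * r)) i" if "i < Suc n" for i
        using that p t r by (auto simp: less_Suc_eq)
      show "\<tau>3 \<in> St A" by (rule \<tau>3(1))
      show "pr ((a(n := b)) i) \<tau>3 = 0" if "i < Suc n" for i
        using that zero(2) \<tau>3(2)[OF pure_transf[OF b(1)]] \<tau>2(2) by (auto simp: less_Suc_eq)
      fix c assume c: "c \<in> Eff A"
      have "(\<Sum>i<Suc n. (p(n := t * r)) i * pr c ((\<alpha>(n := \<beta>)) i)) = (\<Sum>i<n. p i * pr c (\<alpha> i)) + t * r * pr c \<beta>"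
        by simp
      then show "pr c \<rho> = (\<Sum>i<Suc n. (p(n := t * r)) i * pr c ((\<alpha>(n := \<beta>)) i)) + pr c \<tau>3"
        using dec[OF c] \<tau>1(2)[OF c] dec1[OF c] \<tau>3(2)[OF c] by (simp add: algebra_simps)
    qed
  qed
qed

lemma triangular_decomposition:
  assumes "\<rho> \<in> St A"
  shows "\<exists>n \<alpha> a p. triangular A n \<alpha> a \<and> (\<forall>i<n. 0 \<le> p i) \<and> (\<forall>c \<in> Eff A. pr c \<rho> = (\<Sum>i<n. p i * pr c (\<alpha> i)))"
proof -
  obtain N where N: "\<And>n \<alpha> a. triangular A n \<alpha> a \<Longrightarrow> n \<le> N" using triangular_bounded by blast
  show ?thesis
    by (rule triangular_decomposition_extend[OF N triangular_0[of A undefined undefined], where \<tau> = \<rho>]) (use assms in auto)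
qed

text \<open>A state that extends the set may be mixed, but a pure component of it extends the set as
  well: the old outcomes vanish on the component, so the added outcome is certain on it.\<close>

lemma extend_to_maximal:
  assumes "perfectly_distinguishable A \<alpha>s" "\<And>\<alpha>. \<alpha> \<in> set \<alpha>s \<Longrightarrow> pure \<one> A \<alpha>"
  shows "\<exists>\<beta>s. pure_maximal_set A (\<alpha>s @ \<beta>s)"
proof -
  obtain N where N: "\<And>n \<alpha> a. triangular A n \<alpha> a \<Longrightarrow> n \<le> N" using triangular_bounded by blast
  show ?thesis
    using assms
  proof (induction "N - length \<alpha>s" arbitrary: \<alpha>s rule: less_induct)
    case less
    show ?case
    proof (cases "\<exists>\<sigma>. perfectly_distinguishable A (\<alpha>s @ [\<sigma>])")
      case False
      then show ?thesis using less.prems by (intro exI[of _ "[]"]) (auto simp: pure_maximal_set_def)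
    next
      case True
      let ?n = "length \<alpha>s"
      obtain \<sigma> es where norm: "set (\<alpha>s @ [\<sigma>]) \<subseteq> normalised_states A"
        and es: "es \<in> tests T A \<one>" "length es = Suc ?n"
        and \<delta>: "\<And>i j. i < Suc ?n \<Longrightarrow> j < Suc ?n \<Longrightarrow> pr (es ! i) ((\<alpha>s @ [\<sigma>]) ! j) = (if i = j then 1 else 0)"
        using True unfolding perfectly_distinguishable_def by auto
      have \<sigma>: "\<sigma> \<in> normalised_states A" using norm by simp
      obtain \<alpha> p \<tau> where \<alpha>: "\<alpha> \<in> normalised_states A" "pure \<one> A \<alpha>" and p: "p > 0" and \<tau>: "\<tau> \<in> St A"
        and dec: "\<And>a. a \<in> Eff A \<Longrightarrow> pr a \<sigma> = p * pr a \<alpha> + pr a \<tau>"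
        using pure_component[OF \<sigma>] by blast
      have mem: "es ! i \<in> Eff A" if "i < Suc ?n" for i using test_nth[OF es(1)] es(2) that by simp
      have zero: "pr (es ! i) \<alpha> = 0" if i: "i < ?n" for i
      proof -
        have ei: "es ! i \<in> Eff A" using mem i by simp
        have "p * pr (es ! i) \<alpha> + pr (es ! i) \<tau> = 0" using \<delta>[of i ?n] i dec[OF ei] by simp
        moreover have "0 \<le> p * pr (es ! i) \<alpha>" "0 \<le> pr (es ! i) \<tau>"
          using p pr_nonneg[OF normalised_state[OF \<alpha>(1)] ei] pr_nonneg[OF \<tau> ei] by simp_all
        ultimately have "p * pr (es ! i) \<alpha> = 0" by linarith
        then show ?thesis using p by simp
      qed
      have "(\<Sum>i<Suc ?n. pr (es ! i) \<alpha>) = 1"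
        using effect_test_sum[OF es(1) normalised_state[OF \<alpha>(1)]] es(2) \<alpha>(1) by (simp add: normalised_discard)
      then have one: "pr (es ! ?n) \<alpha> = 1" using zero by simp
      have pd: "perfectly_distinguishable A (\<alpha>s @ [\<alpha>])"
        unfolding perfectly_distinguishable_def
      proof (intro conjI bexI[OF _ es(1)] allI impI)
        show "set (\<alpha>s @ [\<alpha>]) \<subseteq> normalised_states A" using norm \<alpha>(1) by simp
        show "length es = length (\<alpha>s @ [\<alpha>])" using es(2) by simp
        fix i j assume i: "i < length (\<alpha>s @ [\<alpha>])" and j: "j < length (\<alpha>s @ [\<alpha>])"
        show "pr (es ! i) ((\<alpha>s @ [\<alpha>]) ! j) = (if i = j then 1 else 0)"
        proof (cases "j < ?n")
          case True
          then show ?thesis using \<delta>[of i j] i by (simp add: nth_append)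
        next
          case False
          then have "j = ?n" using j by simp
          then show ?thesis using zero one i by (cases "i = ?n") auto
        qed
      qed
      have pure': "\<beta> \<in> set (\<alpha>s @ [\<alpha>]) \<Longrightarrow> pure \<one> A \<beta>" for \<beta> using less.prems(2) \<alpha>(2) by auto
      obtain a where "triangular A (length (\<alpha>s @ [\<alpha>])) ((!) (\<alpha>s @ [\<alpha>])) a"
        using distinguishable_triangular[OF pd pure'] by blast
      then have "N - length (\<alpha>s @ [\<alpha>]) < N - ?n" using N by fastforce
      then obtain \<beta>s where "pure_maximal_set A ((\<alpha>s @ [\<alpha>]) @ \<beta>s)"
        using less.hyps[OF _ pd pure'] by blast
      then show ?thesis by (intro exI[of _ "\<alpha> # \<beta>s"]) simp
    qed
  qed
qed

section \<open>Dimension, microcanonical state and spectrum\<close>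

lemma pure_maximal_set_exists: "\<exists>\<alpha>s. pure_maximal_set A \<alpha>s"
proof -
  obtain \<alpha> where \<alpha>: "\<alpha> \<in> normalised_states A" "pure \<one> A \<alpha>" using pure_state_exists by blast
  obtain a where a: "pure A \<one> a" "pr a \<alpha> = 1" using sharp_effect_exists[OF \<alpha>] by blast
  have "triangular A 1 (\<lambda>_. \<alpha>) (\<lambda>_. a)" using \<alpha> a by (simp add: triangular_def)
  then have "perfectly_distinguishable A [\<alpha>]" using triangular_perfectly_distinguishable by fastforce
  then show ?thesis using extend_to_maximal[of A "[\<alpha>]"] \<alpha> by auto
qed

lemma invariant_state_uniform:
  assumes "\<mu> \<in> normalised_states A" "\<And>U. reversible A A U \<Longrightarrow> U \<cdot> \<mu> = \<mu>"
    and "pure_maximal_set A \<alpha>s" "a \<in> Eff A"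
  shows "pr a \<mu> = (\<Sum>i<length \<alpha>s. pr a (\<alpha>s ! i)) / length \<alpha>s"
proof -
  obtain B \<Phi> where "invariant_purification T A B \<mu> \<Phi>"
    using invariant_purification_exists[OF assms(1,2)] by blast
  then interpret invariant_purification T A B \<mu> \<Phi> .
  have "real (length \<alpha>s) * q = 1" by (rule maximal_set_uniform(1)[OF assms(3)])
  then have "q = 1 / length \<alpha>s" by (cases "length \<alpha>s = 0") (simp_all add: field_simps)
  then show ?thesis using maximal_set_uniform(2)[OF assms(3,4)] by simp
qed

text \<open>The weight \<open>q\<close> belongs to the system rather than to the maximal set, and it
  determines the size.\<close>

lemma dimension_eq:
  assumes "pure_maximal_set A \<alpha>s"
  shows "dimension A = length \<alpha>s" "length \<alpha>s > 0"
proof -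
  obtain B \<mu> \<Phi> where "invariant_purification T A B \<mu> \<Phi>" using some_invariant_purification[of A] by blast
  then interpret invariant_purification T A B \<mu> \<Phi> .
  have same: "length \<beta>s = length \<alpha>s" if "pure_maximal_set A \<beta>s" for \<beta>s
  proof -
    have "real (length \<beta>s) * q = real (length \<alpha>s) * q"
      using maximal_set_uniform(1) that assms by metis
    then show ?thesis using q_pos by simp
  qed
  show "dimension A = length \<alpha>s"
    unfolding dimension_def
  proof (rule the_equality)
    show "\<exists>\<beta>s. pure_maximal_set A \<beta>s \<and> length \<beta>s = length \<alpha>s" using assms by blast
    show "d = length \<alpha>s" if "\<exists>\<beta>s. pure_maximal_set A \<beta>s \<and> length \<beta>s = d" for d
      using that same by blast
  qed
  show "length \<alpha>s > 0" using maximal_set_uniform(1)[OF assms] by (cases \<alpha>s) auto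
qed

text \<open>One formula over a fixed maximal set holds for every invariant state, so there is only
  one, which justifies the definite description.\<close>

lemma microcanonical:
  shows microcanonical_normalised: "microcanonical A \<in> normalised_states A"
    and microcanonical_uniform: "pure_maximal_set A \<alpha>s \<Longrightarrow> a \<in> Eff A \<Longrightarrow>
      pr a (microcanonical A) = (\<Sum>i<length \<alpha>s. pr a (\<alpha>s ! i)) / length \<alpha>s"
proof -
  obtain \<mu> where \<mu>: "\<mu> \<in> normalised_states A" "\<forall>U. reversible A A U \<longrightarrow> U \<cdot> \<mu> = \<mu>"
    using invariant_state_exists by blast
  obtain \<beta>s where \<beta>s: "pure_maximal_set A \<beta>s" using pure_maximal_set_exists by blast
  have uniq: "\<nu> = \<mu>" if "\<nu> \<in> normalised_states A" "\<forall>U. reversible A A U \<longrightarrow> U \<cdot> \<nu> = \<nu>" for \<nu>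
    using invariant_state_uniform[OF that(1) _ \<beta>s] invariant_state_uniform[OF \<mu>(1) _ \<beta>s] that \<mu>
    by (intro state_eqI[of \<nu> A \<mu>]) (auto simp: normalised_state)
  have m: "microcanonical A = \<mu>"
    unfolding microcanonical_def by (rule the_equality) (use \<mu> uniq in blast)+
  show "microcanonical A \<in> normalised_states A" using \<mu> m by simp
  show "pr a (microcanonical A) = (\<Sum>i<length \<alpha>s. pr a (\<alpha>s ! i)) / length \<alpha>s"
    if "pure_maximal_set A \<alpha>s" "a \<in> Eff A"
    using invariant_state_uniform[OF \<mu>(1) _ that] \<mu>(2) m by simp
qed

text \<open>A triangular decomposition may have fewer terms than the dimension; its states are
  completed to a maximal set and the added eigenvalues are 0.\<close>

theorem spectrum_exists:
  assumes \<rho>: "\<rho> \<in> normalised_states A"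
  shows "\<exists>p. is_spectrum A \<rho> p"
proof -
  note \<rho>t = normalised_state[OF \<rho>]
  obtain n \<alpha> a p where tri: "triangular A n \<alpha> a" and p: "\<forall>i<n. 0 \<le> p i"
    and dec: "\<And>c. c \<in> Eff A \<Longrightarrow> pr c \<rho> = (\<Sum>i<n. p i * pr c (\<alpha> i))"
    using triangular_decomposition[OF \<rho>t] by blast
  have "n > 0" using dec[OF discard_transf] \<rho> by (cases n) (auto simp: normalised_discard)
  let ?\<alpha>s = "map \<alpha> [0..<n]"
  obtain \<beta>s where \<beta>s: "pure_maximal_set A (?\<alpha>s @ \<beta>s)"
    using extend_to_maximal[OF triangular_perfectly_distinguishable[OF tri \<open>n > 0\<close>]] triangularD(2)[OF tri]
    by fastforce
  define ps where "ps = map p [0..<n] @ replicate (length \<beta>s) 0"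
  have len: "length ps = length (?\<alpha>s @ \<beta>s)" by (simp add: ps_def)
  have norm: "set (?\<alpha>s @ \<beta>s) \<subseteq> normalised_states A"
    using \<beta>s unfolding pure_maximal_set_def perfectly_distinguishable_def by blast
  have sum: "(\<Sum>i<length ps. ps ! i * f ((?\<alpha>s @ \<beta>s) ! i)) = (\<Sum>i<n. p i * f (\<alpha> i))" for f :: "'b \<Rightarrow> real"
  proof -
    have "(\<Sum>i<length ps. ps ! i * f ((?\<alpha>s @ \<beta>s) ! i)) = (\<Sum>i<n. ps ! i * f ((?\<alpha>s @ \<beta>s) ! i))"
      by (rule sum.mono_neutral_right) (auto simp: ps_def nth_append)
    also have "\<dots> = (\<Sum>i<n. p i * f (\<alpha> i))" by (intro sum.cong) (auto simp: ps_def nth_append)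
    finally show ?thesis .
  qed
  have "is_spectrum A \<rho> ps"
    unfolding is_spectrum_def
  proof (intro conjI exI[of _ "?\<alpha>s @ \<beta>s"])
    show "\<forall>x\<in>set ps. 0 \<le> x" using p by (auto simp: ps_def)
    have "(\<Sum>i<n. p i) = 1"
      using dec[OF discard_transf] \<rho> triangularD(1)[OF tri] by (simp add: normalised_discard)
    then show "sum_list ps = 1"
      using sum[of "\<lambda>_. 1"] by (simp add: sum_list_sum_nth atLeast0LessThan)
    show "is_lincomb \<one> A \<rho> {..<length ps} ((!) ps) ((!) (?\<alpha>s @ \<beta>s))"
    proof (subst lincomb_state[OF \<rho>t])
      show "(?\<alpha>s @ \<beta>s) ! i \<in> St A" if "i \<in> {..<length ps}" for i
        using norm that len normalised_state by (metis lessThan_iff nth_mem subsetD)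
      show "\<forall>c\<in>Eff A. pr c \<rho> = (\<Sum>i<length ps. ps ! i * pr c ((?\<alpha>s @ \<beta>s) ! i))"
      proof
        fix c assume "c \<in> Eff A"
        then show "pr c \<rho> = (\<Sum>i<length ps. ps ! i * pr c ((?\<alpha>s @ \<beta>s) ! i))"
          unfolding sum[of "\<lambda>x. pr c x"] by (rule dec)
      qed
    qed
  qed (use \<beta>s len in simp_all)
  then show ?thesis by blast
qed

section \<open>Unital channels\<close>

lemma pure_maximal_setE:
  assumes "pure_maximal_set A \<alpha>s"
  obtains es where "es \<in> tests T A \<one>" "length es = length \<alpha>s"
    "\<And>i. i < length \<alpha>s \<Longrightarrow> \<alpha>s ! i \<in> normalised_states A" "\<And>i. i < length \<alpha>s \<Longrightarrow> \<alpha>s ! i \<in> St A"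
    "\<And>i. i < length \<alpha>s \<Longrightarrow> es ! i \<in> Eff A"
    "\<And>i j. i < length \<alpha>s \<Longrightarrow> j < length \<alpha>s \<Longrightarrow> pr (es ! i) (\<alpha>s ! j) = (if i = j then 1 else 0)"
proof -
  obtain es where es: "set \<alpha>s \<subseteq> normalised_states A" "es \<in> tests T A \<one>" "length es = length \<alpha>s"
    "\<forall>i < length \<alpha>s. \<forall>j < length \<alpha>s. pr (es ! i) (\<alpha>s ! j) = (if i = j then 1 else 0)"
    using assms unfolding pure_maximal_set_def perfectly_distinguishable_def by blast
  have \<alpha>: "\<alpha>s ! i \<in> normalised_states A" if "i < length \<alpha>s" for i using es(1) that by auto
  show thesis
    using es(3,4) by (intro that[OF es(2,3) \<alpha> normalised_state[OF \<alpha>] test_nth[OF es(2)]]) auto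
qed

lemma spectrumE:
  assumes "is_spectrum A \<rho> p" "\<rho> \<in> normalised_states A"
  obtains \<alpha>s where "pure_maximal_set A \<alpha>s" "length \<alpha>s = length p"
    "\<And>a. a \<in> Eff A \<Longrightarrow> pr a \<rho> = (\<Sum>i<length p. p ! i * pr a (\<alpha>s ! i))"
proof -
  obtain \<alpha>s where \<alpha>s: "pure_maximal_set A \<alpha>s" "length \<alpha>s = length p"
    and lin: "is_lincomb \<one> A \<rho> {..<length p} (\<lambda>i. p ! i) (\<lambda>i. \<alpha>s ! i)"
    using assms(1) unfolding is_spectrum_def by blast
  have "\<alpha>s ! i \<in> St A" if i: "i < length \<alpha>s" for i
    by (rule pure_maximal_setE[OF \<alpha>s(1)]) (use i in blast)
  then have "\<forall>a \<in> Eff A. pr a \<rho> = (\<Sum>i<length p. p ! i * pr a (\<alpha>s ! i))"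
    using lin lincomb_state[OF normalised_state[OF assms(2)], of "{..<length p}" "\<lambda>i. \<alpha>s ! i"] \<alpha>s(2) by simp
  then show thesis using that[OF \<alpha>s] by blast
qed

lemma spectrum_length:
  assumes "is_spectrum A \<rho> p"
  shows "length p = dimension A"
  using assms dimension_eq(1) unfolding is_spectrum_def by metis

lemma state_of_spectrum:
  assumes "pure_maximal_set A \<alpha>s" "length p = length \<alpha>s" "\<forall>x\<in>set p. 0 \<le> x" "sum_list p = 1"
  shows "\<exists>\<rho> \<in> normalised_states A. (\<forall>a \<in> Eff A. pr a \<rho> = (\<Sum>i<length p. p ! i * pr a (\<alpha>s ! i))) \<and> is_spectrum A \<rho> p"
proof -
  obtain es where \<alpha>: "\<And>i. i < length \<alpha>s \<Longrightarrow> \<alpha>s ! i \<in> normalised_states A" "\<And>i. i < length \<alpha>s \<Longrightarrow> \<alpha>s ! i \<in> St A"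
    by (rule pure_maximal_setE[OF assms(1)]) (rule that)
  have one: "(\<Sum>i<length p. p ! i * pr (discard A) (\<alpha>s ! i)) = 1"
    using \<alpha>(1) assms(2,4) by (simp add: normalised_discard sum_list_sum_nth atLeast0LessThan)
  obtain \<rho> where \<rho>: "\<rho> \<in> St A" "\<forall>a \<in> Eff A. pr a \<rho> = (\<Sum>i<length p. p ! i * pr a (\<alpha>s ! i))"
    using conic_combination[of "{..<length p}" "\<lambda>i. \<alpha>s ! i" A "\<lambda>i. p ! i"] \<alpha>(2) assms(2,3) one by auto
  have "\<rho> \<in> normalised_states A" using \<rho> one by (simp add: normalised_iff)
  moreover have "is_lincomb \<one> A \<rho> {..<length p} (\<lambda>i. p ! i) (\<lambda>i. \<alpha>s ! i)"
    using lincomb_state[OF \<rho>(1), of "{..<length p}" "\<lambda>i. \<alpha>s ! i" "\<lambda>i. p ! i"] \<rho>(2) \<alpha>(2) assms(2) by simp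
  moreover from this have "is_spectrum A \<rho> p"
    unfolding is_spectrum_def using assms(3,4)
    by (intro conjI exI[of _ \<alpha>s] assms(1) assms(2)[symmetric]) blast+
  ultimately show ?thesis using \<rho>(2) by blast
qed

lemma unital_channel_majorisation:
  assumes "unital A D" "\<rho> \<in> normalised_states A" "is_spectrum A \<rho> p" "is_spectrum A (D \<cdot> \<rho>) p'"
  shows "p' \<preceq> p"
proof -
  define n where "n = length p"
  have D: "channel A A D" "D \<cdot> microcanonical A = microcanonical A" using assms(1) by (simp_all add: unital_def)
  have Dt: "D \<in> transf A A" using channel_transf[OF D(1)] .
  have \<sigma>: "D \<cdot> \<rho> \<in> normalised_states A" using channel_normalised_state[OF D(1) assms(2)] .
  obtain \<alpha>s where \<alpha>s: "pure_maximal_set A \<alpha>s" "length \<alpha>s = length p"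
    and \<rho>: "\<And>a. a \<in> Eff A \<Longrightarrow> pr a \<rho> = (\<Sum>i<length p. p ! i * pr a (\<alpha>s ! i))"
    by (rule spectrumE[OF assms(3,2)]) (rule that)
  obtain \<beta>s where \<beta>s: "pure_maximal_set A \<beta>s" "length \<beta>s = length p'"
    and \<sigma>pr: "\<And>a. a \<in> Eff A \<Longrightarrow> pr a (D \<cdot> \<rho>) = (\<Sum>i<length p'. p' ! i * pr a (\<beta>s ! i))"
    by (rule spectrumE[OF assms(4) \<sigma>]) (rule that)
  have len: "length p' = n" "length \<alpha>s = n" "length \<beta>s = n"
    using spectrum_length[OF assms(3)] spectrum_length[OF assms(4)] \<alpha>s(2) \<beta>s(2) by (simp_all add: n_def)
  have n0: "n > 0" using dimension_eq(2)[OF \<alpha>s(1)] len by simp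
  obtain es where es: "es \<in> tests T A \<one>" "length es = length \<beta>s" "\<And>i. i < length \<beta>s \<Longrightarrow> es ! i \<in> Eff A"
    "\<And>i j. i < length \<beta>s \<Longrightarrow> j < length \<beta>s \<Longrightarrow> pr (es ! i) (\<beta>s ! j) = (if i = j then 1 else 0)"
    by (rule pure_maximal_setE[OF \<beta>s(1)]) (rule that)
  note es' = es[unfolded len]
  obtain fs where \<alpha>: "\<And>i. i < length \<alpha>s \<Longrightarrow> \<alpha>s ! i \<in> normalised_states A" "\<And>i. i < length \<alpha>s \<Longrightarrow> \<alpha>s ! i \<in> St A"
    by (rule pure_maximal_setE[OF \<alpha>s(1)]) (rule that)
  note \<alpha>' = \<alpha>[unfolded len]
  \<comment> \<open>Transition probabilities: the chance of finding the \<open>i\<close>-th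
    eigenstate of the output after sending in the \<open>j\<close>-th eigenstate of the input.
    Columns sum to 1 because \<open>D\<close> is a channel, rows because \<open>D\<close> is unital
    and \<open>microcanonical A\<close> is the uniform mixture of either set.\<close>
  define S where "S i j = pr (es ! i) (D \<cdot> \<alpha>s ! j)" for i j
  have SD: "S i j = pr (es ! i \<cdot> D) (\<alpha>s ! j)" if "i < n" "j < n" for i j
    unfolding S_def using pr_seq[OF \<alpha>'(2)[OF that(2)] Dt es'(3)[OF that(1)]] by simp
  have "doubly_stochastic n S"
  proof (rule doubly_stochasticI)
    show "0 \<le> S i j" if "i < n" "j < n" for i j
      unfolding S_def using pr_nonneg[OF seq_transf[OF \<alpha>'(2)[OF that(2)] Dt] es'(3)[OF that(1)]] .
    show "(\<Sum>i<n. S i j) = 1" if "j < n" for j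
      unfolding S_def
      using effect_test_sum[OF es'(1) seq_transf[OF \<alpha>'(2)[OF that] Dt]] es'(2)
        channel_normalised_state[OF D(1) \<alpha>'(1)[OF that]] by (simp add: normalised_discard)
    show "(\<Sum>j<n. S i j) = 1" if i: "i < n" for i
    proof -
      note m = microcanonical_uniform[OF \<alpha>s(1), unfolded len] microcanonical_uniform[OF \<beta>s(1), unfolded len]
      have "(\<Sum>j<n. S i j) = (\<Sum>j<n. pr (es ! i \<cdot> D) (\<alpha>s ! j))" using SD[OF i] by simp
      also have "\<dots> = n * pr (es ! i \<cdot> D) (microcanonical A)"
        using m(1)[OF seq_transf[OF Dt es'(3)[OF i]]] n0 by simp
      also have "pr (es ! i \<cdot> D) (microcanonical A) = pr (es ! i) (microcanonical A)"
        using pr_seq[OF normalised_state[OF microcanonical_normalised] Dt es'(3)[OF i]] D(2) by simp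
      also have "real n * \<dots> = (\<Sum>j<n. pr (es ! i) (\<beta>s ! j))" using m(2)[OF es'(3)[OF i]] n0 by simp
      also have "\<dots> = 1" using es'(4)[OF i] i by simp
      finally show ?thesis .
    qed
  qed
  moreover have "p' ! i = (\<Sum>j<n. S i j * p ! j)" if i: "i < n" for i
  proof -
    have "(\<Sum>j<n. p' ! j * pr (es ! i) (\<beta>s ! j)) = (\<Sum>j<n. if i = j then p' ! j else 0)"
      using es'(4)[OF i] by (intro sum.cong) auto
    then have "p' ! i = pr (es ! i) (D \<cdot> \<rho>)" using \<sigma>pr[OF es'(3)[OF i]] len i by simp
    also have "\<dots> = pr (es ! i \<cdot> D) \<rho>" using pr_seq[OF normalised_state[OF assms(2)] Dt es'(3)[OF i]] by simp
    also have "\<dots> = (\<Sum>j<n. p ! j * S i j)"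
      using \<rho>[OF seq_transf[OF Dt es'(3)[OF i]]] SD[OF i] by (simp add: n_def)
    finally show ?thesis by (simp add: mult.commute)
  qed
  ultimately show ?thesis using majorised_by_iff_doubly_stochastic[OF len(1) n_def[symmetric]] by blast
qed

text \<open>The channel measures the eigenstates of \<open>\<rho>\<close> and prepares mixtures of those of \<open>\<sigma>\<close> with
  doubly stochastic weights.  It is unital because both pure maximal sets mix uniformly to the
  microcanonical state.\<close>

lemma majorisation_unital_channel:
  assumes "\<rho> \<in> normalised_states A" "\<sigma> \<in> normalised_states A" "is_spectrum A \<rho> p" "is_spectrum A \<sigma> p'"
    and "p' \<preceq> p"
  shows "\<exists>D. unital A D \<and> \<sigma> = D \<cdot> \<rho>"
proof -
  define n where "n = length p"
  obtain \<alpha>s where \<alpha>s: "pure_maximal_set A \<alpha>s" "length \<alpha>s = length p"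
    and \<rho>: "\<And>a. a \<in> Eff A \<Longrightarrow> pr a \<rho> = (\<Sum>i<length p. p ! i * pr a (\<alpha>s ! i))"
    by (rule spectrumE[OF assms(3,1)]) (rule that)
  obtain \<beta>s where \<beta>s: "pure_maximal_set A \<beta>s" "length \<beta>s = length p'"
    and \<sigma>: "\<And>a. a \<in> Eff A \<Longrightarrow> pr a \<sigma> = (\<Sum>i<length p'. p' ! i * pr a (\<beta>s ! i))"
    by (rule spectrumE[OF assms(4,2)]) (rule that)
  have len: "length p' = n" "length \<alpha>s = n" "length \<beta>s = n"
    using spectrum_length[OF assms(3)] spectrum_length[OF assms(4)] \<alpha>s(2) \<beta>s(2) by (simp_all add: n_def)
  have n0: "n > 0" using dimension_eq(2)[OF \<alpha>s(1)] len by simp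
  obtain es where es: "es \<in> tests T A \<one>" "length es = length \<alpha>s" "\<And>i. i < length \<alpha>s \<Longrightarrow> es ! i \<in> Eff A"
    "\<And>i j. i < length \<alpha>s \<Longrightarrow> j < length \<alpha>s \<Longrightarrow> pr (es ! i) (\<alpha>s ! j) = (if i = j then 1 else 0)"
    by (rule pure_maximal_setE[OF \<alpha>s(1)]) (rule that)
  note es' = es[unfolded len]
  obtain fs where \<beta>: "\<And>i. i < length \<beta>s \<Longrightarrow> \<beta>s ! i \<in> normalised_states A" "\<And>i. i < length \<beta>s \<Longrightarrow> \<beta>s ! i \<in> St A"
    by (rule pure_maximal_setE[OF \<beta>s(1)]) (rule that)
  note \<beta>' = \<beta>[unfolded len]
  obtain S where S: "doubly_stochastic n S" and p': "\<And>i. i < n \<Longrightarrow> p' ! i = (\<Sum>j<n. S i j * p ! j)"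
    using assms(5) majorised_by_iff_doubly_stochastic[OF len(1) n_def[symmetric]] by blast
  \<comment> \<open>Column \<open>j\<close> of \<open>S\<close> is the distribution of the
    eigenstates of \<open>\<sigma>\<close> to be prepared after outcome \<open>j\<close>.\<close>
  have "\<exists>r. j < n \<longrightarrow> r \<in> normalised_states A \<and> (\<forall>a \<in> Eff A. pr a r = (\<Sum>i<n. S i j * pr a (\<beta>s ! i)))" for j
  proof (cases "j < n")
    case True
    have one: "(\<Sum>i<n. S i j * pr (discard A) (\<beta>s ! i)) = 1"
      using \<beta>'(1) doubly_stochasticD(3)[OF S True] by (simp add: normalised_discard)
    obtain r where "r \<in> St A" "\<forall>a \<in> Eff A. pr a r = (\<Sum>i<n. S i j * pr a (\<beta>s ! i))"
      using conic_combination[of "{..<n}" "\<lambda>i. \<beta>s ! i" A "\<lambda>i. S i j"] \<beta>'(2) doubly_stochasticD(1)[OF S _ True] one by auto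
    then show ?thesis using one by (intro exI[of _ r]) (simp add: normalised_iff)
  qed auto
  then obtain r where r_all: "\<forall>j. j < n \<longrightarrow> r j \<in> normalised_states A \<and> (\<forall>a \<in> Eff A. pr a (r j) = (\<Sum>i<n. S i j * pr a (\<beta>s ! i)))"
    by metis
  have r: "r j \<in> normalised_states A" "a \<in> Eff A \<Longrightarrow> pr a (r j) = (\<Sum>i<n. S i j * pr a (\<beta>s ! i))" if "j < n" for j a
    using r_all that by blast+
  let ?F = "\<lambda>j. r j \<cdot> es ! j"
  have "concat (map (\<lambda>j. map (\<lambda>G. G \<cdot> (es ! j)) [r j]) [0..<length es]) \<in> tests T A A"
    by (rule test_conditional[OF es'(1)]) (use r(1) normalised_channel es'(2) in \<open>auto simp: channel_def\<close>)
  then have "concat (map (\<lambda>j. [r j \<cdot> es ! j]) [0..<n]) \<in> tests T A A" using es'(2) by simp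
  then have test: "map ?F [0..<n] \<in> tests T A A" by (simp only: concat_map_singleton)
  then obtain D where D: "channel A A D" "is_sum A A D {..<length (map ?F [0..<n])} (\<lambda>i. map ?F [0..<n] ! i)"
    using total_coarse_graining[OF test] n0 by auto
  have Dt: "D \<in> transf A A" using channel_transf[OF D(1)] .
  have Ft: "?F j \<in> transf A A" if "j < n" for j
    using seq_transf[OF es'(3)[OF that] normalised_state[OF r(1)[OF that]]] .
  have lin: "is_lincomb A A D {..<n} (\<lambda>_. 1) ?F"
    using D(2) by (simp add: is_sum_def is_lincomb_def)
  have Dpr: "pr a (D \<cdot> \<tau>) = (\<Sum>j<n. pr (es ! j) \<tau> * (\<Sum>i<n. S i j * pr a (\<beta>s ! i)))"
    if \<tau>: "\<tau> \<in> St A" and a: "a \<in> Eff A" for \<tau> a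
  proof -
    have "is_lincomb \<one> A (D \<cdot> \<tau>) {..<n} (\<lambda>_. 1) (\<lambda>j. ?F j \<cdot> \<tau>)"
      by (rule lincomb_pre[OF Dt _ \<tau> lin]) (use Ft in auto)
    then have "pr a (D \<cdot> \<tau>) = (\<Sum>j<n. pr a (?F j \<cdot> \<tau>))"
      using lincomb_state[OF seq_transf[OF \<tau> Dt], of "{..<n}" "\<lambda>j. ?F j \<cdot> \<tau>" "\<lambda>_. 1"] seq_transf[OF \<tau> Ft] a by simp
    also have "\<dots> = (\<Sum>j<n. pr (es ! j) \<tau> * pr a (r j))"
    proof (rule sum.cong[OF refl])
      fix j assume "j \<in> {..<n}"
      then have j: "j < n" by simp
      show "pr a (?F j \<cdot> \<tau>) = pr (es ! j) \<tau> * pr a (r j)"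
        using seq_assoc[OF \<tau> es'(3)[OF j] normalised_state[OF r(1)[OF j]]]
          pr_scaled_state[OF seq_transf[OF \<tau> es'(3)[OF j]] normalised_state[OF r(1)[OF j]] a] by simp
    qed
    also have "\<dots> = (\<Sum>j<n. pr (es ! j) \<tau> * (\<Sum>i<n. S i j * pr a (\<beta>s ! i)))" using r(2)[OF _ a] by simp
    finally show ?thesis .
  qed
  \<comment> \<open>Used twice: with the spectrum \<open>p\<close> for \<open>t\<close> it produces
    the spectrum \<open>p'\<close>, with the constant \<open>1 / n\<close> it produces the row sums
    of \<open>S\<close>, which give unitality.\<close>
  have mix: "(\<Sum>j<n. t j * (\<Sum>i<n. S i j * f i)) = (\<Sum>i<n. (\<Sum>j<n. S i j * t j) * f i)" for t f :: "nat \<Rightarrow> real"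
    unfolding sum_distrib_left sum_distrib_right by (subst sum.swap) (simp add: mult_ac)
  have "\<sigma> = D \<cdot> \<rho>"
  proof (rule state_eqI[OF normalised_state[OF assms(2)] seq_transf[OF normalised_state[OF assms(1)] Dt]])
    fix a assume a: "a \<in> Eff A"
    have "pr (es ! j) \<rho> = p ! j" if j: "j < n" for j
    proof -
      have "pr (es ! j) \<rho> = (\<Sum>i<n. if j = i then p ! i else 0)"
        unfolding \<rho>[OF es'(3)[OF j]] n_def[symmetric] using es'(4)[OF j] by (intro sum.cong) auto
      then show ?thesis using j by simp
    qed
    then have "pr a (D \<cdot> \<rho>) = (\<Sum>j<n. p ! j * (\<Sum>i<n. S i j * pr a (\<beta>s ! i)))"
      unfolding Dpr[OF normalised_state[OF assms(1)] a] by (intro sum.cong) auto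
    also have "\<dots> = (\<Sum>i<n. p' ! i * pr a (\<beta>s ! i))" unfolding mix using p' by simp
    also have "\<dots> = pr a \<sigma>" using \<sigma>[OF a] len by simp
    finally show "pr a \<sigma> = pr a (D \<cdot> \<rho>)" by simp
  qed
  moreover have "D \<cdot> microcanonical A = microcanonical A"
  proof (rule state_eqI)
    note mt = normalised_state[OF microcanonical_normalised[of A]]
    show "D \<cdot> microcanonical A \<in> St A" "microcanonical A \<in> St A" using seq_transf[OF mt Dt] mt by auto
    fix a assume a: "a \<in> Eff A"
    note m = microcanonical_uniform[OF \<alpha>s(1), unfolded len] microcanonical_uniform[OF \<beta>s(1), unfolded len]
    have "pr (es ! j) (microcanonical A) = 1 / n" if j: "j < n" for j
      using m(1)[OF es'(3)[OF j]] es'(4)[OF j] j by simp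
    then have "pr a (D \<cdot> microcanonical A) = (\<Sum>j<n. 1 / n * (\<Sum>i<n. S i j * pr a (\<beta>s ! i)))"
      unfolding Dpr[OF mt a] by (intro sum.cong) auto
    also have "\<dots> = (\<Sum>i<n. 1 / n * pr a (\<beta>s ! i))"
      unfolding mix using doubly_stochasticD(2)[OF S] by (intro sum.cong) (auto simp flip: sum_divide_distrib)
    also have "\<dots> = pr a (microcanonical A)" using m(2)[OF a] by (simp flip: sum_divide_distrib)
    finally show "pr a (D \<cdot> microcanonical A) = pr a (microcanonical A)" .
  qed
  ultimately show ?thesis using D(1) by (auto simp: unital_def)
qed

text \<open>Conversion by unital channels and majorisation of spectra are the same preorder, so
  monotonicity of \<open>P\<close> is Schur-convexity on probability vectors. What remains is an
  extension to all vectors of length \<open>dimension A\<close>.\<close>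

theorem unital_purity_monotone_iff:
  "unital_purity_monotone A P \<longleftrightarrow> (\<exists>f. schur_convex (dimension A) f \<and>
     (\<forall>\<rho> \<in> normalised_states A. \<forall>p. is_spectrum A \<rho> p \<longrightarrow> P \<rho> = f p))"
proof
  assume "\<exists>f. schur_convex (dimension A) f \<and> (\<forall>\<rho> \<in> normalised_states A. \<forall>p. is_spectrum A \<rho> p \<longrightarrow> P \<rho> = f p)"
  then obtain f where f: "schur_convex (dimension A) f"
    and P: "\<And>\<rho> p. \<rho> \<in> normalised_states A \<Longrightarrow> is_spectrum A \<rho> p \<Longrightarrow> P \<rho> = f p" by blast
  show "unital_purity_monotone A P"
    unfolding unital_purity_monotone_def
  proof (intro ballI impI)
    fix \<rho> \<sigma> assume \<rho>: "\<rho> \<in> normalised_states A" and \<sigma>: "\<sigma> \<in> normalised_states A" and "\<exists>D. unital A D \<and> \<sigma> = D \<cdot> \<rho>"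
    then obtain D where D: "unital A D" "\<sigma> = D \<cdot> \<rho>" by blast
    obtain p p' where p: "is_spectrum A \<rho> p" "is_spectrum A \<sigma> p'" using spectrum_exists \<rho> \<sigma> by metis
    have "p' \<preceq> p" using unital_channel_majorisation[OF D(1) \<rho> p(1)] p(2) D(2) by simp
    then have "f p' \<le> f p" using f spectrum_length[OF p(1)] spectrum_length[OF p(2)] unfolding schur_convex_def by blast
    then show "P \<sigma> \<le> P \<rho>" using P[OF \<rho> p(1)] P[OF \<sigma> p(2)] by simp
  qed
next
  assume mono: "unital_purity_monotone A P"
  define d where "d = dimension A"
  obtain \<alpha>s where \<alpha>s: "pure_maximal_set A \<alpha>s" using pure_maximal_set_exists by blast
  have len: "length \<alpha>s = d" "d > 0" using dimension_eq[OF \<alpha>s] by (simp_all add: d_def)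
  obtain m where m: "d = Suc m" using len(2) by (cases d) auto
  define prob_vec where "prob_vec x \<longleftrightarrow> length x = d \<and> (\<forall>z\<in>set x. 0 \<le> z) \<and> sum_list x = 1" for x :: "real list"
  \<comment> \<open>A representative state for each spectrum. The choice is harmless: states with a
    common spectrum are related by unital channels in both directions, so \<open>P\<close> agrees on
    them.\<close>
  define st where "st x = (SOME \<rho>. \<rho> \<in> normalised_states A \<and> is_spectrum A \<rho> x)" for x
  have st: "st x \<in> normalised_states A" "is_spectrum A (st x) x" if "prob_vec x" for x
  proof -
    have "\<exists>\<rho>. \<rho> \<in> normalised_states A \<and> is_spectrum A \<rho> x"
      using state_of_spectrum[OF \<alpha>s, of x] that len(1) unfolding prob_vec_def by auto
    from someI_ex[OF this] show "st x \<in> normalised_states A" "is_spectrum A (st x) x"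
      unfolding st_def by auto
  qed
  have spec: "prob_vec p" if "is_spectrum A \<rho> p" for \<rho> p
    using that spectrum_length[OF that] unfolding is_spectrum_def prob_vec_def d_def by blast
  have le: "P \<sigma> \<le> P \<rho>" if "\<rho> \<in> normalised_states A" "\<sigma> \<in> normalised_states A"
    "is_spectrum A \<rho> x" "is_spectrum A \<sigma> y" "y \<preceq> x" for \<rho> \<sigma> x y
    using majorisation_unital_channel[OF that] mono that(1,2) unfolding unital_purity_monotone_def by blast
  let ?e = "1 # replicate m 0"
  have e: "prob_vec ?e" using m by (simp add: prob_vec_def sum_list_replicate)
  have below: "x \<preceq> ?e" if "prob_vec x" for x
    using probability_majorised_by_unit[of x m] that m by (simp add: prob_vec_def)
  \<comment> \<open>Vectors majorising a probability vector need not be probability vectors; they get the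
    largest value, the one at pure states.\<close>
  define f where "f x = (if prob_vec x then P (st x) else P (st ?e))" for x
  have "schur_convex d f"
    unfolding schur_convex_def
  proof (intro allI impI)
    fix x y :: "real list" assume xy: "length x = d" "length y = d" "x \<preceq> y"
    consider "prob_vec x" "prob_vec y" | "prob_vec x" "\<not> prob_vec y" | "\<not> prob_vec x" "\<not> prob_vec y" | "\<not> prob_vec x" "prob_vec y"
      by blast
    then show "f x \<le> f y"
    proof cases
      case 1
      then show ?thesis using le[OF st(1)[OF 1(2)] st(1)[OF 1(1)] st(2)[OF 1(2)] st(2)[OF 1(1)] xy(3)] by (simp add: f_def)
    next
      case 2
      then show ?thesis using le[OF st(1)[OF e] st(1)[OF 2(1)] st(2)[OF e] st(2)[OF 2(1)] below[OF 2(1)]] by (simp add: f_def)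
    next
      case 3
      then show ?thesis by (simp add: f_def)
    next
      case 4
      \<comment> \<open>This case is void, since a doubly stochastic matrix takes probability
        vectors to probability vectors.\<close>
      obtain S where S: "doubly_stochastic d S" "\<And>i. i < d \<Longrightarrow> x ! i = (\<Sum>j<d. S i j * y ! j)"
        using xy(3) majorised_by_iff_doubly_stochastic[OF xy(1,2)] by blast
      have "0 \<le> x ! i" if "i < d" for i
        unfolding S(2)[OF that] using doubly_stochasticD(1)[OF S(1) that] 4(2) xy(2)
        by (intro sum_nonneg mult_nonneg_nonneg) (auto simp: prob_vec_def)
      moreover have "sum_list x = 1" using xy(3) 4(2) by (simp add: majorised_by_def prob_vec_def)
      ultimately have "prob_vec x" using xy(1) by (auto simp: prob_vec_def in_set_conv_nth)
      then show ?thesis using 4(1) by simp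
    qed
  qed
  moreover have "P \<rho> = f p" if \<rho>: "\<rho> \<in> normalised_states A" and p: "is_spectrum A \<rho> p" for \<rho> p
  proof -
    note v = spec[OF p]
    have "p \<preceq> p" by (simp add: majorised_by_def)
    then have "P \<rho> = P (st p)"
      using le[OF \<rho> st(1)[OF v] p st(2)[OF v]] le[OF st(1)[OF v] \<rho> st(2)[OF v] p] by simp
    then show ?thesis using v by (simp add: f_def)
  qed
  ultimately show "\<exists>f. schur_convex (dimension A) f \<and> (\<forall>\<rho> \<in> normalised_states A. \<forall>p. is_spectrum A \<rho> p \<longrightarrow> P \<rho> = f p)"
    unfolding d_def by blast
qed

end

theorem proposition5p4p2:
  fixes T :: "('s, 't) opt" and A :: 's and d :: nat and P :: "'t \<Rightarrow> real"
  assumes "sharp_theory_with_purification T"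
    and "opt_data.dimension T A = d"
  shows "opt_data.unital_purity_monotone T A P \<longleftrightarrow>
    (\<exists>f :: real list \<Rightarrow> real. schur_convex d f \<and>
      (\<forall>\<rho> \<in> opt_data.normalised_states T A.
         \<forall>p. opt_data.is_spectrum T A \<rho> p \<longrightarrow> P \<rho> = f p))"
  using sharp_theory_with_purification.unital_purity_monotone_iff[OF assms(1), of A P] assms(2) by simp

end
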